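(* For $t,k,r\in\mathbb{N}$ let $$\mathcal{U}_{t,k,r}(a;q)=\sum_{1\le n_1<n_2<\cdots<n_t}\frac{q^{r(n_1+n_2+\cdots+n_t)}}{(1+aq^{n_1}+q^{2n_1})^k\cdots(1+aq^{n_t}+q^{2n_t})^k},\qquad \mathcal{U}_{k,r}(a;q)=\mathcal{U}_{1,k,r}(a;q)=\sum_{n\ge1}\frac{q^{rn}}{(1+aq^n+q^{2n})^k}.$$ Let $t,k\in\mathbb{N}$. Then the following hold. (1) With $q=e^{2\pi i\tau}$, $\tau\in\mathbb{H}$, $\mathcal{U}_{k,k}(a;q)$ is a mixed weight quasimodular form of highest weight $k$ and level $4$, $3$, $6$ for $a=0$, $1$, $-1$, respectively, and of highest weight $2k$ and level $2$ for $a=2$. Moreover, $\mathcal{U}_{k,k}(0;q)$ is a (mixed weight) modular form when $k$ is odd. (2) $\mathcal{U}_{t,k,k}(a;q)$ is an isobaric polynomial of degree $t$ in the variables $\mathcal{U}_{k,k}(a;q),\mathcal{U}_{2k,2k}(a;q),\ldots,\mathcal{U}_{tk,tk}(a;q)$. In particular, $\mathcal{U}_{t,k,k}(a;q)$ is a mixed weight quasimodular form with highest weight $tk$ and level $4$, $3$, $6$ for $a=0$, $1$, $-1$, respectively, and with highest weight $2tk$ and level $2$ for $a=2$.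
   Context: $\mathbb{N}=\{1,2,3,\ldots\}$; $\mathbb{H}$ is the complex upper half-plane. For general $a\in\mathbb{C}$ the series $\mathcal{U}_{t,k,r}(a;q)$ are regarded as formal power series in $q$; for $a\in\{0,\pm1,2\}$ they converge for $|q|<1$. An isobaric polynomial of degree $t$ in variables $X_1,\ldots,X_t$ is a polynomial (here with rational coefficients) all of whose monomials $X_1^{a_1}X_2^{a_2}\cdots X_t^{a_t}$ satisfy $a_1+2a_2+\cdots+ta_t=t$. In part (2), $X_s$ is replaced by $\mathcal{U}_{sk,sk}(a;q)$. $\Gamma_0(N)=\{\begin{pmatrix}a&b\\c&d\end{pmatrix}\in\mathrm{SL}_2(\mathbb{Z}): c\equiv0 \pmod N\}$. A holomorphic function $g:\mathbb{H}\to\mathbb{C}$ is a quasimodular form of weight $w\in\mathbb{Z}$, depth $h\ge 0$ and Dirichlet character $\chi$ (modulo $N$) on $\Gamma_0(N)$ if there are holomorphic $g_0,\ldots,g_h:\mathbb{H}\to\mathbb{C}$, $g_h\ne0$, with $$g\Big(\frac{a\tau+b}{c\tau+d}\Big)=\chi(d)(c\tau+d)^{w}\sum_{j=0}^h g_j(\tau)\Big(\frac{c}{c\tau+d}\Big)^j\quad\text{for all }\begin{pmatrix}a&b\\c&d\end{pmatrix}\in\Gamma_0(N),$$ and such that $(c\tau+d)^{-(w-2r)}g_r\big(\frac{a\tau+b}{c\tau+d}\big)$ is bounded as $\mathrm{Im}(\tau)\to\infty$ for all $r\in\{0,\ldots,h\}$ and all $\begin{pmatrix}a&b\\c&d\end{pmatrix}\in\mathrm{SL}_2(\mathbb{Z})$.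 The zero function is also counted as quasimodular of every weight. Modular forms are the case of depth $h=0$ (together with $0$). "Level $N$" means (quasi)modular on $\Gamma_0(N)$ (with some Dirichlet character modulo $N$). A mixed weight (quasi)modular form of highest weight $w$ and level $N$ is a finite sum of (quasi)modular forms of level $N$ (constants, of weight $0$, being allowed) whose weights are all at most $w$; the summands may have different characters modulo $N$. *)

theory Defs
  imports
    "HOL-Analysis.Analysis"
    "HOL-Computational_Algebra.Formal_Power_Series"
    "HOL-Library.Poly_Mapping"
begin

subsection \<open>The series\<close>

text \<open>
  The summation range \<open>1 \<le> n\<^sub>1 < \<dots> < n\<^sub>t\<close> is encoded by the \<open>t\<close>-element sets \<open>{n\<^sub>1, \<dots>, n\<^sub>t}\<close> of positive
  integers. The definition is polymorphic so that it covers both readings of the series: with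
  \<open>a = fps_const \<alpha>\<close> and \<open>q = fps_X\<close> it is a formal power series (the sum is then taken in the
  \<open>X\<close>-adic metric on \<^typ>\<open>complex fps\<close>, and the denominators are units), and with complex \<open>a\<close>, \<open>q\<close>
  it is a sum of complex numbers. Both sums exist in the cases used below, namely for all \<open>\<alpha>\<close>
  in the formal case and for \<open>a \<in> {0, 1, -1, 2}\<close>, \<open>|q| < 1\<close> in the complex one (the roots of
  \<open>1 + a x + x\<^sup>2\<close> then lie on the unit circle), always assuming \<open>r > 0\<close>; so the default value of
  \<^const>\<open>infsum\<close> plays no role.
\<close>

definition Useries :: "nat \<Rightarrow> nat \<Rightarrow> nat \<Rightarrow> 'a \<Rightarrow> 'a \<Rightarrow> 'a :: {comm_ring_1, inverse, t2_space}" where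
  "Useries t k r a q =
     (\<Sum>\<^sub>\<infinity>S | S \<subseteq> {1..} \<and> finite S \<and> card S = t.
        q ^ (r * (\<Sum>n\<in>S. n)) / (\<Prod>n\<in>S. (1 + a * q ^ n + q ^ (2 * n)) ^ k))"

definition Useries1 :: "nat \<Rightarrow> nat \<Rightarrow> 'a \<Rightarrow> 'a \<Rightarrow> 'a :: {comm_ring_1, inverse, t2_space}" where
  "Useries1 k r a q = Useries 1 k r a q"

lemma Useries1_altdef:
  "Useries1 k r a q = (\<Sum>\<^sub>\<infinity>n\<in>{1..}. q ^ (r * n) / (1 + a * q ^ n + q ^ (2 * n)) ^ k)"
proof -
  have *: "{S :: nat set. S \<subseteq> {1..} \<and> finite S \<and> card S = 1} = (\<lambda>n. {n}) ` {1..}"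
    by (auto simp: card_1_singleton_iff)
  show ?thesis
    unfolding Useries1_def Useries_def * by (subst infsum_reindex) (auto simp: inj_on_def o_def)
qed

definition U_formal :: "nat \<Rightarrow> nat \<Rightarrow> nat \<Rightarrow> complex \<Rightarrow> complex fps" where
  "U_formal t k r a = Useries t k r (fps_const a) fps_X"

definition U1_formal :: "nat \<Rightarrow> nat \<Rightarrow> complex \<Rightarrow> complex fps" where
  "U1_formal k r a = Useries1 k r (fps_const a) fps_X"

definition qexp :: "complex \<Rightarrow> complex" where
  "qexp \<tau> = exp (2 * of_real pi * \<i> * \<tau>)"


subsection \<open>Isobaric polynomials\<close>

text \<open>
  A polynomial over \<open>\<rat>\<close> in variables \<open>X\<^sub>i\<close> is a finitely supported map from monomials to coefficients,
  a monomial being a finitely supported map from variable indices to exponents.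
\<close>

type_synonym rat_mpoly = "(nat \<Rightarrow>\<^sub>0 nat) \<Rightarrow>\<^sub>0 rat"

definition isobaric :: "nat \<Rightarrow> rat_mpoly \<Rightarrow> bool" where
  "isobaric t P \<longleftrightarrow>
     (\<forall>m \<in> Poly_Mapping.keys P.
        Poly_Mapping.keys m \<subseteq> {1..t} \<and> (\<Sum>i=1..t. i * Poly_Mapping.lookup m i) = t)"

definition eval_rat_mpoly :: "rat_mpoly \<Rightarrow> (nat \<Rightarrow> complex fps) \<Rightarrow> complex fps" where
  "eval_rat_mpoly P x =
     (\<Sum>m \<in> Poly_Mapping.keys P. fps_const (of_rat (Poly_Mapping.lookup P m)) *
        (\<Prod>i \<in> Poly_Mapping.keys m. x i ^ Poly_Mapping.lookup m i))"


subsection \<open>Quasimodular forms\<close>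

definition upper_half_plane :: "complex set" where
  "upper_half_plane = {\<tau>. Im \<tau> > 0}"

text \<open>The quadruple \<open>(a, b, c, d)\<close> stands for the matrix with rows \<open>(a, b)\<close> and \<open>(c, d)\<close>.\<close>

definition SL2Z :: "(int \<times> int \<times> int \<times> int) set" where
  "SL2Z = {(a, b, c, d). a * d - b * c = 1}"

definition Gamma0 :: "nat \<Rightarrow> (int \<times> int \<times> int \<times> int) set" where
  "Gamma0 N = {(a, b, c, d). (a, b, c, d) \<in> SL2Z \<and> int N dvd c}"

definition moebius :: "int \<Rightarrow> int \<Rightarrow> int \<Rightarrow> int \<Rightarrow> complex \<Rightarrow> complex" where
  "moebius a b c d \<tau> = (of_int a * \<tau> + of_int b) / (of_int c * \<tau> + of_int d)"

definition dirichlet_character :: "nat \<Rightarrow> (int \<Rightarrow> complex) \<Rightarrow> bool" where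
  "dirichlet_character N \<epsilon> \<longleftrightarrow>
     (\<forall>m n. \<epsilon> (m * n) = \<epsilon> m * \<epsilon> n) \<and>
     (\<forall>m. \<epsilon> (m + int N) = \<epsilon> m) \<and>
     (\<forall>m. \<epsilon> m \<noteq> 0 \<longleftrightarrow> coprime m (int N))"

text \<open>
  Functions on the upper half-plane are represented by total functions on \<^typ>\<open>complex\<close> whose values
  elsewhere are irrelevant. The filter \<^term>\<open>filtercomap Im at_top\<close> expresses \<open>Im \<tau> \<rightarrow> \<infinity>\<close>
  (uniformly in the real part).
\<close>

definition quasimodular_form ::
    "nat \<Rightarrow> (int \<Rightarrow> complex) \<Rightarrow> int \<Rightarrow> nat \<Rightarrow> (complex \<Rightarrow> complex) \<Rightarrow> bool" where
  "quasimodular_form N \<epsilon> w h g \<longleftrightarrow>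
     g holomorphic_on upper_half_plane \<and>
     (\<exists>G :: nat \<Rightarrow> complex \<Rightarrow> complex.
        (\<forall>j\<le>h. G j holomorphic_on upper_half_plane) \<and>
        (\<exists>\<tau>\<in>upper_half_plane. G h \<tau> \<noteq> 0) \<and>
        (\<forall>(a, b, c, d) \<in> Gamma0 N. \<forall>\<tau>\<in>upper_half_plane.
           g (moebius a b c d \<tau>) =
             \<epsilon> d * (of_int c * \<tau> + of_int d) powi w *
             (\<Sum>j\<le>h. G j \<tau> * (of_int c / (of_int c * \<tau> + of_int d)) ^ j)) \<and>
        (\<forall>r\<le>h. \<forall>(a, b, c, d) \<in> SL2Z.
           Bfun (\<lambda>\<tau>. (of_int c * \<tau> + of_int d) powi (- (w - 2 * int r)) *
                      G r (moebius a b c d \<tau>))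
                (filtercomap Im at_top)))"

definition quasimodular :: "nat \<Rightarrow> int \<Rightarrow> (complex \<Rightarrow> complex) \<Rightarrow> bool" where
  "quasimodular N w g \<longleftrightarrow>
     (\<forall>\<tau>\<in>upper_half_plane. g \<tau> = 0) \<or>
     (\<exists>\<epsilon> h. dirichlet_character N \<epsilon> \<and> quasimodular_form N \<epsilon> w h g)"

definition modular :: "nat \<Rightarrow> int \<Rightarrow> (complex \<Rightarrow> complex) \<Rightarrow> bool" where
  "modular N w g \<longleftrightarrow>
     (\<forall>\<tau>\<in>upper_half_plane. g \<tau> = 0) \<or>
     (\<exists>\<epsilon>. dirichlet_character N \<epsilon> \<and> quasimodular_form N \<epsilon> w 0 g)"

text \<open>The summands may have different weights, depths and characters.\<close>

definition mixed_quasimodular :: "nat \<Rightarrow> int \<Rightarrow> (complex \<Rightarrow> complex) \<Rightarrow> bool" where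
  "mixed_quasimodular N w f \<longleftrightarrow>
     (\<exists>(n :: nat) (g :: nat \<Rightarrow> complex \<Rightarrow> complex) (v :: nat \<Rightarrow> int).
        (\<forall>i<n. v i \<le> w \<and> quasimodular N (v i) (g i)) \<and>
        (\<forall>\<tau>\<in>upper_half_plane. f \<tau> = (\<Sum>i<n. g i \<tau>)))"

definition mixed_modular :: "nat \<Rightarrow> int \<Rightarrow> (complex \<Rightarrow> complex) \<Rightarrow> bool" where
  "mixed_modular N w f \<longleftrightarrow>
     (\<exists>(n :: nat) (g :: nat \<Rightarrow> complex \<Rightarrow> complex) (v :: nat \<Rightarrow> int).
        (\<forall>i<n. v i \<le> w \<and> modular N (v i) (g i)) \<and>
        (\<forall>\<tau>\<in>upper_half_plane. f \<tau> = (\<Sum>i<n. g i \<tau>)))"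

end

theory Submission
  imports Defs "HOL-Complex_Analysis.Complex_Analysis" "HOL-Real_Asymp.Real_Asymp"
begin

text \<open>
  With \<open>x = q\<^sup>n\<close>, the summand of the series is the \<open>k\<close>-th power of \<open>h = x / (1 + a x + x\<^sup>2) = 1 / (x + 1/x + a)\<close>.
  Its poles are \<open>x = \<zeta>\<close> and \<open>x = 1/\<zeta>\<close> where \<open>a = - (\<zeta> + 1/\<zeta>)\<close>, and for \<open>a = 0, 1, -1, 2\<close> the number \<open>\<zeta>\<close> is a
  primitive root of unity of order \<open>N = 4, 3, 6, 2\<close>. These are the orders \<open>N > 1\<close> for which \<open>\<plusminus> 1\<close> are the
  only units modulo \<open>N\<close>.

  Put \<open>x = e\<^bsup>2\<pi>\<i>w\<^esup>\<close> and let \<open>C\<^sub>j\<close> be the \<open>j\<close>-th derivative of \<open>(\<i>/2) cot (\<pi> w)\<close> with respect to \<open>2\<pi>\<i>w\<close>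
  (\<open>dcot\<close>). The power \<open>h\<^sup>k\<close> is a linear combination of the functions \<open>C\<^sub>j (w + 1/N) \<plusminus> C\<^sub>j (w - 1/N)\<close>, the sign being
  \<open>(-1)\<^sup>j\<^sup>+\<^sup>1\<close>, with \<open>j < k\<close>, and with \<open>j < 2k\<close> when \<open>\<zeta> = 1/\<zeta> = -1\<close>. This follows by induction on \<open>k\<close> from the
  differential equation
  \<open>D\<^sup>2 (h\<^sup>k) = k\<^sup>2 h\<^sup>k - a k (2k + 1) h\<^sup>k\<^sup>+\<^sup>1 + (a\<^sup>2 - 4) k (k + 1) h\<^sup>k\<^sup>+\<^sup>2\<close> (\<open>kern_power_second_derivative\<close>). If \<open>a = 0\<close>, only
  exponents of equal parity occur in it, and for odd \<open>k\<close> only even \<open>j\<close> are needed. Summation over \<open>w = n\<tau>\<close>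
  turns the combination into a constant plus a combination of the Eisenstein series
  \<open>E\<^sub>j(z; \<tau>) = \<Sum>\<^bsub>n \<in> \<int>\<^esub> C\<^sub>j (z + n\<tau>)\<close> at \<open>z = 1/N\<close> (\<open>Useries1_as_eis\<close>).

  It remains to see that \<open>E\<^sub>j(1/N; \<tau>)\<close> is a quasimodular form of weight \<open>j + 1\<close>, and modular for \<open>j \<noteq> 1\<close>. As a
  function of \<open>z\<close>, \<open>E\<^sub>0\<close> is odd with simple poles of constant residue on the lattice \<open>\<int> + \<int>\<tau>\<close>; it has the
  period \<open>1\<close>, and it grows by \<open>1\<close> under \<open>z \<mapsto> z + \<tau>\<close>. Therefore
  \<open>E\<^sub>0(z / (c\<tau> + d); (a\<tau> + b) / (c\<tau> + d)) - (c\<tau> + d) E\<^sub>0(z; \<tau>) + c z\<close> is an odd elliptic function without poles,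
  which vanishes by Liouville's theorem (\<open>eis_0_moebius\<close>). Differentiating \<open>j\<close> times with respect to \<open>z\<close> gives
  the weights \<open>j + 1\<close> all at once (\<open>eis_moebius\<close>), the low weights \<open>1\<close> and \<open>2\<close> in the same way as the others.
  The substitution \<open>z = (c\<tau> + d) / N\<close> with \<open>N\<close> dividing \<open>c\<close> and \<open>d \<equiv> \<plusminus> 1\<close> modulo \<open>N\<close> then yields the transformation
  law, with the trivial or the odd character modulo \<open>N\<close> according to the parity of \<open>j\<close> (\<open>eis_torsion_Gamma0\<close>).
  The term \<open>c z\<close> is cancelled by the quasi-period if \<open>j = 0\<close>, and it leaves a constant behind if \<open>j = 1\<close>, the
  only case of depth \<open>1\<close>. Boundedness at the cusps follows from the same formula and the exponential decay of
  the terms.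

  The series with parameter \<open>t\<close> is the \<open>t\<close>-th elementary symmetric function of the \<open>h(q\<^sup>n)\<^sup>k\<close>, whose power sums
  are the series of index \<open>1\<close>. Newton's identities for finitely many variables survive the passage to
  the limit both in formal power series and in complex numbers (\<open>newton_identity_limit\<close>). Solved
  recursively, they produce the isobaric polynomial (\<open>ex_isobaric_newton\<close>), and since products of
  quasimodular forms are quasimodular (\<open>quasimodular_form_mult\<close>), they also give the statement on mixed
  weights.
\<close>

section \<open>Newton's identities, finite and infinite\<close>

text \<open>
  The index set is a finite set of naturals, so that the truncations of the series at
  \<open>n\<^sub>t \<le> M\<close> are literally \<open>esym t {1..M} x\<close>.
\<close>

definition esym :: "nat \<Rightarrow> nat set \<Rightarrow> (nat \<Rightarrow> 'a) \<Rightarrow> 'a :: comm_ring_1" where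
  "esym t A x = (\<Sum>S | S \<subseteq> A \<and> card S = t. \<Prod>n\<in>S. x n)"

lemma esym_0 [simp]: "finite A \<Longrightarrow> esym 0 A x = 1"
proof -
  assume "finite A"
  then have "{S. S \<subseteq> A \<and> card S = 0} = {{}}"
    by (auto dest: finite_subset)
  then show ?thesis by (simp add: esym_def)
qed

lemma esym_Suc_empty [simp]: "esym (Suc t) {} x = 0"
proof -
  have "{S :: nat set. S \<subseteq> {} \<and> card S = Suc t} = {}" by auto
  then show ?thesis unfolding esym_def by (simp only: sum.empty)
qed

lemma esym_Suc_insert:
  assumes "finite A" "y \<notin> A"
  shows "esym (Suc t) (insert y A) x = esym (Suc t) A x + x y * esym t A x"
proof -
  let ?F = "\<lambda>s B. {S. S \<subseteq> B \<and> card S = s}"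
  have split: "?F (Suc t) (insert y A) = ?F (Suc t) A \<union> insert y ` ?F t A"
  proof (intro equalityI subsetI)
    fix S assume S: "S \<in> ?F (Suc t) (insert y A)"
    then have "finite S" using assms by (auto intro: finite_subset)
    show "S \<in> ?F (Suc t) A \<union> insert y ` ?F t A"
    proof (cases "y \<in> S")
      case True
      have "S - {y} \<in> ?F t A" using S True \<open>finite S\<close> by auto
      moreover have "S = insert y (S - {y})" using True by auto
      ultimately show ?thesis by blast
    qed (use S in auto)
  next
    fix S assume "S \<in> ?F (Suc t) A \<union> insert y ` ?F t A"
    then consider "S \<in> ?F (Suc t) A" | T where "S = insert y T" "T \<in> ?F t A"
      by blast
    then show "S \<in> ?F (Suc t) (insert y A)"
    proof cases
      case (2 T)
      then have "finite T" "y \<notin> T" using assms by (auto intro: finite_subset)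
      then show ?thesis using 2 by auto
    qed auto
  qed
  have fin: "finite (?F s A)" for s
    using assms by (auto intro: finite_subset[of _ "Pow A"])
  have "(\<Sum>S\<in>insert y ` ?F t A. \<Prod>n\<in>S. x n) = (\<Sum>S\<in>?F t A. \<Prod>n\<in>insert y S. x n)"
    by (rule sum.reindex_cong[of "insert y"]) (use assms in \<open>auto simp: inj_on_def\<close>)
  also have "\<dots> = (\<Sum>S\<in>?F t A. x y * (\<Prod>n\<in>S. x n))"
    using assms by (intro sum.cong refl prod.insert) (auto intro: finite_subset)
  finally show ?thesis
    unfolding esym_def split using fin assms(2)
    by (subst sum.union_disjoint) (auto simp: sum_distrib_left)
qed

text \<open>
  Adjoining a new element \<open>y\<close> to \<open>A\<close> changes \<open>e\<^sub>s\<close> into \<open>e\<^sub>s + x\<^sub>y e\<^sub>s\<^sub>-\<^sub>1\<close> and \<open>p\<^sub>i\<close> into \<open>p\<^sub>i + x\<^sub>y\<^sup>i\<close>.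
  The old terms add up to \<open>(t + 1) e\<^sub>t\<^sub>+\<^sub>1 + t x\<^sub>y e\<^sub>t\<close> by induction, and the terms with a pure power of
  \<open>x\<^sub>y\<close> telescope to \<open>x\<^sub>y e\<^sub>t\<close>.
\<close>

theorem newton_identity:
  fixes x :: "nat \<Rightarrow> 'a :: comm_ring_1"
  assumes "finite A"
  shows "of_nat (Suc t) * esym (Suc t) A x =
           (\<Sum>i\<le>t. (-1) ^ i * esym (t - i) A x * (\<Sum>n\<in>A. x n ^ Suc i))"
  using assms
proof (induction A arbitrary: t rule: finite_induct)
  case empty
  then show ?case by simp
next
  case (insert y A)
  let ?e = "\<lambda>s. esym s A x" and ?e' = "\<lambda>s. esym s (insert y A) x"
  let ?p = "\<lambda>i. \<Sum>n\<in>A. x n ^ Suc i"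
  have e'_Suc: "?e' (Suc s) = ?e (Suc s) + x y * ?e s" for s
    by (rule esym_Suc_insert) (use insert in auto)
  have e'_0: "?e' 0 = 1" "?e 0 = 1" using insert by auto
  \<comment> \<open>dividing \<open>\<Prod> (1 + x X)\<close> over \<open>insert y A\<close> by \<open>1 + x\<^sub>y X\<close> gives the product over \<open>A\<close>\<close>
  have geo: "(\<Sum>i\<le>s. (- x y) ^ i * ?e' (s - i)) = ?e s" for s
  proof (induction s)
    case (Suc s)
    have "(\<Sum>i\<le>Suc s. (- x y) ^ i * ?e' (Suc s - i)) =
            ?e' (Suc s) + (- x y) * (\<Sum>i\<le>s. (- x y) ^ i * ?e' (s - i))"
      by (subst sum.atMost_Suc_shift) (simp add: sum_distrib_left mult.assoc sum_negf)
    with Suc show ?case by (simp add: e'_Suc)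
  qed (simp add: e'_0)
  have shift: "(\<Sum>i\<le>t. (-1) ^ i * ?e' (t - i) * ?p i) =
      (\<Sum>i\<le>t. (-1) ^ i * ?e (t - i) * ?p i) + x y * (of_nat t * ?e t)"
  proof (cases t)
    case (Suc s)
    have "(\<Sum>i\<le>s. (-1) ^ i * ?e' (Suc s - i) * ?p i) =
        (\<Sum>i\<le>s. (-1) ^ i * ?e (Suc s - i) * ?p i) + x y * (\<Sum>i\<le>s. (-1) ^ i * ?e (s - i) * ?p i)"
      unfolding sum_distrib_left sum.distrib[symmetric]
      by (intro sum.cong refl) (auto simp: Suc_diff_le e'_Suc algebra_simps)
    then show ?thesis using insert.IH[of s] by (simp add: Suc e'_0 algebra_simps)
  qed (simp add: e'_0)
  have "(\<Sum>i\<le>t. (-1) ^ i * ?e' (t - i) * (\<Sum>n\<in>insert y A. x n ^ Suc i)) =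
      (\<Sum>i\<le>t. (-1) ^ i * ?e' (t - i) * ?p i) + x y * (\<Sum>i\<le>t. (- x y) ^ i * ?e' (t - i))"
    unfolding sum_distrib_left[of "x y"] sum.distrib[symmetric]
    using insert by (intro sum.cong refl) (auto simp: algebra_simps power_minus[of "x y"])
  also have "\<dots> = of_nat (Suc t) * ?e (Suc t) + x y * (of_nat t * ?e t) + x y * ?e t"
    by (simp only: shift geo insert.IH)
  also have "\<dots> = of_nat (Suc t) * ?e' (Suc t)"
    by (simp add: e'_Suc algebra_simps)
  finally show ?case by simp
qed

definition index_sets :: "nat \<Rightarrow> nat set set" where
  "index_sets t = {S. S \<subseteq> {1..} \<and> finite S \<and> card S = t}"

text \<open>
  The sets \<open>{S. S \<subseteq> {1..M} \<and> card S = t}\<close> exhaust the range of summation, so a sum over it is the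
  limit of its truncations, whatever the topology.
\<close>

lemma esym_tendsto:
  fixes x :: "nat \<Rightarrow> 'a :: {comm_ring_1, t2_space}"
  assumes "((\<lambda>S. \<Prod>n\<in>S. x n) has_sum s) (index_sets t)"
  shows "(\<lambda>M. esym t {1..M} x) \<longlonglongrightarrow> s"
proof -
  let ?F = "\<lambda>M. {S. S \<subseteq> {1..M} \<and> card S = t}"
  have "filterlim ?F (finite_subsets_at_top (index_sets t)) sequentially"
    unfolding filterlim_finite_subsets_at_top
  proof (intro allI impI)
    fix X assume X: "finite X \<and> X \<subseteq> index_sets t"
    then have "finite (\<Union>X)" by (auto simp: index_sets_def)
    then obtain K where K: "\<forall>n\<in>\<Union>X. n \<le> K" using finite_nat_set_iff_bounded_le by auto
    show "\<forall>\<^sub>F M in sequentially. finite (?F M) \<and> X \<subseteq> ?F M \<and> ?F M \<subseteq> index_sets t"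
      using eventually_ge_at_top[of K]
    proof eventually_elim
      case (elim M)
      have "finite (?F M)" by (rule finite_subset[of _ "Pow {1..M}"]) auto
      moreover have "X \<subseteq> ?F M"
        using X K elim by (fastforce simp: index_sets_def)
      moreover have "?F M \<subseteq> index_sets t" by (auto simp: index_sets_def intro: finite_subset)
      ultimately show ?case by blast
    qed
  qed
  from filterlim_compose[OF assms[unfolded has_sum_def] this] show ?thesis
    by (simp add: esym_def)
qed

lemma power_sum_tendsto:
  fixes x :: "nat \<Rightarrow> 'a :: {comm_monoid_add, t2_space}"
  assumes "(x has_sum s) {1..}"
  shows "(\<lambda>M. \<Sum>n\<in>{1..M}. x n) \<longlonglongrightarrow> s"
proof -
  have "filterlim (\<lambda>M. {1..M}) (finite_subsets_at_top {1::nat..}) sequentially"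
    unfolding filterlim_finite_subsets_at_top
  proof (intro allI impI)
    fix X :: "nat set" assume X: "finite X \<and> X \<subseteq> {1..}"
    then obtain K where K: "\<forall>n\<in>X. n \<le> K" using finite_nat_set_iff_bounded_le by auto
    show "\<forall>\<^sub>F M in sequentially. finite {1..M} \<and> X \<subseteq> {1..M} \<and> {1..M} \<subseteq> {1..}"
      using eventually_ge_at_top[of K] by eventually_elim (use X K in fastforce)
  qed
  from filterlim_compose[OF assms[unfolded has_sum_def] this] show ?thesis .
qed

text \<open>
  Continuity of addition and multiplication appears as a hypothesis, so that the lemma serves both the
  \<open>X\<close>-adic topology on formal power series and the usual topology on the complex numbers.
\<close>

lemma newton_identity_limit:
  fixes x :: "nat \<Rightarrow> 'a :: {comm_ring_1, t2_space}"
  assumes add_lim: "\<And>f g (a :: 'a) b. f \<longlonglongrightarrow> a \<Longrightarrow> g \<longlonglongrightarrow> b \<Longrightarrow> (\<lambda>n. f n + g n) \<longlonglongrightarrow> a + b"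
    and mult_lim: "\<And>f g (a :: 'a) b. f \<longlonglongrightarrow> a \<Longrightarrow> g \<longlonglongrightarrow> b \<Longrightarrow> (\<lambda>n. f n * g n) \<longlonglongrightarrow> a * b"
    and E: "\<And>t. ((\<lambda>S. \<Prod>n\<in>S. x n) has_sum E t) (index_sets t)"
    and p: "\<And>i. ((\<lambda>n. x n ^ Suc i) has_sum p (Suc i)) {1..}"
  shows "of_nat (Suc t) * E (Suc t) = (\<Sum>i\<le>t. (-1) ^ i * E (t - i) * p (Suc i))"
proof (rule LIMSEQ_unique)
  have sum_lim: "(\<lambda>n. \<Sum>i\<in>I. f i n) \<longlonglongrightarrow> (\<Sum>i\<in>I. l i)"
    if "finite I" "\<And>i. i \<in> I \<Longrightarrow> f i \<longlonglongrightarrow> l i" for I :: "nat set" and f and l :: "nat \<Rightarrow> 'a"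
    using that by (induction I rule: finite_induct) (auto intro!: add_lim)
  show "(\<lambda>M. of_nat (Suc t) * esym (Suc t) {1..M} x) \<longlonglongrightarrow> of_nat (Suc t) * E (Suc t)"
    by (intro mult_lim tendsto_const esym_tendsto E)
  have "(\<lambda>M. \<Sum>i\<le>t. (-1) ^ i * esym (t - i) {1..M} x * (\<Sum>n\<in>{1..M}. x n ^ Suc i))
      \<longlonglongrightarrow> (\<Sum>i\<le>t. (-1) ^ i * E (t - i) * p (Suc i))"
    by (intro sum_lim mult_lim tendsto_const esym_tendsto E power_sum_tendsto p) auto
  then show "(\<lambda>M. of_nat (Suc t) * esym (Suc t) {1..M} x)
      \<longlonglongrightarrow> (\<Sum>i\<le>t. (-1) ^ i * E (t - i) * p (Suc i))"
    by (subst newton_identity) auto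
qed

lemma infsum_index_sets_0: "(\<Sum>\<^sub>\<infinity>S\<in>index_sets 0. \<Prod>n\<in>S. x n) = (1 :: 'a :: {comm_ring_1, t2_space})"
proof -
  have "index_sets 0 = {{}}" by (auto simp: index_sets_def)
  then show ?thesis by simp
qed

text \<open>
  All finite partial sums of the norms are parts of an expanded product
  \<open>\<Prod>\<^bsub>n\<in>A\<^esub> (1 + |x\<^sub>n|) \<le> exp (\<Sum>\<^sub>n |x\<^sub>n|)\<close>.
\<close>

lemma summable_on_index_sets_complex:
  fixes x :: "nat \<Rightarrow> complex"
  assumes "summable (\<lambda>n. norm (x n))"
  shows "(\<lambda>S. \<Prod>n\<in>S. x n) summable_on index_sets t"
proof -
  have "(\<lambda>S. norm (\<Prod>n\<in>S. x n)) summable_on index_sets t"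
  proof (rule nonneg_bdd_above_summable_on)
    show "bdd_above (sum (\<lambda>S. norm (\<Prod>n\<in>S. x n)) ` {F. F \<subseteq> index_sets t \<and> finite F})"
    proof (rule bdd_aboveI2)
      fix F assume "F \<in> {F. F \<subseteq> index_sets t \<and> finite F}"
      then have F: "F \<subseteq> index_sets t" "finite F" by auto
      define A where "A = \<Union>F"
      have A: "finite A" "F \<subseteq> Pow A" using F by (auto simp: A_def index_sets_def)
      have "(\<Sum>S\<in>F. norm (\<Prod>n\<in>S. x n)) \<le> (\<Sum>S\<in>Pow A. \<Prod>n\<in>S. norm (x n))"
        unfolding prod_norm[symmetric] using A by (intro sum_mono2) (auto intro!: prod_nonneg)
      also have "\<dots> = (\<Prod>n\<in>A. norm (x n) + 1)"
        using A by (subst prod_add) auto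
      also have "\<dots> \<le> (\<Prod>n\<in>A. exp (norm (x n)))"
        by (intro prod_mono) (auto simp: add.commute[of _ 1])
      also have "\<dots> = exp (\<Sum>n\<in>A. norm (x n))" using A by (simp add: exp_sum)
      also have "\<dots> \<le> exp (suminf (\<lambda>n. norm (x n)))"
        using A assms by (auto intro!: sum_le_suminf)
      finally show "(\<Sum>S\<in>F. norm (\<Prod>n\<in>S. x n)) \<le> exp (suminf (\<lambda>n. norm (x n)))" .
    qed
  qed auto
  then show ?thesis by (rule abs_summable_summable)
qed

text \<open>
  This is what makes the formal series converge: only sets \<open>S \<subseteq> {..i}\<close> contribute to the
  coefficient of \<open>X\<^sup>i\<close>.
\<close>

lemma prod_fps_nth_eq_0:
  fixes x :: "nat \<Rightarrow> 'a :: comm_ring_1 fps"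
  assumes "\<And>n i. i < n \<Longrightarrow> fps_nth (x n) i = 0" "finite S" "m \<in> S" "i < m"
  shows "fps_nth (\<Prod>n\<in>S. x n) i = 0"
proof -
  have "(\<Prod>n\<in>S. x n) = x m * (\<Prod>n\<in>S - {m}. x n)" using assms by (simp add: prod.remove)
  also have "fps_nth \<dots> i = 0" unfolding fps_mult_nth using assms by (intro sum.neutral) auto
  finally show ?thesis .
qed

lemma summable_on_index_sets_fps:
  fixes x :: "nat \<Rightarrow> complex fps"
  assumes "\<And>n i. i < n \<Longrightarrow> fps_nth (x n) i = 0"
  shows "(\<lambda>S. \<Prod>n\<in>S. x n) summable_on index_sets t"
proof -
  have fin: "finite {S \<in> index_sets t. fps_nth (\<Prod>n\<in>S. x n) i \<noteq> 0}" for i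
  proof (rule finite_subset)
    show "{S \<in> index_sets t. fps_nth (\<Prod>n\<in>S. x n) i \<noteq> 0} \<subseteq> Pow {..i}"
      using prod_fps_nth_eq_0[OF assms] by (fastforce simp: index_sets_def not_less[symmetric])
  qed auto
  show ?thesis
    using has_sum_fpsI[where F = "\<lambda>S. \<Prod>n\<in>S. x n" and A = "index_sets t" and
      S = "Abs_fps (\<lambda>i. \<Sum>S | S \<in> index_sets t \<and> fps_nth (\<Prod>n\<in>S. x n) i \<noteq> 0. fps_nth (\<Prod>n\<in>S. x n) i)", OF fin]
    by (auto simp: summable_on_def)
qed

lemma summable_on_powers_fps:
  fixes x :: "nat \<Rightarrow> complex fps"
  assumes "\<And>n i. i < n \<Longrightarrow> fps_nth (x n) i = 0"
  shows "(\<lambda>n. x n ^ Suc s) summable_on {1..}"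
proof -
  have fin: "finite {n \<in> {1..}. fps_nth (x n ^ Suc s) i \<noteq> 0}" for i
  proof (rule finite_subset)
    have "fps_nth (x n ^ Suc s) i = 0" if "i < n" for n
      unfolding power_Suc fps_mult_nth using assms that by (intro sum.neutral) auto
    then show "{n \<in> {1..}. fps_nth (x n ^ Suc s) i \<noteq> 0} \<subseteq> {..i}" by (fastforce simp: not_less[symmetric])
  qed auto
  show ?thesis
    using has_sum_fpsI[where F = "\<lambda>n. x n ^ Suc s" and A = "{1..}" and
      S = "Abs_fps (\<lambda>i. \<Sum>n | n \<in> {1..} \<and> fps_nth (x n ^ Suc s) i \<noteq> 0. fps_nth (x n ^ Suc s) i)", OF fin]
    by (auto simp: summable_on_def)
qed

lemma tendsto_mult_fps:
  fixes f g :: "'b \<Rightarrow> 'a :: comm_ring_1 fps"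
  assumes "(f \<longlongrightarrow> a) F" "(g \<longlongrightarrow> b) F"
  shows "((\<lambda>n. f n * g n) \<longlongrightarrow> a * b) F"
proof (rule tendsto_fpsI)
  fix n
  have "\<forall>\<^sub>F x in F. \<forall>i\<in>{..n}. fps_nth (f x) i = fps_nth a i" "\<forall>\<^sub>F x in F. \<forall>i\<in>{..n}. fps_nth (g x) i = fps_nth b i"
    using assms by (auto simp: tendsto_fps_iff intro!: eventually_ball_finite)
  then show "\<forall>\<^sub>F x in F. fps_nth (f x * g x) n = fps_nth (a * b) n"
    by eventually_elim (auto simp: fps_mult_nth intro!: sum.cong)
qed

lemma tendsto_add_fps:
  fixes f g :: "'b \<Rightarrow> 'a :: comm_ring_1 fps"
  assumes "(f \<longlongrightarrow> a) F" "(g \<longlongrightarrow> b) F"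
  shows "((\<lambda>n. f n + g n) \<longlongrightarrow> a + b) F"
proof (rule tendsto_fpsI)
  fix n
  have "\<forall>\<^sub>F x in F. fps_nth (f x) n = fps_nth a n" "\<forall>\<^sub>F x in F. fps_nth (g x) n = fps_nth b n"
    using assms by (auto simp: tendsto_fps_iff)
  then show "\<forall>\<^sub>F x in F. fps_nth (f x + g x) n = fps_nth (a + b) n"
    by eventually_elim auto
qed

section \<open>Newton's identities for the series\<close>

text \<open>
  The value \<open>x / (1 + a x + x\<^sup>2)\<close> at \<open>x = q\<^sup>n\<close>; with \<open>r = k\<close> the series \<^const>\<open>Useries\<close> are the elementary
  symmetric functions of the \<open>k\<close>-th powers of these quantities.
\<close>

definition summand :: "'a \<Rightarrow> 'a \<Rightarrow> nat \<Rightarrow> 'a :: {comm_ring_1, inverse}" where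
  "summand a q n = q ^ n / (1 + a * q ^ n + q ^ (2 * n))"

abbreviation formal_summand :: "complex \<Rightarrow> nat \<Rightarrow> complex fps" where
  "formal_summand a \<equiv> summand (fps_const a) fps_X"

lemma formal_summand_denominator_nth_0: "n \<ge> 1 \<Longrightarrow> fps_nth (1 + fps_const a * fps_X ^ n + fps_X ^ (2 * n) :: complex fps) 0 = 1"
  by auto

lemma formal_summand_eq: "n \<ge> 1 \<Longrightarrow> formal_summand a n = fps_X ^ n * inverse (1 + fps_const a * fps_X ^ n + fps_X ^ (2 * n))"
  unfolding summand_def using formal_summand_denominator_nth_0 by (subst fps_divide_unit) auto

lemma formal_summand_power_eq:
  assumes "n \<ge> 1"
  shows "formal_summand a n ^ k = fps_X ^ (k * n) * inverse ((1 + fps_const a * fps_X ^ n + fps_X ^ (2 * n)) ^ k)"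
  by (simp add: formal_summand_eq[OF assms] power_mult_distrib fps_inverse_power power_mult[symmetric] mult.commute[of n])

lemma formal_summand_power_nth_eq_0:
  assumes "n \<ge> 1" "k \<ge> 1" "i < n"
  shows "fps_nth (formal_summand a n ^ k) i = 0"
proof -
  have "n \<le> k * n" using assms(2) by simp
  then have "i < k * n" using assms(3) by (rule order.strict_trans2[rotated])
  then show ?thesis unfolding formal_summand_power_eq[OF assms(1)] by (simp add: fps_X_power_mult_nth)
qed

lemma U_formal_eq: "U_formal t k k a = (\<Sum>\<^sub>\<infinity>S\<in>index_sets t. \<Prod>n\<in>S. formal_summand a n ^ k)"
  unfolding U_formal_def Useries_def index_sets_def
proof (rule infsum_cong, safe)
  fix S :: "nat set" assume S: "S \<subseteq> {1..}" "finite S"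
  let ?D = "\<lambda>n. (1 + fps_const a * fps_X ^ n + fps_X ^ (2 * n)) :: complex fps"
  have S1: "n \<ge> 1" if "n \<in> S" for n using S that by auto
  have D0: "fps_nth (?D n ^ k) 0 = 1" if "n \<in> S" for n
    using formal_summand_denominator_nth_0[OF S1[OF that]] by (metis fps_power_zeroth power_one)
  have prod0: "fps_nth (\<Prod>n\<in>S. ?D n ^ k) 0 = 1"
    using \<open>finite S\<close> D0 by (induction S rule: finite_induct) auto
  have "(\<Prod>n\<in>S. formal_summand a n ^ k) = (\<Prod>n\<in>S. fps_X ^ (k * n) * inverse (?D n ^ k))"
    by (intro prod.cong refl formal_summand_power_eq S1)
  also have "\<dots> = fps_X ^ (k * \<Sum>S) * (\<Prod>n\<in>S. inverse (?D n ^ k))"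
    by (simp add: prod.distrib power_sum sum_distrib_left)
  also have "(\<Prod>n\<in>S. inverse (?D n ^ k)) = inverse (\<Prod>n\<in>S. ?D n ^ k)"
    using \<open>finite S\<close> by (induction S rule: finite_induct) (auto simp: fps_inverse_mult)
  also have "fps_X ^ (k * \<Sum>S) * inverse (\<Prod>n\<in>S. ?D n ^ k) = fps_X ^ (k * \<Sum>S) / (\<Prod>n\<in>S. ?D n ^ k)"
    using prod0 by (subst fps_divide_unit) auto
  finally show "fps_X ^ (k * \<Sum>S) / (\<Prod>n\<in>S. ?D n ^ k) = (\<Prod>n\<in>S. formal_summand a n ^ k)" by simp
qed

lemma U1_formal_eq: "U1_formal k k a = (\<Sum>\<^sub>\<infinity>n\<in>{1..}. formal_summand a n ^ k)"
  unfolding U1_formal_def Useries1_altdef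
proof (rule infsum_cong)
  fix n :: nat assume n: "n \<in> {1..}"
  let ?D = "(1 + fps_const a * fps_X ^ n + fps_X ^ (2 * n)) :: complex fps"
  have "fps_nth (?D ^ k) 0 = 1"
    using n formal_summand_denominator_nth_0[of n] by (metis atLeast_iff fps_power_zeroth power_one)
  then show "fps_X ^ (k * n) / ?D ^ k = formal_summand a n ^ k"
    using n by (subst formal_summand_power_eq) (auto simp: fps_divide_unit)
qed

theorem U_formal_newton:
  assumes "k \<ge> 1"
  shows "of_nat (Suc t) * U_formal (Suc t) k k a =
     (\<Sum>i\<le>t. (-1) ^ i * U_formal (t - i) k k a * U1_formal (Suc i * k) (Suc i * k) a)"
proof (rule newton_identity_limit[where x = "\<lambda>n. formal_summand a n ^ k" and E = "\<lambda>t. U_formal t k k a"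
      and p = "\<lambda>i. U1_formal (i * k) (i * k) a"])
  have nth_eq_0: "fps_nth (formal_summand a n ^ k) i = 0" if "i < n" for n i
    using formal_summand_power_nth_eq_0[OF _ assms that] that by simp
  show "((\<lambda>S. \<Prod>n\<in>S. formal_summand a n ^ k) has_sum U_formal t k k a) (index_sets t)" for t
    unfolding U_formal_eq by (intro has_sum_infsum summable_on_index_sets_fps nth_eq_0)
  show "((\<lambda>n. (formal_summand a n ^ k) ^ Suc i) has_sum U1_formal (Suc i * k) (Suc i * k) a) {1..}" for i
  proof -
    have "(\<lambda>n. (formal_summand a n ^ k) ^ Suc i) summable_on {1..}"
      by (intro summable_on_powers_fps nth_eq_0)
    then show ?thesis
      unfolding U1_formal_eq by (simp only: power_mult[symmetric] mult.commute has_sum_infsum)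
  qed
qed (auto intro: tendsto_mult_fps tendsto_add_fps)

lemma U_formal_0: "U_formal 0 k k a = 1"
  unfolding U_formal_eq by (rule infsum_index_sets_0)

lemma Useries_eq:
  fixes a q :: complex
  shows "Useries t k k a q = (\<Sum>\<^sub>\<infinity>S\<in>index_sets t. \<Prod>n\<in>S. summand a q n ^ k)"
  unfolding Useries_def index_sets_def
  by (intro infsum_cong) (simp add: summand_def power_divide prod_dividef power_sum sum_distrib_left power_mult[symmetric] mult.commute)

lemma Useries1_eq:
  fixes a q :: complex
  shows "Useries1 k k a q = (\<Sum>\<^sub>\<infinity>n\<in>{1..}. summand a q n ^ k)"
  unfolding Useries1_altdef
  by (intro infsum_cong) (simp add: summand_def power_divide power_mult[symmetric] mult.commute)

lemma Useries_0: "Useries 0 k k (a :: complex) q = 1"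
  unfolding Useries_eq by (rule infsum_index_sets_0)

theorem Useries_newton:
  fixes a q :: complex
  assumes summable: "\<And>s. s \<ge> 1 \<Longrightarrow> summable (\<lambda>n. norm (summand a q n ^ s))" and "k \<ge> 1"
  shows "of_nat (Suc t) * Useries (Suc t) k k a q =
     (\<Sum>i\<le>t. (-1) ^ i * Useries (t - i) k k a q * Useries1 (Suc i * k) (Suc i * k) a q)"
proof (rule newton_identity_limit[where x = "\<lambda>n. summand a q n ^ k" and E = "\<lambda>t. Useries t k k a q"
      and p = "\<lambda>i. Useries1 (i * k) (i * k) a q"])
  show "((\<lambda>S. \<Prod>n\<in>S. summand a q n ^ k) has_sum Useries t k k a q) (index_sets t)" for t
    unfolding Useries_eq using assms by (intro has_sum_infsum summable_on_index_sets_complex) auto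
  show "((\<lambda>n. (summand a q n ^ k) ^ Suc i) has_sum Useries1 (Suc i * k) (Suc i * k) a q) {1..}" for i
  proof -
    have "summable (\<lambda>n. norm (summand a q n ^ (Suc i * k)))" using assms by (intro summable) auto
    then have "(\<lambda>n. summand a q n ^ (Suc i * k)) summable_on UNIV"
      by (rule norm_summable_imp_summable_on)
    then have "(\<lambda>n. summand a q n ^ (Suc i * k)) summable_on {1..}"
      by (rule summable_on_subset_banach) auto
    then show ?thesis unfolding Useries1_eq by (simp only: power_mult[symmetric] mult.commute has_sum_infsum)
  qed
qed (auto intro: tendsto_intros)

section \<open>Isobaric polynomials\<close>

definition monom_value :: "(nat \<Rightarrow>\<^sub>0 nat) \<Rightarrow> (nat \<Rightarrow> 'a) \<Rightarrow> 'a :: comm_ring_1" where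
  "monom_value m x = (\<Prod>i\<in>Poly_Mapping.keys m. x i ^ Poly_Mapping.lookup m i)"

lemma monom_value_superset:
  assumes "finite I" "Poly_Mapping.keys m \<subseteq> I"
  shows "monom_value m x = (\<Prod>i\<in>I. x i ^ Poly_Mapping.lookup m i)"
  unfolding monom_value_def using assms
  by (intro prod.mono_neutral_left) (auto simp: in_keys_iff)

lemma monom_value_add: "monom_value (m + n) x = monom_value m x * monom_value n x"
proof -
  let ?I = "Poly_Mapping.keys m \<union> Poly_Mapping.keys n"
  have "Poly_Mapping.keys (m + n) \<subseteq> ?I" by (rule Poly_Mapping.keys_add)
  then show ?thesis
    by (simp add: monom_value_superset[of ?I] lookup_add power_add prod.distrib)
qed

lemma eval_rat_mpoly_superset:
  assumes "finite M" "Poly_Mapping.keys P \<subseteq> M"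
  shows "eval_rat_mpoly P x = (\<Sum>m\<in>M. fps_const (of_rat (Poly_Mapping.lookup P m)) * monom_value m x)"
  unfolding eval_rat_mpoly_def monom_value_def[symmetric] using assms
  by (intro sum.mono_neutral_left) (auto simp: in_keys_iff)

lemma eval_rat_mpoly_add: "eval_rat_mpoly (P + Q) x = eval_rat_mpoly P x + eval_rat_mpoly Q x"
proof -
  let ?I = "Poly_Mapping.keys P \<union> Poly_Mapping.keys Q"
  have "Poly_Mapping.keys (P + Q) \<subseteq> ?I" by (rule Poly_Mapping.keys_add)
  then show ?thesis
    by (simp add: eval_rat_mpoly_superset[of ?I] lookup_add of_rat_add sum.distrib
        fps_const_add[symmetric] distrib_right del: fps_const_add)
qed

lemma eval_rat_mpoly_zero: "eval_rat_mpoly 0 x = 0"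
  by (simp add: eval_rat_mpoly_def)

lemma eval_rat_mpoly_single:
  "eval_rat_mpoly (Poly_Mapping.single m c) x = fps_const (of_rat c) * monom_value m x"
  by (subst eval_rat_mpoly_superset[of "{m}"]) (auto simp: lookup_single)

lemma single_mult_eq_sum:
  "Poly_Mapping.single m c * P = (\<Sum>n\<in>Poly_Mapping.keys P. Poly_Mapping.single (m + n) (c * Poly_Mapping.lookup P n))"
proof -
  have "P = (\<Sum>n\<in>Poly_Mapping.keys P. Poly_Mapping.single n (Poly_Mapping.lookup P n))"
    by (rule poly_mapping_eqI) (auto simp: lookup_sum lookup_single when_def in_keys_iff)
  then have "Poly_Mapping.single m c * P = 
     Poly_Mapping.single m c * (\<Sum>n\<in>Poly_Mapping.keys P. Poly_Mapping.single n (Poly_Mapping.lookup P n))"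
    by simp
  then show ?thesis by (simp add: sum_distrib_left mult_single)
qed

lemma eval_rat_mpoly_sum: "eval_rat_mpoly (\<Sum>i\<in>I. P i) x = (\<Sum>i\<in>I. eval_rat_mpoly (P i) x)"
  by (induction I rule: infinite_finite_induct) (simp_all add: eval_rat_mpoly_add eval_rat_mpoly_zero)

lemma eval_rat_mpoly_single_mult:
  "eval_rat_mpoly (Poly_Mapping.single m c * P) x = fps_const (of_rat c) * monom_value m x * eval_rat_mpoly P x"
proof -
  have "eval_rat_mpoly P x = (\<Sum>n\<in>Poly_Mapping.keys P. fps_const (of_rat (Poly_Mapping.lookup P n)) * monom_value n x)"
    by (rule eval_rat_mpoly_superset) auto
  then show ?thesis
    unfolding single_mult_eq_sum eval_rat_mpoly_sum eval_rat_mpoly_single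
    by (simp add: monom_value_add of_rat_mult fps_const_mult[symmetric] sum_distrib_left mult_ac del: fps_const_mult)
qed

text \<open>
  Multiplication by a variable \<open>X\<^sub>j\<close> raises the isobaric degree by \<open>j\<close>.
\<close>

lemma isobaric_single_mult:
  assumes P: "isobaric s P" and s: "s + j = t" and j: "j \<ge> 1"
  shows "isobaric t (Poly_Mapping.single (Poly_Mapping.single j 1) c * P)"
  unfolding isobaric_def
proof
  fix m assume "m \<in> Poly_Mapping.keys (Poly_Mapping.single (Poly_Mapping.single j 1) c * P)"
  then obtain n where n: "n \<in> Poly_Mapping.keys P" and m: "m = Poly_Mapping.single j 1 + n"
    unfolding single_mult_eq_sum using keys_sum by (fastforce split: if_splits)
  have keys_n: "Poly_Mapping.keys n \<subseteq> {1..s}" and sum_n: "(\<Sum>i=1..s. i * Poly_Mapping.lookup n i) = s"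
    using P n by (auto simp: isobaric_def)
  have keys_m: "Poly_Mapping.keys m \<subseteq> {1..t}"
    using keys_add[of "Poly_Mapping.single j (1::nat)" n] keys_n s j unfolding m by fastforce
  have "(\<Sum>i=1..t. i * Poly_Mapping.lookup n i) = (\<Sum>i=1..s. i * Poly_Mapping.lookup n i)"
    using keys_n s by (intro sum.mono_neutral_right) (auto simp: in_keys_iff)
  moreover have "(\<Sum>i=1..t. i * Poly_Mapping.lookup (Poly_Mapping.single j (1::nat)) i) = j"
  proof -
    have "(\<Sum>i=1..t. i * Poly_Mapping.lookup (Poly_Mapping.single j (1::nat)) i) = (\<Sum>i=1..t. if j = i then i else 0)"
      by (intro sum.cong) (auto simp: lookup_single when_def)
    then show ?thesis using s j by simp
  qed
  ultimately have "(\<Sum>i=1..t. i * Poly_Mapping.lookup m i) = t"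
    using sum_n s unfolding m by (simp add: lookup_add distrib_left sum.distrib)
  with keys_m show "Poly_Mapping.keys m \<subseteq> {1..t} \<and> (\<Sum>i=1..t. i * Poly_Mapping.lookup m i) = t" ..
qed

lemma isobaric_sum: "(\<And>i. i \<in> I \<Longrightarrow> isobaric t (P i)) \<Longrightarrow> isobaric t (\<Sum>i\<in>I. P i)"
  unfolding isobaric_def using keys_sum[of P I] by blast

text \<open>
  Solving Newton's identities for the last \<open>e\<^sub>t\<close> divides by \<open>t\<close> and multiplies an isobaric polynomial
  of degree \<open>t - i\<close> by \<open>X\<^sub>i\<close>. The index \<open>a\<close> only records that one polynomial works for a whole family of
  sequences.
\<close>

theorem ex_isobaric_newton:
  fixes E :: "'b \<Rightarrow> nat \<Rightarrow> complex fps" and p :: "'b \<Rightarrow> nat \<Rightarrow> complex fps"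
  assumes E0: "\<And>a. E a 0 = 1"
    and newton: "\<And>a t. of_nat (Suc t) * E a (Suc t) = (\<Sum>i\<le>t. (-1) ^ i * E a (t - i) * p a (Suc i))"
  shows "\<exists>P. isobaric t P \<and> (\<forall>a. E a t = eval_rat_mpoly P (p a))"
proof (induction t rule: less_induct)
  case (less t)
  show ?case
  proof (cases t)
    case 0
    have "isobaric 0 (Poly_Mapping.single 0 1)" by (auto simp: isobaric_def)
    then show ?thesis
      using 0 by (intro exI[of _ "Poly_Mapping.single 0 1"])
        (auto simp: E0 eval_rat_mpoly_single monom_value_def simp del: single_one)
  next
    case (Suc s)
    obtain P where P: "\<And>i. i \<le> s \<Longrightarrow> isobaric i (P i)" "\<And>i a. i \<le> s \<Longrightarrow> E a i = eval_rat_mpoly (P i) (p a)"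
      using less.IH Suc by (metis less_Suc_eq_le)
    define c :: "nat \<Rightarrow> rat" where "c i = (-1) ^ i / of_nat t" for i
    define Q where "Q = (\<Sum>i\<le>s. Poly_Mapping.single (Poly_Mapping.single (Suc i) 1) (c i) * P (s - i))"
    have "isobaric t Q"
      unfolding Q_def
    proof (rule isobaric_sum)
      fix i assume "i \<in> {..s}"
      then show "isobaric t (Poly_Mapping.single (Poly_Mapping.single (Suc i) 1) (c i) * P (s - i))"
        using P Suc by (intro isobaric_single_mult[of "s - i"]) auto
    qed
    moreover have "E a t = eval_rat_mpoly Q (p a)" for a
    proof -
      have t: "of_nat t = (fps_const (of_nat t) :: complex fps)" by (simp add: fps_of_nat)
      have "fps_const (of_nat t) * eval_rat_mpoly Q (p a) =
          (\<Sum>i\<le>s. fps_const (of_nat t * of_rat (c i)) * (p a (Suc i) * E a (s - i)))"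
        unfolding Q_def eval_rat_mpoly_sum eval_rat_mpoly_single_mult sum_distrib_left
        by (intro sum.cong refl) (simp add: P monom_value_def fps_const_mult[symmetric] mult_ac del: fps_const_mult)
      also have "\<dots> = (\<Sum>i\<le>s. (-1) ^ i * E a (s - i) * p a (Suc i))"
      proof (intro sum.cong refl)
        fix i
        have "of_nat t * of_rat (c i) = ((-1) ^ i :: complex)"
        proof -
          have "t \<noteq> 0" using Suc by simp
          then show ?thesis by (simp add: c_def of_rat_divide of_rat_power)
        qed
        moreover have "fps_const ((-1) ^ i) = ((-1) ^ i :: complex fps)"
          by (metis fps_const_1_eq_1 fps_const_neg fps_const_power)
        ultimately show "fps_const (of_nat t * of_rat (c i)) * (p a (Suc i) * E a (s - i)) = (-1) ^ i * E a (s - i) * p a (Suc i)"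
          by (simp add: mult_ac)
      qed
      also have "\<dots> = fps_const (of_nat t) * E a t"
        using newton[of s a] Suc t by simp
      finally have "fps_const (of_nat t) * eval_rat_mpoly Q (p a) = fps_const (of_nat t) * E a t" .
      moreover have "fps_const (of_nat t) \<noteq> (0 :: complex fps)" using Suc by (simp del: of_nat_Suc)
      ultimately show ?thesis by simp
    qed
    ultimately show ?thesis by blast
  qed
qed

section \<open>Products of quasimodular forms\<close>

abbreviation "\<H> \<equiv> upper_half_plane"

lemma upper_half_plane_iff: "\<tau> \<in> \<H> \<longleftrightarrow> Im \<tau> > 0"
  by (simp add: upper_half_plane_def)

lemma open_upper_half_plane: "open \<H>"
  unfolding upper_half_plane_def by (rule open_halfspace_Im_gt)

lemma connected_upper_half_plane: "connected \<H>"
  unfolding upper_half_plane_def by (intro convex_connected convex_halfspace_Im_gt)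

lemma denominator_nonzero:
  assumes "(a, b, c, d) \<in> SL2Z" "\<tau> \<in> \<H>"
  shows "of_int c * \<tau> + of_int d \<noteq> 0"
proof
  assume eq: "of_int c * \<tau> + of_int d = 0"
  then have "Im (of_int c * \<tau> + of_int d) = 0" by simp
  then have "c = 0" using assms by (simp add: upper_half_plane_iff)
  with eq assms show False by (auto simp: SL2Z_def)
qed

lemma eventually_upper_half_plane: "\<forall>\<^sub>F \<tau> in filtercomap Im at_top. \<tau> \<in> \<H>"
  unfolding upper_half_plane_iff by (intro eventually_filtercomapI eventually_gt_at_top)

lemma Gamma0_imp_SL2Z: "(a, b, c, d) \<in> Gamma0 N \<Longrightarrow> (a, b, c, d) \<in> SL2Z"
  by (simp add: Gamma0_def)

lemma Bfun_mult_complex: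
  fixes f g :: "'a \<Rightarrow> complex"
  assumes "Bfun f F" "Bfun g F"
  shows "Bfun (\<lambda>x. f x * g x) F"
proof -
  obtain K where K: "K > 0" "eventually (\<lambda>x. norm (f x) \<le> K) F" using assms(1) by (auto simp: Bfun_def)
  obtain L where L: "L > 0" "eventually (\<lambda>x. norm (g x) \<le> L) F" using assms(2) by (auto simp: Bfun_def)
  have "eventually (\<lambda>x. norm (f x * g x) \<le> K * L) F"
    using K(2) L(2) by eventually_elim (use K(1) in \<open>simp add: norm_mult mult_mono\<close>)
  then show ?thesis by (rule BfunI)
qed

lemma Bfun_add_complex:
  fixes f g :: "'a \<Rightarrow> complex"
  assumes "Bfun f F" "Bfun g F"
  shows "Bfun (\<lambda>x. f x + g x) F"
proof -
  obtain K where K: "K > 0" "eventually (\<lambda>x. norm (f x) \<le> K) F" using assms(1) by (auto simp: Bfun_def)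
  obtain L where L: "L > 0" "eventually (\<lambda>x. norm (g x) \<le> L) F" using assms(2) by (auto simp: Bfun_def)
  have "eventually (\<lambda>x. norm (f x + g x) \<le> K + L) F"
    using K(2) L(2) by eventually_elim (rule norm_triangle_mono)
  then show ?thesis by (rule BfunI)
qed

lemma Bfun_sum_complex:
  fixes f :: "'i \<Rightarrow> 'a \<Rightarrow> complex"
  assumes "\<And>i. i \<in> I \<Longrightarrow> Bfun (f i) F"
  shows "Bfun (\<lambda>x. \<Sum>i\<in>I. f i x) F"
  using assms by (induction I rule: infinite_finite_induct) (auto intro: Bfun_add_complex)

lemma Bfun_cong_ev:
  fixes f g :: "'a \<Rightarrow> complex"
  assumes "Bfun f F" "eventually (\<lambda>x. f x = g x) F"
  shows "Bfun g F"
proof -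
  obtain K where "eventually (\<lambda>x. norm (f x) \<le> K) F" using assms(1) by (auto simp: Bfun_def)
  with assms(2) have "eventually (\<lambda>x. norm (g x) \<le> K) F" by eventually_elim simp
  then show ?thesis by (rule BfunI)
qed

text \<open>
  \<open>G\<close> lists the functions \<open>g\<^sub>0, \<dots>, g\<^sub>h\<close> in the transformation law of a quasimodular form.
\<close>

definition quasi_components :: "nat \<Rightarrow> (int \<Rightarrow> complex) \<Rightarrow> int \<Rightarrow> nat \<Rightarrow> (complex \<Rightarrow> complex) \<Rightarrow> (nat \<Rightarrow> complex \<Rightarrow> complex) \<Rightarrow> bool" where
  "quasi_components N \<epsilon> w h g G \<longleftrightarrow>
     (\<forall>j\<le>h. G j holomorphic_on \<H>) \<and> (\<exists>\<tau>\<in>\<H>. G h \<tau> \<noteq> 0) \<and>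
     (\<forall>a b c d. (a, b, c, d) \<in> Gamma0 N \<longrightarrow> (\<forall>\<tau>\<in>\<H>. g (moebius a b c d \<tau>) =
        \<epsilon> d * (of_int c * \<tau> + of_int d) powi w *
        (\<Sum>j\<le>h. G j \<tau> * (of_int c / (of_int c * \<tau> + of_int d)) ^ j))) \<and>
     (\<forall>r\<le>h. \<forall>a b c d. (a, b, c, d) \<in> SL2Z \<longrightarrow>
        Bfun (\<lambda>\<tau>. (of_int c * \<tau> + of_int d) powi (- (w - 2 * int r)) * G r (moebius a b c d \<tau>))
          (filtercomap Im at_top))"

lemma quasimodular_form_iff:
  "quasimodular_form N \<epsilon> w h g \<longleftrightarrow> g holomorphic_on \<H> \<and> (\<exists>G. quasi_components N \<epsilon> w h g G)"
proof -
  have prod4: "(\<forall>(a, b, c, d)\<in>X. P a b c d) \<longleftrightarrow> (\<forall>a b c d. (a, b, c, d) \<in> X \<longrightarrow> P a b c d)"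
    for X :: "(int \<times> int \<times> int \<times> int) set" and P
    by auto
  show ?thesis unfolding quasimodular_form_def quasi_components_def prod4 ..
qed

text \<open>
  Both transformation laws are polynomials in \<open>c / (c\<tau> + d)\<close>, so the components of the product are
  Cauchy products of the components of the factors. The leading one is a product of two nonzero
  holomorphic functions on a connected set and hence nonzero.
\<close>

theorem quasimodular_form_mult:
  assumes f: "quasimodular_form N \<epsilon>\<^sub>1 v h f" and g: "quasimodular_form N \<epsilon>\<^sub>2 w l g"
  shows "quasimodular_form N (\<lambda>d. \<epsilon>\<^sub>1 d * \<epsilon>\<^sub>2 d) (v + w) (h + l) (\<lambda>\<tau>. f \<tau> * g \<tau>)"
proof -
  obtain F where qF: "quasi_components N \<epsilon>\<^sub>1 v h f F" using f unfolding quasimodular_form_iff by blast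
  obtain G where qG: "quasi_components N \<epsilon>\<^sub>2 w l g G" using g unfolding quasimodular_form_iff by blast
  note F = qF[unfolded quasi_components_def, THEN conjunct1, rule_format]
    qF[unfolded quasi_components_def, THEN conjunct2, THEN conjunct1]
    qF[unfolded quasi_components_def, THEN conjunct2, THEN conjunct2, THEN conjunct1, rule_format]
    qF[unfolded quasi_components_def, THEN conjunct2, THEN conjunct2, THEN conjunct2, rule_format]
  note G = qG[unfolded quasi_components_def, THEN conjunct1, rule_format]
    qG[unfolded quasi_components_def, THEN conjunct2, THEN conjunct1]
    qG[unfolded quasi_components_def, THEN conjunct2, THEN conjunct2, THEN conjunct1, rule_format]
    qG[unfolded quasi_components_def, THEN conjunct2, THEN conjunct2, THEN conjunct2, rule_format]
  have fg_hol: "f holomorphic_on \<H>" "g holomorphic_on \<H>"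
    using f g by (auto simp: quasimodular_form_def)
  \<comment> \<open>padding with \<open>0\<close> beyond the depth, as the Cauchy product of polynomials requires\<close>
  define F' where "F' j = (if j \<le> h then F j else (\<lambda>_. 0))" for j
  define G' where "G' j = (if j \<le> l then G j else (\<lambda>_. 0))" for j
  define H where "H j \<tau> = (\<Sum>i\<le>j. F' i \<tau> * G' (j - i) \<tau>)" for j \<tau>
  have F'_hol: "F' j holomorphic_on \<H>" for j
    using F(1)[of j] by (cases "j \<le> h") (auto simp: F'_def)
  have G'_hol: "G' j holomorphic_on \<H>" for j
    using G(1)[of j] by (cases "j \<le> l") (auto simp: G'_def)
  have H_hol: "H j holomorphic_on \<H>" for j
    unfolding H_def by (intro holomorphic_intros F'_hol G'_hol)
  have H_top: "H (h + l) \<tau> = F h \<tau> * G l \<tau>" for \<tau>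
  proof -
    have "H (h + l) \<tau> = (\<Sum>i\<in>{h}. F' i \<tau> * G' (h + l - i) \<tau>)"
      unfolding H_def by (intro sum.mono_neutral_right) (auto simp: F'_def G'_def)
    then show ?thesis by (simp add: F'_def G'_def)
  qed
  have H_nonzero: "\<exists>\<tau>\<in>\<H>. H (h + l) \<tau> \<noteq> 0"
  proof (rule ccontr)
    assume "\<not> ?thesis"
    then have zero: "F h \<tau> = 0 \<or> G l \<tau> = 0" if "\<tau> \<in> \<H>" for \<tau>
      using that by (auto simp: H_top)
    obtain \<tau>\<^sub>0 where \<tau>\<^sub>0: "\<tau>\<^sub>0 \<in> \<H>" "F h \<tau>\<^sub>0 \<noteq> 0" using F(2) by blast
    have "continuous_on \<H> (F h)" by (intro holomorphic_on_imp_continuous_on F) auto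
    then have op: "open {\<tau> \<in> \<H>. F h \<tau> \<noteq> 0}"
      using continuous_open_preimage[OF _ open_upper_half_plane, of "F h" "- {0}"]
      by (simp add: vimage_def Int_def open_Compl)
    have "G l \<tau> = 0" if "\<tau> \<in> \<H>" for \<tau>
    proof (rule analytic_continuation_open[where f = "G l" and g = "\<lambda>_. 0"])
      show "open {\<tau> \<in> \<H>. F h \<tau> \<noteq> 0}" by (rule op)
      show "{\<tau> \<in> \<H>. F h \<tau> \<noteq> 0} \<noteq> {}" using \<tau>\<^sub>0 by blast
      show "G l holomorphic_on \<H>" by (rule G) simp
    qed (use open_upper_half_plane connected_upper_half_plane zero that in auto)
    with G(2) show False by blast
  qed
  have transf: "f (moebius a b c d \<tau>) * g (moebius a b c d \<tau>) =
       (\<epsilon>\<^sub>1 d * \<epsilon>\<^sub>2 d) * (of_int c * \<tau> + of_int d) powi (v + w) *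
       (\<Sum>j\<le>h + l. H j \<tau> * (of_int c / (of_int c * \<tau> + of_int d)) ^ j)"
    if \<gamma>: "(a, b, c, d) \<in> Gamma0 N" "\<tau> \<in> \<H>" for a b c d \<tau>
  proof -
    let ?\<mu> = "of_int c * \<tau> + of_int d"
    have "?\<mu> \<noteq> 0" using denominator_nonzero Gamma0_imp_SL2Z that by blast
    moreover have "(\<Sum>j\<le>h. F' j \<tau> * (of_int c / ?\<mu>) ^ j) * (\<Sum>j\<le>l. G' j \<tau> * (of_int c / ?\<mu>) ^ j) =
        (\<Sum>j\<le>h + l. H j \<tau> * (of_int c / ?\<mu>) ^ j)"
      unfolding H_def by (rule polynomial_product) (auto simp: F'_def G'_def)
    moreover have "(\<Sum>j\<le>h. F' j \<tau> * (of_int c / ?\<mu>) ^ j) = (\<Sum>j\<le>h. F j \<tau> * (of_int c / ?\<mu>) ^ j)"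
      "(\<Sum>j\<le>l. G' j \<tau> * (of_int c / ?\<mu>) ^ j) = (\<Sum>j\<le>l. G j \<tau> * (of_int c / ?\<mu>) ^ j)"
      by (auto simp: F'_def G'_def intro!: sum.cong)
    ultimately show ?thesis
      unfolding F(3)[OF \<gamma>] G(3)[OF \<gamma>] by (simp only: power_int_add mult_ac simp_thms)
  qed
  have bounded: "Bfun (\<lambda>\<tau>. (of_int c * \<tau> + of_int d) powi (- (v + w - 2 * int r)) * H r (moebius a b c d \<tau>))
      (filtercomap Im at_top)" if \<gamma>: "(a, b, c, d) \<in> SL2Z" for r a b c d
  proof (rule Bfun_cong_ev)
    let ?\<mu> = "\<lambda>\<tau>. of_int c * \<tau> + of_int d"
    let ?F = "\<lambda>i \<tau>. ?\<mu> \<tau> powi (- (v - 2 * int i)) * F' i (moebius a b c d \<tau>)"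
    let ?G = "\<lambda>i \<tau>. ?\<mu> \<tau> powi (- (w - 2 * int i)) * G' i (moebius a b c d \<tau>)"
    have "Bfun (?F i) (filtercomap Im at_top)" for i
      using F(4)[OF _ \<gamma>] by (cases "i \<le> h") (auto simp: F'_def)
    moreover have "Bfun (?G i) (filtercomap Im at_top)" for i
      using G(4)[OF _ \<gamma>] by (cases "i \<le> l") (auto simp: G'_def)
    ultimately have "Bfun (\<lambda>\<tau>. ?F i \<tau> * ?G (r - i) \<tau>) (filtercomap Im at_top)" for i
      by (rule Bfun_mult_complex)
    then show "Bfun (\<lambda>\<tau>. \<Sum>i\<le>r. ?F i \<tau> * ?G (r - i) \<tau>) (filtercomap Im at_top)"
      by (rule Bfun_sum_complex)
    show "\<forall>\<^sub>F \<tau> in filtercomap Im at_top. (\<Sum>i\<le>r. ?F i \<tau> * ?G (r - i) \<tau>) =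
        ?\<mu> \<tau> powi (- (v + w - 2 * int r)) * H r (moebius a b c d \<tau>)"
      using eventually_upper_half_plane
    proof eventually_elim
      case (elim \<tau>)
      have "?\<mu> \<tau> \<noteq> 0" using denominator_nonzero \<gamma> elim by blast
      have pw: "?\<mu> \<tau> powi (- (v + w - 2 * int r)) = ?\<mu> \<tau> powi (- (v - 2 * int i)) * ?\<mu> \<tau> powi (- (w - 2 * int (r - i)))"
        if "i \<le> r" for i
      proof -
        have "- (v + w - 2 * int r) = - (v - 2 * int i) + - (w - 2 * int (r - i))"
          using that by (simp add: of_nat_diff)
        then show ?thesis using \<open>?\<mu> \<tau> \<noteq> 0\<close> by (simp only: power_int_add simp_thms)
      qed
      show ?case unfolding H_def sum_distrib_left
      proof (intro sum.cong refl)
        fix i assume "i \<in> {..r}"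
        then have "i \<le> r" by simp
        show "?F i \<tau> * ?G (r - i) \<tau> =
            ?\<mu> \<tau> powi (- (v + w - 2 * int r)) * (F' i (moebius a b c d \<tau>) * G' (r - i) (moebius a b c d \<tau>))"
          unfolding pw[OF \<open>i \<le> r\<close>] by (simp only: mult_ac)
      qed
    qed
  qed
  have hol: "(\<lambda>\<tau>. f \<tau> * g \<tau>) holomorphic_on \<H>" using fg_hol by (intro holomorphic_intros)
  have "quasi_components N (\<lambda>d. \<epsilon>\<^sub>1 d * \<epsilon>\<^sub>2 d) (v + w) (h + l) (\<lambda>\<tau>. f \<tau> * g \<tau>) H"
    unfolding quasi_components_def by (intro conjI allI impI ballI H_hol H_nonzero transf bounded)
  with hol show ?thesis unfolding quasimodular_form_iff by blast
qed

lemma dirichlet_character_mult: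
  "dirichlet_character N \<epsilon>\<^sub>1 \<Longrightarrow> dirichlet_character N \<epsilon>\<^sub>2 \<Longrightarrow> dirichlet_character N (\<lambda>d. \<epsilon>\<^sub>1 d * \<epsilon>\<^sub>2 d)"
  unfolding dirichlet_character_def by (auto simp: mult_ac)

lemma quasimodular_mult:
  assumes "quasimodular N v f" "quasimodular N w g"
  shows "quasimodular N (v + w) (\<lambda>\<tau>. f \<tau> * g \<tau>)"
proof (cases "(\<forall>\<tau>\<in>\<H>. f \<tau> = 0) \<or> (\<forall>\<tau>\<in>\<H>. g \<tau> = 0)")
  case False
  then obtain \<epsilon>\<^sub>1 h \<epsilon>\<^sub>2 l where "dirichlet_character N \<epsilon>\<^sub>1" "quasimodular_form N \<epsilon>\<^sub>1 v h f"
      "dirichlet_character N \<epsilon>\<^sub>2" "quasimodular_form N \<epsilon>\<^sub>2 w l g"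
    using assms unfolding quasimodular_def by blast
  then show ?thesis
    unfolding quasimodular_def using quasimodular_form_mult dirichlet_character_mult by blast
qed (auto simp: quasimodular_def)

lemma modular_mult:
  assumes "modular N v f" "modular N w g"
  shows "modular N (v + w) (\<lambda>\<tau>. f \<tau> * g \<tau>)"
proof (cases "(\<forall>\<tau>\<in>\<H>. f \<tau> = 0) \<or> (\<forall>\<tau>\<in>\<H>. g \<tau> = 0)")
  case False
  then obtain \<epsilon>\<^sub>1 \<epsilon>\<^sub>2 where "dirichlet_character N \<epsilon>\<^sub>1" "quasimodular_form N \<epsilon>\<^sub>1 v 0 f"
      "dirichlet_character N \<epsilon>\<^sub>2" "quasimodular_form N \<epsilon>\<^sub>2 w 0 g"
    using assms unfolding modular_def by blast
  then show ?thesis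
    unfolding modular_def using quasimodular_form_mult[of N _ v 0 f _ w 0 g] dirichlet_character_mult
    by (metis add_0)
qed (auto simp: modular_def)

lemma modular_imp_quasimodular: "modular N w f \<Longrightarrow> quasimodular N w f"
  unfolding modular_def quasimodular_def by blast

definition principal_character :: "nat \<Rightarrow> int \<Rightarrow> complex" where
  "principal_character N m = of_bool (coprime m (int N))"

lemma principal_character: "dirichlet_character N (principal_character N)"
proof -
  have "coprime (m + int N) (int N) = coprime m (int N)" for m
    by (simp add: coprime_iff_gcd_eq_1)
  then show ?thesis
    unfolding dirichlet_character_def principal_character_def by simp
qed

lemma Gamma0_coprime: "(a, b, c, d) \<in> Gamma0 N \<Longrightarrow> coprime d (int N)"
proof -
  assume "(a, b, c, d) \<in> Gamma0 N"
  then have "a * d - b * c = 1" "int N dvd c" by (auto simp: Gamma0_def SL2Z_def)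
  then show ?thesis
  proof (intro coprimeI)
    fix e assume e: "e dvd d" "e dvd int N"
    then have "e dvd a * d - b * c" using \<open>int N dvd c\<close> by (auto intro: dvd_diff dvd_mult dvd_trans)
    then show "is_unit e" using \<open>a * d - b * c = 1\<close> by simp
  qed
qed

lemma modular_const: "modular N 0 (\<lambda>_. C)"
proof (cases "C = 0")
  case False
  have "\<i> \<in> \<H>" by (simp add: upper_half_plane_iff)
  have "quasi_components N (principal_character N) 0 0 (\<lambda>_. C) (\<lambda>_ _. C)"
    unfolding quasi_components_def
  proof (intro conjI allI impI ballI)
    show "\<exists>\<tau>\<in>\<H>. C \<noteq> 0" using False \<open>\<i> \<in> \<H>\<close> by blast
    fix a b c d \<tau> assume "(a, b, c, d) \<in> Gamma0 N"
    then have "principal_character N d = 1"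
      using Gamma0_coprime by (simp add: principal_character_def)
    then show "C = principal_character N d * (of_int c * \<tau> + of_int d) powi 0 *
        (\<Sum>j\<le>0. C * (of_int c / (of_int c * \<tau> + of_int d)) ^ j)" by simp
  qed simp_all
  then have "quasimodular_form N (principal_character N) 0 0 (\<lambda>_. C)"
    unfolding quasimodular_form_iff by auto
  then show ?thesis
    unfolding modular_def using principal_character by blast
qed (simp add: modular_def)

section \<open>Mixed weights\<close>

text \<open>
  Sums of functions of bounded weight for an arbitrary notion \<open>Q\<close> of a form of given weight; it
  covers the modular and the quasimodular case.
\<close>

definition mixed :: "(int \<Rightarrow> (complex \<Rightarrow> complex) \<Rightarrow> bool) \<Rightarrow> int \<Rightarrow> (complex \<Rightarrow> complex) \<Rightarrow> bool" where
  "mixed Q w f \<longleftrightarrow> (\<exists>(n :: nat) g v. (\<forall>i<n. v i \<le> w \<and> Q (v i) (g i)) \<and>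
     (\<forall>\<tau>\<in>\<H>. f \<tau> = (\<Sum>i<n. g i \<tau>)))"

lemma mixed_quasimodular_iff: "mixed_quasimodular N w = mixed (quasimodular N) w"
  by (simp add: mixed_quasimodular_def mixed_def fun_eq_iff)

lemma mixed_modular_iff: "mixed_modular N w = mixed (modular N) w"
  by (simp add: mixed_modular_def mixed_def fun_eq_iff)

lemma mixedI:
  fixes n :: nat
  assumes "\<And>i. i < n \<Longrightarrow> v i \<le> w \<and> Q (v i) (g i)" "\<And>\<tau>. \<tau> \<in> \<H> \<Longrightarrow> f \<tau> = (\<Sum>i<n. g i \<tau>)"
  shows "mixed Q w f"
  unfolding mixed_def
  by (rule exI[of _ n], rule exI[of _ g], rule exI[of _ v]) (simp add: assms)

lemma mixedE:
  assumes "mixed Q w f"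
  obtains n :: nat and v :: "nat \<Rightarrow> int" and g :: "nat \<Rightarrow> complex \<Rightarrow> complex"
  where "\<forall>i<n. v i \<le> w \<and> Q (v i) (g i)" "\<forall>\<tau>\<in>\<H>. f \<tau> = (\<Sum>i<n. g i \<tau>)"
  using assms unfolding mixed_def by (elim exE conjE) (rule that)

lemma mixed_single: "Q v f \<Longrightarrow> v \<le> w \<Longrightarrow> mixed Q w f"
  by (rule mixedI[of 1 "\<lambda>_. v" w Q "\<lambda>_. f"]) auto

lemma mixed_cong:
  assumes "mixed Q w f" "\<And>\<tau>. \<tau> \<in> \<H> \<Longrightarrow> f \<tau> = g \<tau>"
  shows "mixed Q w g"
proof -
  from assms(1) obtain n :: nat and v :: "nat \<Rightarrow> int" and u :: "nat \<Rightarrow> complex \<Rightarrow> complex"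
    where "\<forall>i<n. v i \<le> w \<and> Q (v i) (u i)" "\<forall>\<tau>\<in>\<H>. f \<tau> = (\<Sum>i<n. u i \<tau>)"
    by (rule mixedE)
  then show ?thesis using assms(2) by (intro mixedI[of n v w Q u]) simp_all
qed

lemma mixed_0: "mixed Q w (\<lambda>_. 0)"
  by (rule mixedI[of 0]) auto

lemma mixed_add:
  assumes "mixed Q w f" "mixed Q w f'"
  shows "mixed Q w (\<lambda>\<tau>. f \<tau> + f' \<tau>)"
proof -
  from assms(1) obtain n :: nat and v :: "nat \<Rightarrow> int" and g :: "nat \<Rightarrow> complex \<Rightarrow> complex" where "\<forall>i<n. v i \<le> w \<and> Q (v i) (g i)" "\<forall>\<tau>\<in>\<H>. f \<tau> = (\<Sum>i<n. g i \<tau>)"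
    by (rule mixedE)
  note f = this(1)[rule_format, THEN conjunct1] this(1)[rule_format, THEN conjunct2] this(2)[rule_format]
  from assms(2) obtain n' :: nat and v' :: "nat \<Rightarrow> int" and g' :: "nat \<Rightarrow> complex \<Rightarrow> complex" where "\<forall>i<n'. v' i \<le> w \<and> Q (v' i) (g' i)" "\<forall>\<tau>\<in>\<H>. f' \<tau> = (\<Sum>i<n'. g' i \<tau>)"
    by (rule mixedE)
  note f' = this(1)[rule_format, THEN conjunct1] this(1)[rule_format, THEN conjunct2] this(2)[rule_format]
  define G where "G i = (if i < n then g i else g' (i - n))" for i
  define V where "V i = (if i < n then v i else v' (i - n))" for i
  have sum_G: "(\<Sum>i<n + n'. G i \<tau>) = (\<Sum>i<n. g i \<tau>) + (\<Sum>i<n'. g' i \<tau>)" for \<tau>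
  proof -
    have "{..<n + n'} = {..<n} \<union> {n..<n + n'}" by auto
    then have "(\<Sum>i<n + n'. G i \<tau>) = (\<Sum>i<n. G i \<tau>) + (\<Sum>i\<in>{n..<n + n'}. G i \<tau>)"
      by (simp add: sum.union_disjoint ivl_disj_int)
    moreover have "(\<Sum>i\<in>{n..<n + n'}. G i \<tau>) = (\<Sum>i<n'. g' i \<tau>)"
      by (rule sum.reindex_bij_witness[of _ "\<lambda>i. i + n" "\<lambda>i. i - n"]) (auto simp: G_def)
    moreover have "(\<Sum>i<n. G i \<tau>) = (\<Sum>i<n. g i \<tau>)"
      by (intro sum.cong) (auto simp: G_def)
    ultimately show ?thesis by simp
  qed
  have "V i \<le> w \<and> Q (V i) (G i)" if "i < n + n'" for i
  proof (cases "i < n")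
    case False
    then have "i - n < n'" using that by simp
    then show ?thesis using f'(1,2) False by (simp add: G_def V_def)
  qed (use f(1,2) in \<open>simp add: G_def V_def\<close>)
  moreover have "f \<tau> + f' \<tau> = (\<Sum>i<n + n'. G i \<tau>)" if "\<tau> \<in> \<H>" for \<tau>
    by (simp add: sum_G f(3)[OF that] f'(3)[OF that])
  ultimately show ?thesis by (rule mixedI)
qed

lemma mixed_sum: "(\<And>i. i \<in> I \<Longrightarrow> mixed Q w (f i)) \<Longrightarrow> mixed Q w (\<lambda>\<tau>. \<Sum>i\<in>I. f i \<tau>)"
  by (induction I rule: infinite_finite_induct) (auto intro: mixed_0 mixed_add)

lemma mixed_mult:
  assumes Q: "\<And>v w f g. Q v f \<Longrightarrow> Q w g \<Longrightarrow> Q (v + w) (\<lambda>\<tau>. f \<tau> * g \<tau>)"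
    and "mixed Q w f" "mixed Q w' f'"
  shows "mixed Q (w + w') (\<lambda>\<tau>. f \<tau> * f' \<tau>)"
proof -
  from assms(2) obtain n :: nat and v :: "nat \<Rightarrow> int" and g :: "nat \<Rightarrow> complex \<Rightarrow> complex" where "\<forall>i<n. v i \<le> w \<and> Q (v i) (g i)" "\<forall>\<tau>\<in>\<H>. f \<tau> = (\<Sum>i<n. g i \<tau>)"
    by (rule mixedE)
  note f = this(1)[rule_format, THEN conjunct1] this(1)[rule_format, THEN conjunct2] this(2)[rule_format]
  from assms(3) obtain n' :: nat and v' :: "nat \<Rightarrow> int" and g' :: "nat \<Rightarrow> complex \<Rightarrow> complex" where "\<forall>i<n'. v' i \<le> w' \<and> Q (v' i) (g' i)" "\<forall>\<tau>\<in>\<H>. f' \<tau> = (\<Sum>i<n'. g' i \<tau>)"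
    by (rule mixedE)
  note f' = this(1)[rule_format, THEN conjunct1] this(1)[rule_format, THEN conjunct2] this(2)[rule_format]
  have "mixed Q (w + w') (\<lambda>\<tau>. g i \<tau> * g' j \<tau>)" if "i < n" "j < n'" for i j
  proof (rule mixed_single)
    show "Q (v i + v' j) (\<lambda>\<tau>. g i \<tau> * g' j \<tau>)" by (rule Q[OF f(2)[OF that(1)] f'(2)[OF that(2)]])
    show "v i + v' j \<le> w + w'" by (rule add_mono[OF f(1)[OF that(1)] f'(1)[OF that(2)]])
  qed
  then have "mixed Q (w + w') (\<lambda>\<tau>. \<Sum>j<n'. g i \<tau> * g' j \<tau>)" if "i < n" for i
    by (rule mixed_sum) (use that in auto)
  then have "mixed Q (w + w') (\<lambda>\<tau>. \<Sum>i<n. \<Sum>j<n'. g i \<tau> * g' j \<tau>)"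
    by (rule mixed_sum) auto
  then show ?thesis
  proof (rule mixed_cong)
    fix \<tau> assume \<tau>: "\<tau> \<in> \<H>"
    show "(\<Sum>i<n. \<Sum>j<n'. g i \<tau> * g' j \<tau>) = f \<tau> * f' \<tau>"
      unfolding f(3)[OF \<tau>] f'(3)[OF \<tau>] by (rule sum_product[symmetric])
  qed
qed

section \<open>The cotangent and its derivatives\<close>

lemma qexp_add: "qexp (z + w) = qexp z * qexp w"
  by (simp add: qexp_def ring_distribs exp_add)

lemma qexp_minus: "qexp (- z) = inverse (qexp z)"
  by (simp add: qexp_def exp_minus)

lemma qexp_nonzero [simp]: "qexp z \<noteq> 0"
  by (simp add: qexp_def)

lemma norm_qexp: "norm (qexp z) = exp (- (2 * pi * Im z))"
  by (simp add: qexp_def norm_exp_eq_Re)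

lemma qexp_eq_1_iff: "qexp z = 1 \<longleftrightarrow> z \<in> \<int>"
proof
  assume "qexp z = 1"
  then obtain n :: int where "Re (2 * of_real pi * \<i> * z) = 0" "Im (2 * of_real pi * \<i> * z) = of_int (2 * n) * pi"
    unfolding qexp_def exp_eq_1 by auto
  then have "z = of_int n" by (auto simp: complex_eq_iff)
  then show "z \<in> \<int>" by simp
next
  assume "z \<in> \<int>"
  then obtain n where "z = of_int n" by (auto elim: Ints_cases)
  then show "qexp z = 1"
    unfolding qexp_def exp_eq_1 by (auto intro!: exI[of _ n])
qed

lemma qexp_has_derivative: "(qexp has_field_derivative 2 * of_real pi * \<i> * qexp z) (at z)"
  unfolding qexp_def[abs_def] by (auto intro!: derivative_eq_intros)

abbreviation tpi :: complex where "tpi \<equiv> 2 * of_real pi * \<i>"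

lemma tpi_nonzero [simp]: "tpi \<noteq> 0" by simp

text \<open>
  This is \<open>(\<i>/2) cot (\<pi> w)\<close>. At the integers, where the denominator vanishes, it takes the value \<open>0\<close>, so
  that periodicity and oddness hold without exception.
\<close>

definition halfcot :: "complex \<Rightarrow> complex" where
  "halfcot w = (1 + qexp w) / (2 * (1 - qexp w))"

text \<open>
  The normalised derivative \<open>D = (2 \<pi> \<i>)\<^sup>-\<^sup>1 d/dw\<close> of \<^const>\<open>halfcot\<close> is \<open>halfcot\<^sup>2 - 1/4\<close>. Therefore
  \<open>D\<^sup>j halfcot\<close> is a polynomial in \<^const>\<open>halfcot\<close>, and this polynomial is divisible by \<open>X\<^sup>2 - 1/4\<close> if
  \<open>j > 0\<close>.
\<close>

fun cot_poly :: "nat \<Rightarrow> complex poly" where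
  "cot_poly 0 = [:0, 1:]"
| "cot_poly (Suc j) = pderiv (cot_poly j) * [:-1/4, 0, 1:]"

definition dcot :: "nat \<Rightarrow> complex \<Rightarrow> complex" where
  "dcot j w = poly (cot_poly j) (halfcot w)"

lemma dcot_0: "dcot 0 = halfcot" by (simp add: dcot_def fun_eq_iff)

lemma halfcot_altdef: "w \<notin> \<int> \<Longrightarrow> halfcot w = 1 / (1 - qexp w) - 1 / 2"
  by (simp add: halfcot_def field_simps flip: qexp_eq_1_iff)

lemma halfcot_sq:
  assumes "w \<notin> \<int>"
  shows "halfcot w ^ 2 - 1 / 4 = qexp w / (1 - qexp w) ^ 2"
proof -
  define D where "D = 1 - qexp w"
  have "D \<noteq> 0" using assms by (auto simp: D_def simp flip: qexp_eq_1_iff)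
  then have "(1 / D - 1 / 2) ^ 2 - 1 / 4 = (1 - D) / D ^ 2"
    by (simp add: field_simps power2_eq_square)
  then show ?thesis
    unfolding halfcot_altdef[OF assms] D_def by simp
qed

lemma halfcot_has_derivative:
  assumes "w \<notin> \<int>"
  shows "(halfcot has_field_derivative tpi * (halfcot w ^ 2 - 1 / 4)) (at w)"
proof -
  have ne: "1 - qexp w \<noteq> 0" using assms by (simp flip: qexp_eq_1_iff)
  have "((\<lambda>w. 1 / (1 - qexp w) - 1 / 2) has_field_derivative tpi * (qexp w / (1 - qexp w) ^ 2)) (at w)"
  proof -
    have "((\<lambda>w. 1 / (1 - qexp w) - 1 / 2) has_field_derivative
        (0 * (1 - qexp w) - 1 * (0 - tpi * qexp w)) / ((1 - qexp w) * (1 - qexp w)) - 0) (at w)"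
      by (intro DERIV_diff DERIV_divide DERIV_const qexp_has_derivative ne)
    then show ?thesis by (simp add: power2_eq_square)
  qed
  then have "((\<lambda>w. 1 / (1 - qexp w) - 1 / 2) has_field_derivative tpi * (halfcot w ^ 2 - 1 / 4)) (at w)"
    unfolding halfcot_sq[OF assms] .
  moreover have "open (- \<int> :: complex set)" by (simp add: open_Compl closed_Ints)
  ultimately show ?thesis
    by (rule has_field_derivative_transform_within_open) (use assms in \<open>auto simp: halfcot_altdef\<close>)
qed

lemma dcot_has_derivative:
  assumes "w \<notin> \<int>"
  shows "(dcot j has_field_derivative tpi * dcot (Suc j) w) (at w)"
proof -
  have "((\<lambda>w. poly (cot_poly j) (halfcot w)) has_field_derivative
      poly (pderiv (cot_poly j)) (halfcot w) * (tpi * (halfcot w ^ 2 - 1 / 4))) (at w)"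
    by (rule DERIV_chain2[OF poly_DERIV halfcot_has_derivative[OF assms]])
  then show ?thesis
    by (simp add: dcot_def[abs_def] algebra_simps power2_eq_square)
qed

lemma dcot_holomorphic: "dcot j holomorphic_on - \<int>"
  by (rule holomorphic_onI) (meson ComplD dcot_has_derivative field_differentiable_at_within field_differentiable_def)

lemma dcot_plus_1: "dcot j (w + 1) = dcot j w"
proof -
  have "qexp 1 = 1" by (simp add: qexp_eq_1_iff)
  then show ?thesis by (simp add: dcot_def halfcot_def qexp_add)
qed

lemma cot_poly_minus: "poly (cot_poly j) (- x) = (-1) ^ Suc j * poly (cot_poly j) x"
proof (induction j arbitrary: x)
  case (Suc j)
  have "poly (pcompose (cot_poly j) [:0, -1:]) = poly (smult ((-1) ^ Suc j) (cot_poly j))"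
    by (rule ext) (simp add: poly_pcompose Suc)
  then have "pcompose (cot_poly j) [:0, -1:] = smult ((-1) ^ Suc j) (cot_poly j)"
    by (simp only: poly_eq_poly_eq_iff)
  then have "pderiv (pcompose (cot_poly j) [:0, -1:]) = smult ((-1) ^ Suc j) (pderiv (cot_poly j))"
    by (simp only: pderiv_smult)
  then have "poly (pcompose (pderiv (cot_poly j)) [:0, -1:] * pderiv [:0, -1:]) x =
      (-1) ^ Suc j * poly (pderiv (cot_poly j)) x"
    unfolding pderiv_pcompose by simp
  then have "poly (pderiv (cot_poly j)) (- x) = (-1) ^ j * poly (pderiv (cot_poly j)) x"
    by (simp add: poly_pcompose pderiv_pCons)
  then show ?case by (simp add: algebra_simps)
qed simp

lemma halfcot_minus: "halfcot (- w) = - halfcot w"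
proof (cases "qexp w = 1")
  case False
  then show ?thesis
    by (simp add: halfcot_def qexp_minus field_simps)
qed (simp add: halfcot_def qexp_minus)

lemma dcot_minus: "dcot j (- w) = (-1) ^ Suc j * dcot j w"
  unfolding dcot_def halfcot_minus by (rule cot_poly_minus)

text \<open>
  In the upper half-plane \<^const>\<open>halfcot\<close> tends to \<open>1/2\<close> as fast as \<open>qexp w\<close> tends to \<open>0\<close>. The higher
  derivatives contain the factor \<open>halfcot\<^sup>2 - 1/4 = qexp w / (1 - qexp w)\<^sup>2\<close>, and the cofactor is bounded
  because \<^const>\<open>halfcot\<close> is.
\<close>

lemma dcot_bound:
  assumes "\<delta> > 0"
  obtains K where "K \<ge> 0"
    "\<And>w. Im w \<ge> \<delta> \<Longrightarrow> norm (dcot j w - of_bool (j = 0) / 2) \<le> K * exp (- (2 * pi * Im w))"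
proof -
  \<comment> \<open>an upper bound for \<open>|qexp w|\<close>, so that \<open>1 - qexp w\<close> stays away from \<open>0\<close>\<close>
  define \<rho> where "\<rho> = exp (- (2 * pi * \<delta>))"
  have \<rho>: "0 < \<rho>" "\<rho> < 1" using assms by (auto simp: \<rho>_def)
  have E: "norm (qexp w) \<le> \<rho>" "1 - \<rho> \<le> norm (1 - qexp w)" "w \<notin> \<int>" if "Im w \<ge> \<delta>" for w
  proof -
    show *: "norm (qexp w) \<le> \<rho>" using that unfolding \<rho>_def norm_qexp by simp
    show "1 - \<rho> \<le> norm (1 - qexp w)" using norm_triangle_ineq2[of 1 "qexp w"] * by simp
    show "w \<notin> \<int>" using that assms by (auto elim!: Ints_cases)
  qed
  show ?thesis
  proof (cases j)
    case 0
    show ?thesis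
    proof (rule that[of "1 / (1 - \<rho>)"])
      fix w assume w: "Im w \<ge> \<delta>"
      have ne: "1 - qexp w \<noteq> 0" using E[OF w] \<rho> by auto
      then have "dcot j w - of_bool (j = 0) / 2 = qexp w / (1 - qexp w)"
        by (simp add: 0 dcot_0 halfcot_def field_simps)
      then have "norm (dcot j w - of_bool (j = 0) / 2) = norm (qexp w) / norm (1 - qexp w)"
        by (simp add: norm_divide)
      also have "\<dots> \<le> norm (qexp w) / (1 - \<rho>)" using E[OF w] \<rho> by (intro divide_left_mono mult_pos_pos) auto
      finally show "norm (dcot j w - of_bool (j = 0) / 2) \<le> 1 / (1 - \<rho>) * exp (- (2 * pi * Im w))"
        by (simp add: norm_qexp)
    qed (use \<rho> in auto)
  next
    case (Suc i)
    define B where "B = 2 / (2 * (1 - \<rho>))"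
    have "compact (poly (pderiv (cot_poly i)) ` cball 0 B)"
      by (intro compact_continuous_image continuous_intros compact_cball)
    then obtain R where R: "R > 0" "\<And>x. norm x \<le> B \<Longrightarrow> norm (poly (pderiv (cot_poly i)) x) \<le> R"
      using compact_imp_bounded bounded_pos by (metis imageI mem_cball_0)
    show ?thesis
    proof (rule that[of "R / (1 - \<rho>) ^ 2"])
      fix w assume w: "Im w \<ge> \<delta>"
      have ne: "1 - qexp w \<noteq> 0" using E[OF w] \<rho> by auto
      have "norm (halfcot w) = norm (1 + qexp w) / (2 * norm (1 - qexp w))"
        unfolding halfcot_def norm_divide norm_mult by simp
      also have "\<dots> \<le> 2 / (2 * (1 - \<rho>))"
        using E[OF w] \<rho> norm_triangle_ineq[of 1 "qexp w"] by (intro frac_le) auto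
      finally have *: "norm (poly (pderiv (cot_poly i)) (halfcot w)) \<le> R" by (intro R) (simp only: B_def)
      have "norm (dcot j w - of_bool (j = 0) / 2) = norm (poly (pderiv (cot_poly i)) (halfcot w)) * norm (halfcot w ^ 2 - 1 / 4)"
        by (simp add: Suc dcot_def norm_mult[symmetric] power2_eq_square algebra_simps)
      also have "norm (halfcot w ^ 2 - 1 / 4) = norm (qexp w) / norm (1 - qexp w) ^ 2"
        using E[OF w] by (simp add: halfcot_sq norm_divide norm_power)
      also have "norm (poly (pderiv (cot_poly i)) (halfcot w)) * (norm (qexp w) / norm (1 - qexp w) ^ 2)
          \<le> R * (norm (qexp w) / (1 - \<rho>) ^ 2)"
        using E[OF w] \<rho> R by (intro mult_mono * divide_left_mono power_mono mult_pos_pos zero_less_power) auto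
      finally show "norm (dcot j w - of_bool (j = 0) / 2) \<le> R / (1 - \<rho>) ^ 2 * exp (- (2 * pi * Im w))"
        by (simp add: norm_qexp)
    qed (use R \<rho> in auto)
  qed
qed

section \<open>Eisenstein series\<close>

text \<open>
  Pairing \<open>n\<close> with \<open>-n\<close> cancels the limits \<open>\<plusminus> 1/2\<close> of \<^const>\<open>halfcot\<close>, so the case \<open>j = 0\<close> (weight \<open>1\<close>)
  converges as well.
\<close>

definition pairterm :: "nat \<Rightarrow> nat \<Rightarrow> complex \<Rightarrow> complex \<Rightarrow> complex" where
  "pairterm j n z \<tau> = dcot j (z + of_nat n * \<tau>) + dcot j (z - of_nat n * \<tau>)"

lemma pairterm_bound:
  assumes "\<delta> > 0"
  obtains K where "K \<ge> 0"
    "\<And>n z \<tau>. of_nat n * Im \<tau> - \<bar>Im z\<bar> \<ge> \<delta> \<Longrightarrow>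
       norm (pairterm j n z \<tau>) \<le> K * exp (- (2 * pi * (of_nat n * Im \<tau> - \<bar>Im z\<bar>)))"
proof -
  obtain K where K: "K \<ge> 0"
    "\<And>w. Im w \<ge> \<delta> \<Longrightarrow> norm (dcot j w - of_bool (j = 0) / 2) \<le> K * exp (- (2 * pi * Im w))"
    using dcot_bound[OF assms] by blast
  show ?thesis
  proof (rule that[of "2 * K"])
    fix n z \<tau> assume a: "of_nat n * Im \<tau> - \<bar>Im z\<bar> \<ge> \<delta>"
    let ?c = "of_bool (j = 0) / 2 :: complex"
    let ?e = "exp (- (2 * pi * (of_nat n * Im \<tau> - \<bar>Im z\<bar>)))"
    have "dcot j (z - of_nat n * \<tau>) = (-1) ^ Suc j * dcot j (of_nat n * \<tau> - z)"
      using dcot_minus[of j "of_nat n * \<tau> - z"] by simp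
    then have eq: "pairterm j n z \<tau> = (dcot j (of_nat n * \<tau> + z) - ?c) + (-1) ^ Suc j * (dcot j (of_nat n * \<tau> - z) - ?c)"
      by (cases j) (auto simp: pairterm_def algebra_simps)
    have le: "norm (dcot j (of_nat n * \<tau> + s) - ?c) \<le> K * ?e" if "\<bar>Im s\<bar> = \<bar>Im z\<bar>" for s
    proof -
      have 1: "Im (of_nat n * \<tau> + s) \<ge> of_nat n * Im \<tau> - \<bar>Im z\<bar>" using that by simp
      then have "norm (dcot j (of_nat n * \<tau> + s) - ?c) \<le> K * exp (- (2 * pi * Im (of_nat n * \<tau> + s)))"
        using a by (intro K) auto
      also have "\<dots> \<le> K * ?e" using 1 K(1) by (intro mult_left_mono) auto
      finally show ?thesis .
    qed
    have "norm (pairterm j n z \<tau>) \<le> norm (dcot j (of_nat n * \<tau> + z) - ?c) + norm (dcot j (of_nat n * \<tau> - z) - ?c)"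
      unfolding eq by (rule order_trans[OF norm_triangle_ineq]) (simp add: norm_mult norm_power)
    also have "\<dots> \<le> K * ?e + K * ?e" using le[of z] le[of "-z"] by (intro add_mono) auto
    finally show "norm (pairterm j n z \<tau>) \<le> 2 * K * ?e" by simp
  qed (use K in auto)
qed

lemma summable_exp_linear:
  assumes "y > 0"
  shows "summable (\<lambda>n. K * exp (- (2 * pi * (of_nat (Suc n) * y - b))))"
proof -
  have "summable (\<lambda>n. (K * exp (2 * pi * (b - y))) * exp (- (2 * pi * y)) ^ n)"
    using assms by (intro summable_mult summable_geometric) auto
  also have "(\<lambda>n. (K * exp (2 * pi * (b - y))) * exp (- (2 * pi * y)) ^ n) =
      (\<lambda>n. K * exp (- (2 * pi * (of_nat (Suc n) * y - b))))"
    by (auto simp: fun_eq_iff exp_of_nat_mult[symmetric] exp_add[symmetric] algebra_simps)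
  finally show ?thesis .
qed

lemma pairterm_majorant:
  assumes "y > 0" "b \<ge> 0"
  obtains h where "summable h"
    "\<forall>\<^sub>F n in sequentially. \<forall>z \<tau>. Im \<tau> \<ge> y \<longrightarrow> \<bar>Im z\<bar> \<le> b \<longrightarrow> norm (pairterm j (Suc n) z \<tau>) \<le> h n"
proof -
  obtain K where K: "K \<ge> 0"
    "\<And>n z \<tau>. of_nat n * Im \<tau> - \<bar>Im z\<bar> \<ge> 1 \<Longrightarrow>
       norm (pairterm j n z \<tau>) \<le> K * exp (- (2 * pi * (of_nat n * Im \<tau> - \<bar>Im z\<bar>)))"
    using pairterm_bound[of 1 j] by auto
  show ?thesis
  proof (rule that[OF summable_exp_linear[OF assms(1), of K b]])
    obtain N where N: "(1 + b) / y \<le> of_nat N" using real_arch_simple by blast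
    show "\<forall>\<^sub>F n in sequentially. \<forall>z \<tau>. Im \<tau> \<ge> y \<longrightarrow> \<bar>Im z\<bar> \<le> b \<longrightarrow>
        norm (pairterm j (Suc n) z \<tau>) \<le> K * exp (- (2 * pi * (of_nat (Suc n) * y - b)))"
      using eventually_ge_at_top[of N]
    proof (eventually_elim, intro allI impI)
      fix n z \<tau> assume n: "n \<ge> N" and \<tau>: "Im \<tau> \<ge> y" and z: "\<bar>Im z\<bar> \<le> b"
      have "(1 + b) / y \<le> real (Suc n)" using n N by linarith
      then have 1: "1 + b \<le> of_nat (Suc n) * y" using assms by (simp add: field_simps)
      have 2: "of_nat (Suc n) * y \<le> of_nat (Suc n) * Im \<tau>" using \<tau> by (intro mult_left_mono) auto
      have "norm (pairterm j (Suc n) z \<tau>) \<le> K * exp (- (2 * pi * (of_nat (Suc n) * Im \<tau> - \<bar>Im z\<bar>)))"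
        using 1 2 z by (intro K) linarith
      also have "\<dots> \<le> K * exp (- (2 * pi * (of_nat (Suc n) * y - b)))"
      proof -
        have "of_nat (Suc n) * y - b \<le> of_nat (Suc n) * Im \<tau> - \<bar>Im z\<bar>" using 2 z by linarith
        then show ?thesis using K(1) by (intro mult_left_mono) (simp_all only: exp_le_cancel_iff neg_le_iff_le mult_le_cancel_left_pos pi_gt_zero zero_less_mult_iff zero_less_numeral simp_thms)
      qed
      finally show "norm (pairterm j (Suc n) z \<tau>) \<le> K * exp (- (2 * pi * (of_nat (Suc n) * y - b)))" .
    qed
  qed
qed

lemma summable_pairterm:
  assumes "\<tau> \<in> \<H>"
  shows "summable (\<lambda>n. norm (pairterm j (Suc n) z \<tau>))"
proof -
  obtain h where h: "summable h" "\<forall>\<^sub>F n in sequentially. \<forall>w \<sigma>. Im \<sigma> \<ge> Im \<tau> \<longrightarrow> \<bar>Im w\<bar> \<le> \<bar>Im z\<bar> \<longrightarrow> norm (pairterm j (Suc n) w \<sigma>) \<le> h n"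
    using pairterm_majorant[of "Im \<tau>" "\<bar>Im z\<bar>"] assms by (auto simp: upper_half_plane_iff)
  from h(2) have "\<forall>\<^sub>F n in sequentially. norm (norm (pairterm j (Suc n) z \<tau>)) \<le> h n"
    by eventually_elim auto
  then show ?thesis using h(1) by (rule summable_comparison_test_ev)
qed

definition pairsum :: "nat \<Rightarrow> complex \<Rightarrow> complex \<Rightarrow> complex" where
  "pairsum j z \<tau> = suminf (\<lambda>n. pairterm j (Suc n) z \<tau>)"

text \<open>
  The Eisenstein series \<open>\<Sum>\<^bsub>n \<in> \<int>\<^esub> D\<^sup>j halfcot (z + n \<tau>)\<close> with Eisenstein's order of summation. For
  \<open>j \<ge> 2\<close> it is, up to a constant factor, the lattice sum \<open>\<Sum>\<^bsub>\<omega>\<^esub> (z + \<omega>)\<^sup>-\<^sup>j\<^sup>-\<^sup>1\<close>; for \<open>j = 0, 1\<close> it is a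
  version of the zeta function and of the \<open>\<wp>\<close>-function of Weierstrass.
\<close>

definition eis :: "nat \<Rightarrow> complex \<Rightarrow> complex \<Rightarrow> complex" where
  "eis j z \<tau> = dcot j z + pairsum j z \<tau>"

lemma pairterm_sums:
  assumes "\<tau> \<in> \<H>"
  shows "(\<lambda>n. pairterm j (Suc n) z \<tau>) sums pairsum j z \<tau>"
  unfolding pairsum_def using summable_norm_cancel[OF summable_pairterm[OF assms]] by (rule summable_sums)

section \<open>Holomorphy of the Eisenstein series\<close>

definition lattice :: "complex \<Rightarrow> complex set" where
  "lattice \<tau> = {of_int m + of_int n * \<tau> |m n. True}"

lemma latticeI: "of_int m + of_int n * \<tau> \<in> lattice \<tau>"
  by (auto simp: lattice_def)

lemma lattice_uminus_iff: "- z \<in> lattice \<tau> \<longleftrightarrow> z \<in> lattice \<tau>"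
proof -
  have "- z \<in> lattice \<tau>" if "z \<in> lattice \<tau>" for z
  proof -
    from that obtain m n where "z = of_int m + of_int n * \<tau>" by (auto simp: lattice_def)
    then have "- z = of_int (-m) + of_int (-n) * \<tau>" by simp
    then show ?thesis by (simp only: latticeI)
  qed
  from this[of z] this[of "-z"] show ?thesis by auto
qed

lemma lattice_discrete:
  assumes "\<tau> \<in> \<H>" "z \<in> lattice \<tau>" "norm z < min 1 (Im \<tau>)"
  shows "z = 0"
proof -
  obtain m n where z: "z = of_int m + of_int n * \<tau>" using assms(2) by (auto simp: lattice_def)
  have pos: "Im \<tau> > 0" using assms by (simp add: upper_half_plane_iff)
  have "\<bar>of_int n * Im \<tau>\<bar> < Im \<tau>" using abs_Im_le_cmod[of z] assms(3) by (simp add: z)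
  then have "\<bar>real_of_int n\<bar> < 1" using pos by (simp add: abs_mult)
  then have "n = 0" by linarith
  moreover have "\<bar>real_of_int m\<bar> < 1" using abs_Re_le_cmod[of z] assms(3) \<open>n = 0\<close> by (simp add: z)
  then have "m = 0" by linarith
  ultimately show ?thesis by (simp add: z)
qed

lemma lattice_diff: "z \<in> lattice \<tau> \<Longrightarrow> w \<in> lattice \<tau> \<Longrightarrow> z - w \<in> lattice \<tau>"
proof -
  assume "z \<in> lattice \<tau>" "w \<in> lattice \<tau>"
  then obtain m n m' n' where "z = of_int m + of_int n * \<tau>" "w = of_int m' + of_int n' * \<tau>"
    by (auto simp: lattice_def)
  then have "z - w = of_int (m - m') + of_int (n - n') * \<tau>" by (simp add: algebra_simps)
  then show ?thesis by (simp only: latticeI)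
qed

lemma closed_subset_lattice:
  assumes "\<tau> \<in> \<H>" "X \<subseteq> lattice \<tau>"
  shows "closed X"
proof (rule discrete_imp_closed[of "min 1 (Im \<tau>)"])
  show "\<forall>x\<in>X. \<forall>y\<in>X. dist y x < min 1 (Im \<tau>) \<longrightarrow> y = x"
  proof (intro ballI impI)
    fix x y assume "x \<in> X" "y \<in> X" "dist y x < min 1 (Im \<tau>)"
    then have "y - x = 0"
      using assms(2) by (intro lattice_discrete[OF assms(1)] lattice_diff) (auto simp: dist_norm)
    then show "y = x" by simp
  qed
qed (use assms in \<open>simp add: upper_half_plane_iff\<close>)

text \<open>
  The poles of \<^const>\<open>pairsum\<close>: those lattice points that are not poles of the leading term
  \<^const>\<open>dcot\<close>.
\<close>

definition off_axis_lattice :: "complex \<Rightarrow> complex set" where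
  "off_axis_lattice \<tau> = {of_int m + of_int n * \<tau> |m n. n \<noteq> 0}"

lemma off_axis_subset: "off_axis_lattice \<tau> \<subseteq> lattice \<tau>"
  by (auto simp: off_axis_lattice_def lattice_def)

lemma off_axis_not_Ints:
  assumes "z \<notin> off_axis_lattice \<tau>"
  shows "z + of_nat (Suc n) * \<tau> \<notin> \<int>" "z - of_nat (Suc n) * \<tau> \<notin> \<int>"
proof -
  have *: "z - of_int l * \<tau> \<notin> \<int>" if "l \<noteq> 0" for l
  proof
    assume "z - of_int l * \<tau> \<in> \<int>"
    then obtain m where m: "z - of_int l * \<tau> = of_int m" by (rule Ints_cases)
    have "z = (z - of_int l * \<tau>) + of_int l * \<tau>" by simp
    also have "\<dots> = of_int m + of_int l * \<tau>" by (simp only: m)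
    finally show False using assms that unfolding off_axis_lattice_def by blast
  qed
  have l: "int (Suc n) \<noteq> 0" "- int (Suc n) \<noteq> 0" by simp_all
  show "z - of_nat (Suc n) * \<tau> \<notin> \<int>"
    using *[OF l(1)] by (simp only: of_int_of_nat_eq not_False_eq_True)
  show "z + of_nat (Suc n) * \<tau> \<notin> \<int>"
    using *[OF l(2)] by (simp only: of_int_of_nat_eq of_int_minus mult_minus_left diff_minus_eq_add not_False_eq_True)
qed

text \<open>
  The series converges locally uniformly off its poles, since all but finitely many terms obey the
  exponential bound near a given point; hence it can be differentiated term by term.
\<close>

lemma pairsum_has_derivative:
  assumes \<tau>: "\<tau> \<in> \<H>" and z: "z \<notin> off_axis_lattice \<tau>"
  shows "((\<lambda>z. pairsum j z \<tau>) has_field_derivative tpi * pairsum (Suc j) z \<tau>) (at z)"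
proof -
  let ?S = "- off_axis_lattice \<tau>"
  have S: "open ?S" using closed_subset_lattice[OF \<tau> off_axis_subset] by (simp add: open_Compl)
  have "\<exists>g g'. \<forall>x\<in>?S. (\<lambda>n. pairterm j (Suc n) x \<tau>) sums g x \<and>
      (\<lambda>n. tpi * pairterm (Suc j) (Suc n) x \<tau>) sums g' x \<and> (g has_field_derivative g' x) (at x)"
  proof (rule series_and_derivative_comparison_local[OF S])
    fix n x assume "x \<in> ?S"
    then have x: "x + of_nat (Suc n) * \<tau> \<notin> \<int>" "x - of_nat (Suc n) * \<tau> \<notin> \<int>"
      using off_axis_not_Ints by auto
    have "((\<lambda>x. dcot j (x + of_nat (Suc n) * \<tau>) + dcot j (x - of_nat (Suc n) * \<tau>)) has_field_derivative
        tpi * dcot (Suc j) (x + of_nat (Suc n) * \<tau>) * (1 + 0) + tpi * dcot (Suc j) (x - of_nat (Suc n) * \<tau>) * (1 - 0)) (at x)"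
      by (intro DERIV_add DERIV_chain2[OF dcot_has_derivative] DERIV_diff DERIV_ident DERIV_const x)
    then show "((\<lambda>x. pairterm j (Suc n) x \<tau>) has_field_derivative tpi * pairterm (Suc j) (Suc n) x \<tau>) (at x)"
      unfolding pairterm_def by (simp add: algebra_simps)
  next
    fix x assume "x \<in> ?S"
    obtain h where h: "summable h" "\<forall>\<^sub>F n in sequentially. \<forall>z \<sigma>. Im \<sigma> \<ge> Im \<tau> \<longrightarrow> \<bar>Im z\<bar> \<le> \<bar>Im x\<bar> + 1 \<longrightarrow> norm (pairterm j (Suc n) z \<sigma>) \<le> h n"
      using pairterm_majorant[of "Im \<tau>" "\<bar>Im x\<bar> + 1"] \<tau> by (auto simp: upper_half_plane_iff)
    have "\<forall>\<^sub>F n in sequentially. \<forall>y\<in>ball x 1 \<inter> ?S. norm (pairterm j (Suc n) y \<tau>) \<le> h n"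
      using h(2)
    proof (eventually_elim, intro ballI)
      fix n y assume hn: "\<forall>z \<sigma>. Im \<sigma> \<ge> Im \<tau> \<longrightarrow> \<bar>Im z\<bar> \<le> \<bar>Im x\<bar> + 1 \<longrightarrow> norm (pairterm j (Suc n) z \<sigma>) \<le> h n"
        and y: "y \<in> ball x 1 \<inter> ?S"
      have "\<bar>Im (x - y)\<bar> \<le> norm (x - y)" by (rule abs_Im_le_cmod)
      moreover have "norm (x - y) < 1" using y by (simp add: dist_norm)
      ultimately have "\<bar>Im y\<bar> \<le> \<bar>Im x\<bar> + 1" unfolding minus_complex.sel by linarith
      then show "norm (pairterm j (Suc n) y \<tau>) \<le> h n" using hn by blast
    qed
    with h(1) show "\<exists>d h. 0 < d \<and> summable h \<and> (\<forall>\<^sub>F n in sequentially. \<forall>y\<in>ball x d \<inter> ?S. norm (pairterm j (Suc n) y \<tau>) \<le> h n)"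
      by (intro exI[of _ "1::real"] exI[of _ h]) auto
  qed
  then obtain g g' where g: "\<And>x. x \<in> ?S \<Longrightarrow> (\<lambda>n. pairterm j (Suc n) x \<tau>) sums g x"
      "\<And>x. x \<in> ?S \<Longrightarrow> (\<lambda>n. tpi * pairterm (Suc j) (Suc n) x \<tau>) sums g' x"
      "\<And>x. x \<in> ?S \<Longrightarrow> (g has_field_derivative g' x) (at x)" by blast
  have "(\<lambda>n. tpi * pairterm (Suc j) (Suc n) z \<tau>) sums (tpi * pairsum (Suc j) z \<tau>)"
    by (intro sums_mult pairterm_sums \<tau>)
  with g(2)[of z] z have g'z: "g' z = tpi * pairsum (Suc j) z \<tau>" by (auto dest: sums_unique2)
  have "g x = pairsum j x \<tau>" if "x \<in> ?S" for x
    using g(1)[OF that] pairterm_sums[OF \<tau>] by (rule sums_unique2)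
  with g(3)[of z] g'z S z show ?thesis
    by (auto intro: has_field_derivative_transform_within_open[of g _ z ?S])
qed

lemma lattice_not_Ints: "z \<notin> lattice \<tau> \<Longrightarrow> z \<notin> \<int>"
proof
  assume z: "z \<notin> lattice \<tau>" "z \<in> \<int>"
  then obtain m where "z = of_int m + of_int 0 * \<tau>" by (auto elim: Ints_cases)
  with z latticeI show False by blast
qed

lemma eis_has_derivative:
  assumes \<tau>: "\<tau> \<in> \<H>" and z: "z \<notin> lattice \<tau>"
  shows "((\<lambda>z. eis j z \<tau>) has_field_derivative tpi * eis (Suc j) z \<tau>) (at z)"
proof -
  have "z \<notin> off_axis_lattice \<tau>" using z off_axis_subset by blast
  with lattice_not_Ints[OF z] show ?thesis
    unfolding eis_def distrib_left by (intro DERIV_add dcot_has_derivative pairsum_has_derivative \<tau>)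
qed

lemma eis_holomorphic_in_tau:
  assumes "Im r = 0"
  shows "(\<lambda>\<tau>. eis j r \<tau>) holomorphic_on \<H>"
proof -
  let ?f = "\<lambda>n \<tau>. pairterm j (Suc n) r \<tau>"
  have hol: "?f n holomorphic_on \<H>" for n
  proof -
    have "(\<lambda>\<tau>. r + of_nat (Suc n) * \<tau>) ` \<H> \<subseteq> - \<int>" "(\<lambda>\<tau>. r - of_nat (Suc n) * \<tau>) ` \<H> \<subseteq> - \<int>"
      using assms by (auto simp: upper_half_plane_iff complex_is_Int_iff add_pos_nonneg)
    then have "(dcot j \<circ> (\<lambda>\<tau>. r + of_nat (Suc n) * \<tau>)) holomorphic_on \<H>"
        "(dcot j \<circ> (\<lambda>\<tau>. r - of_nat (Suc n) * \<tau>)) holomorphic_on \<H>"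
      by (auto intro!: holomorphic_on_compose_gen[OF _ dcot_holomorphic] holomorphic_intros)
    then show ?thesis unfolding pairterm_def o_def by (intro holomorphic_on_add)
  qed
  have "\<exists>g g'. \<forall>x\<in>\<H>. (\<lambda>n. ?f n x) sums g x \<and> (\<lambda>n. deriv (?f n) x) sums g' x \<and> (g has_field_derivative g' x) (at x)"
  proof (rule series_and_derivative_comparison_local[OF open_upper_half_plane])
    fix n x assume "x \<in> \<H>"
    then show "(?f n has_field_derivative deriv (?f n) x) (at x)"
      using hol open_upper_half_plane by (rule holomorphic_derivI[rotated 2])
  next
    fix x assume x: "x \<in> \<H>"
    define y where "y = Im x / 2"
    have y: "y > 0" using x by (simp add: y_def upper_half_plane_iff)
    obtain h where h: "summable h" "\<forall>\<^sub>F n in sequentially. \<forall>z \<sigma>. Im \<sigma> \<ge> y \<longrightarrow> \<bar>Im z\<bar> \<le> 0 \<longrightarrow> norm (pairterm j (Suc n) z \<sigma>) \<le> h n"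
      using pairterm_majorant[of y 0] y by auto
    have "\<forall>\<^sub>F n in sequentially. \<forall>\<sigma>\<in>ball x y \<inter> \<H>. norm (?f n \<sigma>) \<le> h n"
      using h(2)
    proof (eventually_elim, intro ballI)
      fix n \<sigma> assume hn: "\<forall>z \<sigma>. Im \<sigma> \<ge> y \<longrightarrow> \<bar>Im z\<bar> \<le> 0 \<longrightarrow> norm (pairterm j (Suc n) z \<sigma>) \<le> h n"
        and \<sigma>: "\<sigma> \<in> ball x y \<inter> \<H>"
      have "\<bar>Im (x - \<sigma>)\<bar> \<le> norm (x - \<sigma>)" by (rule abs_Im_le_cmod)
      moreover have "norm (x - \<sigma>) < Im x / 2" using \<sigma> by (simp add: dist_norm y_def)
      ultimately have "Im \<sigma> \<ge> y" unfolding minus_complex.sel y_def by linarith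
      then show "norm (?f n \<sigma>) \<le> h n" using hn assms by simp
    qed
    with h(1) y show "\<exists>d h. 0 < d \<and> summable h \<and> (\<forall>\<^sub>F n in sequentially. \<forall>\<sigma>\<in>ball x d \<inter> \<H>. norm (?f n \<sigma>) \<le> h n)"
      by (intro exI[of _ y] exI[of _ h]) auto
  qed
  then obtain g g' where g: "\<And>x. x \<in> \<H> \<Longrightarrow> (\<lambda>n. ?f n x) sums g x"
      "\<And>x. x \<in> \<H> \<Longrightarrow> (g has_field_derivative g' x) (at x)" by blast
  have "g holomorphic_on \<H>"
    using g(2) by (meson field_differentiable_at_within field_differentiable_def holomorphic_onI)
  moreover have "g \<tau> = pairsum j r \<tau>" if "\<tau> \<in> \<H>" for \<tau>
    using g(1)[OF that] pairterm_sums[OF that] by (rule sums_unique2)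
  ultimately have "(\<lambda>\<tau>. pairsum j r \<tau>) holomorphic_on \<H>"
    by (rule holomorphic_transform)
  then show ?thesis unfolding eis_def by (intro holomorphic_intros)
qed

section \<open>Periods\<close>

lemma eis_partial_sums:
  assumes "\<tau> \<in> \<H>"
  shows "(\<lambda>M. dcot j z + (\<Sum>n<M. pairterm j (Suc n) z \<tau>)) \<longlonglongrightarrow> eis j z \<tau>"
  unfolding eis_def using pairterm_sums[OF assms] by (intro tendsto_intros) (simp add: sums_def)

lemma dcot_tendsto:
  assumes "\<tau> \<in> \<H>"
  shows "(\<lambda>M. dcot j (z + of_nat M * \<tau>)) \<longlonglongrightarrow> of_bool (j = 0) / 2"
    and "(\<lambda>M. dcot j (z - of_nat M * \<tau>)) \<longlonglongrightarrow> - of_bool (j = 0) / 2"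
proof -
  have pos: "Im \<tau> > 0" using assms by (simp add: upper_half_plane_iff)
  have main: "(\<lambda>M. dcot j (z + of_nat M * \<tau>)) \<longlonglongrightarrow> of_bool (j = 0) / 2" for z
  proof -
    obtain K where K: "K \<ge> 0"
      "\<And>w. Im w \<ge> 1 \<Longrightarrow> norm (dcot j w - of_bool (j = 0) / 2) \<le> K * exp (- (2 * pi * Im w))"
      using dcot_bound[of 1 j] by auto
    show ?thesis
    proof (rule LIM_zero_cancel, rule Lim_null_comparison)
    have lim: "filterlim (\<lambda>M. Im z + real M * Im \<tau>) at_top sequentially"
      using pos by real_asymp
    then have "\<forall>\<^sub>F M in sequentially. Im z + real M * Im \<tau> \<ge> 1"
      by (simp add: filterlim_at_top)
    then show "\<forall>\<^sub>F M in sequentially. norm (dcot j (z + of_nat M * \<tau>) - of_bool (j = 0) / 2)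
        \<le> K * exp (- (2 * pi * (Im z + real M * Im \<tau>)))"
    proof eventually_elim
      case (elim M)
      then show ?case using K(2)[of "z + of_nat M * \<tau>"] by simp
    qed
    show "(\<lambda>M. K * exp (- (2 * pi * (Im z + real M * Im \<tau>)))) \<longlonglongrightarrow> 0"
      using pos by real_asymp
    qed
  qed
  show "(\<lambda>M. dcot j (z + of_nat M * \<tau>)) \<longlonglongrightarrow> of_bool (j = 0) / 2" by (rule main)
  have "dcot j (z - of_nat M * \<tau>) = (-1) ^ Suc j * dcot j (- z + of_nat M * \<tau>)" for M
    using dcot_minus[of j "- z + of_nat M * \<tau>"] by simp
  moreover have "(\<lambda>M. (-1) ^ Suc j * dcot j (- z + of_nat M * \<tau>)) \<longlonglongrightarrow> (-1) ^ Suc j * (of_bool (j = 0) / 2)"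
    by (intro tendsto_intros main)
  moreover have "(-1) ^ Suc j * (of_bool (j = 0) / 2) = (- of_bool (j = 0) / 2 :: complex)"
    by (cases j) auto
  ultimately show "(\<lambda>M. dcot j (z - of_nat M * \<tau>)) \<longlonglongrightarrow> - of_bool (j = 0) / 2" by (simp only:)
qed

lemma eis_plus_1: "eis j (z + 1) \<tau> = eis j z \<tau>"
proof -
  have "pairterm j n (z + 1) \<tau> = pairterm j n z \<tau>" for n
    using dcot_plus_1[of j "z + of_nat n * \<tau>"] dcot_plus_1[of j "z - of_nat n * \<tau>"]
    by (simp add: pairterm_def algebra_simps)
  then show ?thesis by (simp add: eis_def pairsum_def dcot_plus_1)
qed

text \<open>
  The difference of symmetric partial sums at \<open>z + \<tau>\<close> and \<open>z\<close> telescopes to a difference of two boundary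
  terms, which tend to \<open>1/2\<close> and \<open>-1/2\<close> when \<open>j = 0\<close> and to \<open>0\<close> otherwise.
\<close>

lemma eis_plus_tau:
  assumes "\<tau> \<in> \<H>"
  shows "eis j (z + \<tau>) \<tau> = eis j z \<tau> + of_bool (j = 0)"
proof -
  let ?P = "\<lambda>z M. dcot j z + (\<Sum>n<M. pairterm j (Suc n) z \<tau>)"
  \<comment> \<open>each partial sum extends over the symmetric range from \<open>-M\<close> to \<open>M\<close>\<close>
  have telescope: "?P (z + \<tau>) M - ?P z M = dcot j (z + \<tau> + of_nat M * \<tau>) - dcot j (z - of_nat M * \<tau>)" for M
  proof (induction M)
    case (Suc M)
    have "z + \<tau> - of_nat (Suc M) * \<tau> = z - of_nat M * \<tau>" "z + of_nat (Suc M) * \<tau> = z + \<tau> + of_nat M * \<tau>"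
      by (simp_all add: algebra_simps)
    then have pair: "pairterm j (Suc M) (z + \<tau>) \<tau> - pairterm j (Suc M) z \<tau> =
        dcot j (z + \<tau> + of_nat (Suc M) * \<tau>) + dcot j (z - of_nat M * \<tau>)
        - (dcot j (z + \<tau> + of_nat M * \<tau>) + dcot j (z - of_nat (Suc M) * \<tau>))"
      by (simp only: pairterm_def)
    have "?P (z + \<tau>) (Suc M) - ?P z (Suc M) = (?P (z + \<tau>) M - ?P z M) +
        (pairterm j (Suc M) (z + \<tau>) \<tau> - pairterm j (Suc M) z \<tau>)" by simp
    also have "\<dots> = dcot j (z + \<tau> + of_nat (Suc M) * \<tau>) - dcot j (z - of_nat (Suc M) * \<tau>)"
      unfolding Suc pair by simp
    finally show ?case .
  qed simp
  have "(\<lambda>M. ?P (z + \<tau>) M - ?P z M) \<longlonglongrightarrow> eis j (z + \<tau>) \<tau> - eis j z \<tau>"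
    by (intro tendsto_diff eis_partial_sums assms)
  moreover have "(\<lambda>M. ?P (z + \<tau>) M - ?P z M) \<longlonglongrightarrow> of_bool (j = 0) / 2 - (- of_bool (j = 0) / 2)"
    unfolding telescope by (intro tendsto_diff dcot_tendsto assms)
  ultimately have "eis j (z + \<tau>) \<tau> - eis j z \<tau> = of_bool (j = 0) / 2 - (- of_bool (j = 0) / 2)"
    by (rule LIMSEQ_unique)
  then show ?thesis by (simp add: algebra_simps)
qed

lemma int_translation:
  fixes f :: "complex \<Rightarrow> complex"
  assumes "\<And>z. f (z + p) = f z + c"
  shows "f (z + of_int n * p) = f z + of_int n * c"
proof (induction n arbitrary: z rule: int_induct[of _ 0])
  case (step1 i)
  have "f (z + of_int (i + 1) * p) = f ((z + of_int i * p) + p)" by (simp add: algebra_simps)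
  also have "\<dots> = f (z + of_int i * p) + c" by (rule assms)
  also have "\<dots> = f z + of_int i * c + c" by (simp only: step1.IH)
  also have "\<dots> = f z + of_int (i + 1) * c" by (simp add: algebra_simps)
  finally show ?case .
next
  case (step2 i)
  have "f (z + of_int i * p) = f ((z + of_int (i - 1) * p) + p)" by (simp add: algebra_simps)
  also have "\<dots> = f (z + of_int (i - 1) * p) + c" by (rule assms)
  finally have "f (z + of_int (i - 1) * p) = f (z + of_int i * p) - c" by simp
  also have "\<dots> = f z + of_int i * c - c" by (simp only: step2.IH)
  also have "\<dots> = f z + of_int (i - 1) * c" by (simp add: algebra_simps)
  finally show ?case .
qed simp

lemma eis_translate:
  assumes "\<tau> \<in> \<H>"
  shows "eis j (z + of_int m + of_int n * \<tau>) \<tau> = eis j z \<tau> + of_int n * of_bool (j = 0)"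
proof -
  have "eis j (z + of_int m + of_int n * \<tau>) \<tau> = eis j (z + of_int m * 1) \<tau> + of_int n * of_bool (j = 0)"
    using int_translation[of "\<lambda>z. eis j z \<tau>" \<tau> "of_bool (j = 0)" "z + of_int m" n, OF eis_plus_tau[OF assms]] by simp
  also have "eis j (z + of_int m * 1) \<tau> = eis j z \<tau>"
    using int_translation[of "\<lambda>z. eis j z \<tau>" 1 0 z m] eis_plus_1[of j _ \<tau>] by simp
  finally show ?thesis .
qed

lemma eis_minus: "eis j (- z) \<tau> = (-1) ^ Suc j * eis j z \<tau>" if "\<tau> \<in> \<H>"
proof -
  have "pairterm j n (- z) \<tau> = (-1) ^ Suc j * pairterm j n z \<tau>" for n
    using dcot_minus[of j "z + of_nat n * \<tau>"] dcot_minus[of j "z - of_nat n * \<tau>"]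
    by (simp add: pairterm_def algebra_simps)
  then have "pairsum j (- z) \<tau> = (-1) ^ Suc j * pairsum j z \<tau>"
    unfolding pairsum_def by (simp add: suminf_mult[OF summable_norm_cancel[OF summable_pairterm[OF that]], symmetric] del: power_Suc)
  then show ?thesis by (simp only: eis_def dcot_minus distrib_left)
qed

section \<open>Transformation under unimodular matrices\<close>

lemma lattice_translate_cell:
  assumes "\<tau> \<in> \<H>"
  obtains m n :: int and s t :: real where "0 \<le> s" "s \<le> 1" "0 \<le> t" "t \<le> 1"
    "z = (of_real s + of_real t * \<tau>) + of_int m + of_int n * \<tau>"
proof -
  have pos: "Im \<tau> > 0" using assms by (simp add: upper_half_plane_iff)
  define y where "y = Im z / Im \<tau>"
  define x where "x = Re z - y * Re \<tau>"
  have z: "z = of_real x + of_real y * \<tau>"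
    using pos by (simp add: complex_eq_iff x_def y_def)
  show ?thesis
  proof (rule that[of "frac x" "frac y" "\<lfloor>x\<rfloor>" "\<lfloor>y\<rfloor>"])
    have "of_real x = (of_real (frac x) + of_int \<lfloor>x\<rfloor> :: complex)" "of_real y = (of_real (frac y) + of_int \<lfloor>y\<rfloor> :: complex)"
      by (simp_all add: frac_def)
    then show "z = of_real (frac x) + of_real (frac y) * \<tau> + of_int \<lfloor>x\<rfloor> + of_int \<lfloor>y\<rfloor> * \<tau>"
      unfolding z by (simp only: algebra_simps)
  qed (auto simp: frac_ge_0 less_imp_le[OF frac_lt_1])
qed

text \<open>
  The hypothesis at \<open>0\<close> makes the singularity removable, and by periodicity the same extension works at
  every lattice point. The extended function is entire and bounded by its values on a period cell,
  hence constant by Liouville's theorem; an odd constant is \<open>0\<close>.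
\<close>

lemma odd_elliptic_function_eq_0:
  assumes \<tau>: "\<tau> \<in> \<H>"
    and hol: "G holomorphic_on - lattice \<tau>"
    and per1: "\<And>z. G (z + 1) = G z" and per2: "\<And>z. G (z + \<tau>) = G z"
    and odd: "\<And>z. G (- z) = - G z"
    and lim: "((\<lambda>z. z * G z) \<longlongrightarrow> 0) (at 0)"
    and z: "z \<notin> lattice \<tau>"
  shows "G z = 0"
proof -
  \<comment> \<open>nonzero lattice points have at least this absolute value\<close>
  define e where "e = min 1 (Im \<tau>)"
  have e: "e > 0" using \<tau> by (simp add: e_def upper_half_plane_iff)
  have ball: "w \<notin> lattice \<tau>" if "w \<in> ball 0 e - {0}" for w
    using lattice_discrete[OF \<tau>, of w] that by (auto simp: e_def)
  have per: "G (z + (of_int m + of_int n * \<tau>)) = G z" for z m n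
    using int_translation[of G \<tau> 0 "z + of_int m" n] int_translation[of G 1 0 z m] per1 per2
    by (simp add: add.assoc)
  have "\<exists>g. g holomorphic_on ball 0 e \<and> (\<forall>z\<in>ball 0 e - {0}. g z = G z)"
  proof (subst holomorphic_on_extend_lim)
    show "G holomorphic_on ball 0 e - {0}" by (rule holomorphic_on_subset[OF hol]) (use ball in auto)
    show "((\<lambda>z. (z - 0) * G z) \<longlongrightarrow> 0) (at 0)" using lim by simp
  qed (use e in auto)
  then obtain g where g: "g holomorphic_on ball 0 e" "\<And>w. w \<in> ball 0 e - {0} \<Longrightarrow> g w = G w" by blast
  define F where "F w = (if w \<in> lattice \<tau> then g 0 else G w)" for w
  have F_per: "F (w + (of_int m + of_int n * \<tau>)) = F w" for w m n
  proof -
    have "w + (of_int m + of_int n * \<tau>) \<in> lattice \<tau> \<longleftrightarrow> w \<in> lattice \<tau>"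
    proof
      assume "w + (of_int m + of_int n * \<tau>) \<in> lattice \<tau>"
      from lattice_diff[OF this latticeI[of m n]] show "w \<in> lattice \<tau>" by simp
    next
      assume "w \<in> lattice \<tau>"
      from lattice_diff[OF this latticeI[of "- m" "- n"]]
      show "w + (of_int m + of_int n * \<tau>) \<in> lattice \<tau>" by (simp add: algebra_simps)
    qed
    then show ?thesis by (simp add: F_def per)
  qed
  have F_ball: "F w = g w" if "w \<in> ball 0 e" for w
  proof (cases "w = 0")
    case True
    have "(0 :: complex) = of_int 0 + of_int 0 * \<tau>" by simp
    then have "0 \<in> lattice \<tau>" using latticeI by metis
    then show ?thesis using True by (simp add: F_def)
  next
    case False
    then show ?thesis using ball[of w] g(2)[of w] that by (auto simp: F_def)
  qed
  have "F field_differentiable at w" for w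
  proof (cases "w \<in> lattice \<tau>")
    case True
    then obtain m n where w: "w = of_int m + of_int n * \<tau>" by (auto simp: lattice_def)
    have "g field_differentiable at 0"
      using g(1) e by (intro holomorphic_on_imp_differentiable_at[of g "ball 0 e"]) auto
    then obtain g' where "(g has_field_derivative g') (at (w - w))" by (auto simp: field_differentiable_def)
    then have "((\<lambda>u. g (u - w)) has_field_derivative g' * (1 - 0)) (at w)"
      by (rule DERIV_chain2) (intro DERIV_diff DERIV_ident DERIV_const)
    moreover have "g (u - w) = F u" if "u \<in> ball w e" for u
    proof -
      have "g (u - w) = F (u - w)" using that by (intro F_ball[symmetric]) (simp add: dist_norm norm_minus_commute)
      also have "\<dots> = F u" using F_per[of "u - w" m n] by (simp add: w)
      finally show ?thesis .
    qed
    ultimately have "(F has_field_derivative g' * (1 - 0)) (at w)"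
      using e by (auto intro: has_field_derivative_transform_within_open[of _ _ w "ball w e"])
    then show ?thesis by (auto simp: field_differentiable_def)
  next
    case False
    have op: "open (- lattice \<tau>)" using closed_subset_lattice[OF \<tau> order_refl] by (simp add: open_Compl)
    then have "G field_differentiable at w"
      using hol False by (intro holomorphic_on_imp_differentiable_at[of G "- lattice \<tau>"]) auto
    then obtain G' where "(G has_field_derivative G') (at w)" by (auto simp: field_differentiable_def)
    then have "(F has_field_derivative G') (at w)"
      by (rule has_field_derivative_transform_within_open[OF _ op]) (use False in \<open>auto simp: F_def\<close>)
    then show ?thesis by (auto simp: field_differentiable_def)
  qed
  then have F_hol: "F holomorphic_on UNIV" by (simp add: holomorphic_on_def)
  let ?cell = "(\<lambda>(s, t). of_real s + of_real t * \<tau>) ` ({0..1} \<times> {0..1})"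
  have "compact ?cell"
    unfolding case_prod_unfold
    by (rule compact_continuous_image) (auto intro!: continuous_intros compact_Times)
  moreover have "continuous_on ?cell F"
    using F_hol holomorphic_on_imp_continuous_on holomorphic_on_subset by blast
  ultimately have "bounded (F ` ?cell)" by (rule compact_imp_bounded[OF compact_continuous_image, rotated])
  moreover have "range F \<subseteq> F ` ?cell"
  proof
    fix v assume "v \<in> range F"
    then obtain w where v: "v = F w" by auto
    obtain m n s t where st: "0 \<le> s" "s \<le> 1" "0 \<le> t" "t \<le> 1"
      "w = (of_real s + of_real t * \<tau>) + of_int m + of_int n * \<tau>"
      using lattice_translate_cell[OF \<tau>] by metis
    have "v = F (of_real s + of_real t * \<tau>)"
      unfolding v st(5) using F_per[of "of_real s + of_real t * \<tau>" m n] by (simp add: add.assoc)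
    then show "v \<in> F ` ?cell" using st by force
  qed
  ultimately have "F constant_on UNIV" by (intro Liouville_theorem F_hol) (rule bounded_subset)
  then have "F (- z) = F z" by (auto simp: constant_on_def)
  moreover have "- z \<notin> lattice \<tau>" using z lattice_uminus_iff by simp
  ultimately have "- G z = G z" using z by (simp add: F_def odd)
  then show ?thesis by simp
qed

lemma moebius_upper_half_plane:
  assumes \<gamma>: "(a, b, c, d) \<in> SL2Z" and \<tau>: "\<tau> \<in> \<H>"
  shows "moebius a b c d \<tau> \<in> \<H>"
proof -
  let ?\<mu> = "of_int c * \<tau> + of_int d"
  have ne: "?\<mu> \<noteq> 0" using denominator_nonzero[OF \<gamma> \<tau>] .
  have det: "real_of_int a * of_int d - of_int b * of_int c = 1"
    using \<gamma> unfolding SL2Z_def by (simp flip: of_int_mult of_int_diff)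
  have "Im (of_int a * \<tau> + of_int b) * Re ?\<mu> - Re (of_int a * \<tau> + of_int b) * Im ?\<mu> =
      (real_of_int a * of_int d - of_int b * of_int c) * Im \<tau>"
    by (simp add: algebra_simps)
  then have "Im (moebius a b c d \<tau>) = Im \<tau> / (norm ?\<mu>)\<^sup>2"
    unfolding moebius_def Im_divide' det by simp
  with ne \<tau> show ?thesis by (simp add: upper_half_plane_iff)
qed

text \<open>
  This is the residue of \<open>eis 0\<close> for every \<open>\<tau>\<close>. Its independence of \<open>\<tau>\<close> makes the poles cancel in the comparison
  of \<open>\<tau>\<close> with its image under a unimodular matrix.
\<close>

lemma halfcot_residue: "((\<lambda>z. z * halfcot z) \<longlongrightarrow> - 1 / tpi) (at 0)"
proof -
  have "((\<lambda>z. (qexp z - qexp 0) / (z - 0)) \<longlongrightarrow> tpi * qexp 0) (at 0)"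
    using qexp_has_derivative[of 0] unfolding has_field_derivative_iff by simp
  then have lim: "((\<lambda>z. (qexp z - 1) / z) \<longlongrightarrow> tpi) (at 0)"
    by (simp add: qexp_def)
  have "isCont qexp 0" using qexp_has_derivative by (rule DERIV_isCont)
  then have cont: "(qexp \<longlongrightarrow> 1) (at 0)" by (simp add: isCont_def qexp_def)
  have "((\<lambda>z. - (1 + qexp z) / (2 * ((qexp z - 1) / z))) \<longlongrightarrow> - (1 + 1) / (2 * tpi)) (at 0)"
    by (intro tendsto_intros lim cont) simp
  moreover have "\<forall>\<^sub>F z in at 0. - (1 + qexp z) / (2 * ((qexp z - 1) / z)) = z * halfcot z"
    unfolding eventually_at
  proof (intro exI[of _ 1] conjI ballI impI)
    fix z :: complex assume "z \<noteq> 0 \<and> dist z 0 < 1"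
    define u where "u = qexp z - 1"
    have u: "1 - qexp z = - u" by (simp add: u_def)
    show "- (1 + qexp z) / (2 * ((qexp z - 1) / z)) = z * halfcot z"
      unfolding halfcot_def u u_def[symmetric] by (simp add: divide_simps algebra_simps)
  qed simp
  ultimately have "((\<lambda>z. z * halfcot z) \<longlongrightarrow> - (1 + 1) / (2 * tpi)) (at 0)"
    by (rule Lim_transform_eventually)
  then show ?thesis by (simp add: field_simps)
qed

lemma eis_0_residue:
  assumes "\<tau> \<in> \<H>"
  shows "((\<lambda>z. z * eis 0 z \<tau>) \<longlongrightarrow> - 1 / tpi) (at 0)"
proof -
  have "0 \<notin> off_axis_lattice \<tau>"
  proof
    assume "0 \<in> off_axis_lattice \<tau>"
    then obtain m n where "0 = of_int m + of_int n * \<tau>" and n: "n \<noteq> 0" by (auto simp: off_axis_lattice_def)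
    then have "Im (of_int m + of_int n * \<tau>) = 0" by (metis zero_complex.sel(2))
    then show False using n assms by (simp add: upper_half_plane_iff)
  qed
  then have "isCont (\<lambda>z. pairsum 0 z \<tau>) 0" using pairsum_has_derivative[OF assms] DERIV_isCont by blast
  then have "((\<lambda>z. z * halfcot z + z * pairsum 0 z \<tau>) \<longlongrightarrow> - 1 / tpi + 0 * pairsum 0 0 \<tau>) (at 0)"
    by (intro tendsto_intros halfcot_residue) (simp add: isCont_def)
  then show ?thesis by (simp add: eis_def dcot_0 distrib_left)
qed

text \<open>
  Scaling by \<open>1 / (c \<tau> + d)\<close> maps the period lattice of \<open>\<tau>\<close> onto that of \<open>(a \<tau> + b) / (c \<tau> + d)\<close>.
\<close>

lemma lattice_moebius:
  assumes \<gamma>: "(a, b, c, d) \<in> SL2Z" and \<tau>: "\<tau> \<in> \<H>"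
  defines "\<mu> \<equiv> of_int c * \<tau> + of_int d"
  shows "1 / \<mu> = of_int a + of_int (- c) * moebius a b c d \<tau>"
    and "\<tau> / \<mu> = of_int (- b) + of_int d * moebius a b c d \<tau>"
    and "z / \<mu> \<in> lattice (moebius a b c d \<tau>) \<Longrightarrow> z \<in> lattice \<tau>"
proof -
  have ne: "\<mu> \<noteq> 0" unfolding \<mu>_def using denominator_nonzero[OF \<gamma> \<tau>] .
  have det: "of_int a * of_int d - of_int b * of_int c = (1 :: complex)"
    using \<gamma> unfolding SL2Z_def by (simp flip: of_int_mult of_int_diff)
  have m: "moebius a b c d \<tau> = (of_int a * \<tau> + of_int b) / \<mu>" by (simp add: moebius_def \<mu>_def)
  have "of_int a * \<mu> - of_int c * (of_int a * \<tau> + of_int b) = 1"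
    unfolding \<mu>_def using det by (simp add: algebra_simps)
  then show "1 / \<mu> = of_int a + of_int (- c) * moebius a b c d \<tau>"
    unfolding m using ne by (simp add: field_simps)
  have "- of_int b * \<mu> + of_int d * (of_int a * \<tau> + of_int b) = (of_int a * of_int d - of_int b * of_int c) * \<tau>"
    unfolding \<mu>_def by (simp add: algebra_simps)
  then have "- of_int b * \<mu> + of_int d * (of_int a * \<tau> + of_int b) = \<tau>" using det by simp
  then show "\<tau> / \<mu> = of_int (- b) + of_int d * moebius a b c d \<tau>"
    unfolding m using ne by (simp add: field_simps)
  assume "z / \<mu> \<in> lattice (moebius a b c d \<tau>)"
  then obtain k l where "z / \<mu> = of_int k + of_int l * moebius a b c d \<tau>" by (auto simp: lattice_def)
  then have "z = of_int k * \<mu> + of_int l * (of_int a * \<tau> + of_int b)"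
    unfolding m using ne by (simp add: field_simps)
  also have "\<dots> = of_int (k * d + l * b) + of_int (k * c + l * a) * \<tau>"
    unfolding \<mu>_def by (simp add: algebra_simps)
  finally show "z \<in> lattice \<tau>" by (simp only: latticeI)
qed

text \<open>
  The two sides have the same poles. The term \<open>c z\<close> compensates their different quasi-periods, so their
  difference is an odd elliptic function without poles.
\<close>

theorem eis_0_moebius:
  assumes \<gamma>: "(a, b, c, d) \<in> SL2Z" and \<tau>: "\<tau> \<in> \<H>" and z: "z \<notin> lattice \<tau>"
  defines "\<mu> \<equiv> of_int c * \<tau> + of_int d"
  shows "eis 0 (z / \<mu>) (moebius a b c d \<tau>) = \<mu> * eis 0 z \<tau> - of_int c * z"
proof -
  let ?\<tau>' = "moebius a b c d \<tau>"
  note \<tau>' = moebius_upper_half_plane[OF \<gamma> \<tau>]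
  have ne: "\<mu> \<noteq> 0" unfolding \<mu>_def using denominator_nonzero[OF \<gamma> \<tau>] .
  note lat = lattice_moebius[OF \<gamma> \<tau>, folded \<mu>_def]
  define G where "G z = eis 0 (z / \<mu>) ?\<tau>' - \<mu> * eis 0 z \<tau> + of_int c * z" for z
  have shift: "eis 0 (w + (of_int m + of_int n * ?\<tau>')) ?\<tau>' = eis 0 w ?\<tau>' + of_int n" for w m n
    using eis_translate[OF \<tau>', of 0 w m n] by (simp add: add.assoc)
  have "G z = 0"
  proof (rule odd_elliptic_function_eq_0[OF \<tau> _ _ _ _ _ z])
    show "G (z + 1) = G z" for z
    proof -
      have "eis 0 ((z + 1) / \<mu>) ?\<tau>' = eis 0 (z / \<mu>) ?\<tau>' - of_int c"
        using shift[of "z / \<mu>" a "- c"] by (simp add: add_divide_distrib lat(1))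
      then show ?thesis unfolding G_def eis_plus_1 by (simp add: algebra_simps)
    qed
    show "G (z + \<tau>) = G z" for z
    proof -
      have "eis 0 ((z + \<tau>) / \<mu>) ?\<tau>' = eis 0 (z / \<mu>) ?\<tau>' + of_int d"
        using shift[of "z / \<mu>" "- b" d] by (simp add: add_divide_distrib lat(2))
      moreover have "\<mu> * 1 = of_int c * \<tau> + of_int d" by (simp add: \<mu>_def)
      ultimately show ?thesis unfolding G_def eis_plus_tau[OF \<tau>] by (simp add: algebra_simps)
    qed
    show "G (- z) = - G z" for z
      using eis_minus[OF \<tau>', of 0 "z / \<mu>"] eis_minus[OF \<tau>, of 0 z] by (simp add: G_def)
    show "G holomorphic_on - lattice \<tau>"
    proof (rule holomorphic_onI)
      fix w assume "w \<in> - lattice \<tau>"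
      then have w: "w \<notin> lattice \<tau>" "w / \<mu> \<notin> lattice ?\<tau>'" using lat(3) by auto
      have "((\<lambda>w. w / \<mu>) has_field_derivative 1 / \<mu>) (at w)" by (intro DERIV_cdivide DERIV_ident)
      then have "((\<lambda>z. eis 0 (z / \<mu>) ?\<tau>') has_field_derivative tpi * eis (Suc 0) (w / \<mu>) ?\<tau>' * (1 / \<mu>)) (at w)"
        by (rule DERIV_chain2[where g = "\<lambda>w. w / \<mu>" and f = "\<lambda>w. eis 0 w ?\<tau>'", OF eis_has_derivative[OF \<tau>' w(2)]])
      then have "(\<lambda>z. eis 0 (z / \<mu>) ?\<tau>') field_differentiable at w" by (auto simp: field_differentiable_def)
      moreover have "(\<lambda>z. eis 0 z \<tau>) field_differentiable at w"
        using eis_has_derivative[OF \<tau> w(1)] by (auto simp: field_differentiable_def)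
      ultimately have "(\<lambda>z. eis 0 (z / \<mu>) ?\<tau>' - \<mu> * eis 0 z \<tau> + of_int c * z) field_differentiable at w"
        by (intro derivative_intros)
      then show "G field_differentiable at w within - lattice \<tau>"
        unfolding G_def[abs_def] by (rule field_differentiable_at_within)
    qed
    \<comment> \<open>in \<open>z G(z)\<close> the residues contribute \<open>\<mu>\<close> times the same constant with opposite signs\<close>
    have "filterlim (\<lambda>z. z / \<mu>) (at 0) (at 0)"
      using ne by (intro filterlim_atI tendsto_eq_intros) (auto simp: eventually_at intro!: exI[of _ 1])
    from filterlim_compose[OF eis_0_residue[OF \<tau>'] this]
    have "((\<lambda>z. z / \<mu> * eis 0 (z / \<mu>) ?\<tau>') \<longlongrightarrow> - 1 / tpi) (at 0)" .
    then have "((\<lambda>z. \<mu> * (z / \<mu> * eis 0 (z / \<mu>) ?\<tau>') - \<mu> * (z * eis 0 z \<tau>) + of_int c * z * z)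
        \<longlongrightarrow> \<mu> * (- 1 / tpi) - \<mu> * (- 1 / tpi) + of_int c * 0 * 0) (at 0)"
      by (intro tendsto_intros eis_0_residue[OF \<tau>])
    then show "((\<lambda>z. z * G z) \<longlongrightarrow> 0) (at 0)"
      using ne by (simp add: G_def algebra_simps)
  qed
  then show ?thesis by (simp add: G_def algebra_simps)
qed

text \<open>
  Differentiating the formula for \<open>j = 0\<close> with respect to \<open>z\<close> raises the weight by one in each step. The
  correction term \<open>c z\<close> survives once, as a constant, which is the source of the depth one in weight two.
\<close>

theorem eis_moebius:
  assumes \<gamma>: "(a, b, c, d) \<in> SL2Z" and \<tau>: "\<tau> \<in> \<H>" and z: "z \<notin> lattice \<tau>"
  defines "\<mu> \<equiv> of_int c * \<tau> + of_int d"
  shows "eis j (z / \<mu>) (moebius a b c d \<tau>) =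
    \<mu> ^ Suc j * eis j z \<tau> - of_bool (j = 0) * of_int c * z - of_bool (j = 1) * of_int c * \<mu> / tpi"
  using z
proof (induction j arbitrary: z)
  case 0
  then show ?case using eis_0_moebius[OF \<gamma> \<tau>] by (simp add: \<mu>_def)
next
  case (Suc j)
  let ?\<tau>' = "moebius a b c d \<tau>"
  let ?R = "\<lambda>z. \<mu> ^ Suc j * eis j z \<tau> - of_bool (j = 0) * of_int c * z - of_bool (j = 1) * of_int c * \<mu> / tpi"
  note \<tau>' = moebius_upper_half_plane[OF \<gamma> \<tau>]
  have ne: "\<mu> \<noteq> 0" unfolding \<mu>_def using denominator_nonzero[OF \<gamma> \<tau>] .
  have z': "z / \<mu> \<notin> lattice ?\<tau>'" using lattice_moebius(3)[OF \<gamma> \<tau>] Suc.prems unfolding \<mu>_def by blast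
  have "((\<lambda>w. w / \<mu>) has_field_derivative 1 / \<mu>) (at z)" by (intro DERIV_cdivide DERIV_ident)
  then have 1: "((\<lambda>w. eis j (w / \<mu>) ?\<tau>') has_field_derivative tpi * eis (Suc j) (z / \<mu>) ?\<tau>' * (1 / \<mu>)) (at z)"
    by (rule DERIV_chain2[where g = "\<lambda>w. w / \<mu>" and f = "\<lambda>w. eis j w ?\<tau>'", OF eis_has_derivative[OF \<tau>' z']])
  have "(?R has_field_derivative \<mu> ^ Suc j * (tpi * eis (Suc j) z \<tau>) - of_bool (j = 0) * of_int c * 1 - 0) (at z)"
    by (intro DERIV_diff DERIV_cmult DERIV_const DERIV_ident eis_has_derivative \<tau> Suc.prems)
  moreover have "open (- lattice \<tau>)" using closed_subset_lattice[OF \<tau> order_refl] by (simp add: open_Compl)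
  ultimately have "((\<lambda>w. eis j (w / \<mu>) ?\<tau>') has_field_derivative
      \<mu> ^ Suc j * (tpi * eis (Suc j) z \<tau>) - of_bool (j = 0) * of_int c * 1 - 0) (at z)"
    by (rule has_field_derivative_transform_within_open) (use Suc in auto)
  with 1 have "tpi * eis (Suc j) (z / \<mu>) ?\<tau>' * (1 / \<mu>) =
      \<mu> ^ Suc j * (tpi * eis (Suc j) z \<tau>) - of_bool (j = 0) * of_int c * 1 - 0"
    by (rule DERIV_unique)
  then have "eis (Suc j) (z / \<mu>) ?\<tau>' = \<mu> * (\<mu> ^ Suc j * (tpi * eis (Suc j) z \<tau>) - of_bool (j = 0) * of_int c) / tpi"
    using ne by (simp add: field_simps)
  then show ?case by (simp add: field_simps)
qed

section \<open>Behaviour at the cusps\<close>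

lemma eventually_Im_ge: "\<forall>\<^sub>F \<tau> in filtercomap Im at_top. Im \<tau> \<ge> C"
  by (intro eventually_filtercomapI eventually_ge_at_top)

text \<open>
  On the line \<open>z = x + \<beta> \<tau>\<close> with \<open>0 \<le> \<beta> < 1\<close> the distances \<open>(n \<plusminus> \<beta>) Im \<tau>\<close> of the paired terms from
  the real axis stay away from \<open>0\<close>, so one convergent geometric series dominates the sum for all \<open>Im \<tau> \<ge> 1\<close>.
\<close>

lemma eis_bounded_at_top:
  fixes x \<beta> :: real
  assumes "0 \<le> \<beta>" "\<beta> < 1"
  shows "Bfun (\<lambda>\<tau>. eis j (of_real x + of_real \<beta> * \<tau>) \<tau>) (filtercomap Im at_top)"
proof -
  let ?z = "\<lambda>\<tau>. of_real x + of_real \<beta> * \<tau> :: complex"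
  obtain K where K: "K \<ge> 0"
    "\<And>n z \<tau>. of_nat n * Im \<tau> - \<bar>Im z\<bar> \<ge> 1 - \<beta> \<Longrightarrow>
       norm (pairterm j n z \<tau>) \<le> K * exp (- (2 * pi * (of_nat n * Im \<tau> - \<bar>Im z\<bar>)))"
    using pairterm_bound[of "1 - \<beta>" j] assms by auto
  define h where "h n = K * exp (- (2 * pi * (of_nat (Suc n) * 1 - \<beta>)))" for n
  have h: "summable h" unfolding h_def by (rule summable_exp_linear) simp
  have "norm (pairsum j (?z \<tau>) \<tau>) \<le> suminf h" if "Im \<tau> \<ge> 1" for \<tau>
  proof -
    have \<tau>: "\<tau> \<in> \<H>" using that by (simp add: upper_half_plane_iff)
    have "norm (pairterm j (Suc n) (?z \<tau>) \<tau>) \<le> h n" for n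
    proof -
      have "(of_nat (Suc n) - \<beta>) * 1 \<le> (of_nat (Suc n) - \<beta>) * Im \<tau>"
        using assms that by (intro mult_left_mono) auto
      also have "\<dots> = of_nat (Suc n) * Im \<tau> - \<bar>Im (?z \<tau>)\<bar>"
        using assms that by (simp add: algebra_simps)
      finally have 1: "of_nat (Suc n) * 1 - \<beta> \<le> of_nat (Suc n) * Im \<tau> - \<bar>Im (?z \<tau>)\<bar>" by simp
      then have "1 - \<beta> \<le> of_nat (Suc n) * Im \<tau> - \<bar>Im (?z \<tau>)\<bar>" by simp
      then have "norm (pairterm j (Suc n) (?z \<tau>) \<tau>) \<le> K * exp (- (2 * pi * (of_nat (Suc n) * Im \<tau> - \<bar>Im (?z \<tau>)\<bar>)))"
        by (rule K)
      also have "\<dots> \<le> h n" unfolding h_def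
        using 1 K(1) by (intro mult_left_mono) (simp_all only: exp_le_cancel_iff neg_le_iff_le mult_le_cancel_left_pos pi_gt_zero zero_less_mult_iff zero_less_numeral simp_thms)
      finally show ?thesis .
    qed
    then have "suminf (\<lambda>n. norm (pairterm j (Suc n) (?z \<tau>) \<tau>)) \<le> suminf h"
      by (intro suminf_le summable_pairterm \<tau> h)
    then show ?thesis
      unfolding pairsum_def using summable_norm[OF summable_pairterm[OF \<tau>, of j "?z \<tau>"]] by linarith
  qed
  then have "Bfun (\<lambda>\<tau>. pairsum j (?z \<tau>) \<tau>) (filtercomap Im at_top)"
    by (intro BfunI[of _ "suminf h"] eventually_mono[OF eventually_Im_ge[of 1]])
  moreover have "Bfun (\<lambda>\<tau>. dcot j (?z \<tau>)) (filtercomap Im at_top)"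
  proof (cases "\<beta> = 0")
    case False
    then have \<beta>: "\<beta> > 0" using assms by simp
    then obtain L where L: "L \<ge> 0"
      "\<And>w. Im w \<ge> \<beta> \<Longrightarrow> norm (dcot j w - of_bool (j = 0) / 2) \<le> L * exp (- (2 * pi * Im w))"
      using dcot_bound by blast
    have "norm (dcot j (?z \<tau>)) \<le> L + 1" if "Im \<tau> \<ge> 1" for \<tau>
    proof -
      have ge: "Im (?z \<tau>) \<ge> \<beta>" using \<beta> that by simp
      then have "norm (dcot j (?z \<tau>) - of_bool (j = 0) / 2) \<le> L * exp (- (2 * pi * Im (?z \<tau>)))" by (rule L)
      also have "\<dots> \<le> L * 1" using L(1) ge \<beta> by (intro mult_left_mono) auto
      finally have "norm (dcot j (?z \<tau>) - of_bool (j = 0) / 2) \<le> L" by simp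
      moreover have "norm (of_bool (j = 0) / 2 :: complex) \<le> 1" by (simp add: norm_divide)
      ultimately show ?thesis
        using norm_triangle_ineq[of "dcot j (?z \<tau>) - of_bool (j = 0) / 2" "of_bool (j = 0) / 2"] by simp
    qed
    then show ?thesis by (intro BfunI[of _ "L + 1"] eventually_mono[OF eventually_Im_ge[of 1]])
  qed simp
  ultimately show ?thesis unfolding eis_def by (rule Bfun_add_complex[rotated])
qed

section \<open>Characters of the levels 2, 3, 4 and 6\<close>

text \<open>
  The character modulo \<open>3\<close>, \<open>4\<close> or \<open>6\<close> that sends \<open>1\<close> to \<open>1\<close> and \<open>-1\<close> to \<open>-1\<close>.
\<close>

definition odd_character :: "nat \<Rightarrow> int \<Rightarrow> complex" where
  "odd_character N m = (if m mod int N = 1 then 1 else if m mod int N = int N - 1 then -1 else 0)"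

definition weight_character :: "nat \<Rightarrow> nat \<Rightarrow> int \<Rightarrow> complex" where
  "weight_character N j = (if odd j then principal_character N else odd_character N)"

text \<open>
  The levels \<open>3\<close>, \<open>4\<close>, \<open>6\<close> (and \<open>2\<close>) are those for which \<open>\<plusminus> 1\<close> are the only units, so that a matrix in
  \<^const>\<open>Gamma0\<close> maps the point \<open>1/N\<close> to \<open>\<plusminus> 1/N\<close> modulo the lattice.
\<close>

lemma small_level_residues:
  assumes "N \<in> {3, 4, 6}"
  shows "coprime m (int N) \<longleftrightarrow> m mod int N = 1 \<or> m mod int N = int N - 1"
proof -
  define r where "r = m mod int N"
  have cop: "coprime m (int N) \<longleftrightarrow> coprime r (int N)"
    using assms unfolding r_def by (subst coprime_mod_left_iff) auto
  have r: "0 \<le> r" "r < int N" using assms by (auto simp: r_def)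
  have num: "\<not> coprime 2 (4::int)" "\<not> coprime 2 (6::int)" "\<not> coprime 3 (6::int)" "\<not> coprime 4 (6::int)"
     "coprime 2 (3::int)" "coprime 3 (4::int)" "coprime 5 (6::int)"
    using coprime_diff_one_left[of "3::int"] coprime_diff_one_left[of "4::int"] coprime_diff_one_left[of "6::int"]
      not_coprimeI[of 2 2 "4::int"] not_coprimeI[of 2 2 "6::int"] not_coprimeI[of 3 3 "6::int"] not_coprimeI[of 2 4 "6::int"]
    by simp_all
  consider "N = 3" | "N = 4" | "N = 6" using assms by blast
  then have "coprime r (int N) \<longleftrightarrow> r = 1 \<or> r = int N - 1"
  proof cases
    case 1
    with r have "r = 0 \<or> r = 1 \<or> r = 2" by simp presburger
    with 1 num show ?thesis by (elim disjE) simp_all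
  next
    case 2
    with r have "r = 0 \<or> r = 1 \<or> r = 2 \<or> r = 3" by simp presburger
    with 2 num show ?thesis by (elim disjE) simp_all
  next
    case 3
    with r have "r = 0 \<or> r = 1 \<or> r = 2 \<or> r = 3 \<or> r = 4 \<or> r = 5" by simp presburger
    with 3 num show ?thesis by (elim disjE) simp_all
  qed
  then show ?thesis unfolding cop r_def .
qed

lemma odd_character:
  assumes "N \<in> {3, 4, 6}"
  shows "dirichlet_character N (odd_character N)"
  unfolding dirichlet_character_def
proof (intro conjI allI)
  fix m n :: int
  show "odd_character N (m + int N) = odd_character N m" by (simp add: odd_character_def)
  show "odd_character N m \<noteq> 0 \<longleftrightarrow> coprime m (int N)"
    using small_level_residues[OF assms, of m] by (simp add: odd_character_def)
  show "odd_character N (m * n) = odd_character N m * odd_character N n"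
  proof (cases "coprime m (int N) \<and> coprime n (int N)")
    case True
    have eq: "(m * n) mod int N = ((m mod int N) * (n mod int N)) mod int N" by (simp add: mod_mult_eq)
    define u v where "u = m mod int N" and "v = n mod int N"
    have "u = 1 \<or> u = int N - 1" "v = 1 \<or> v = int N - 1"
      using True small_level_residues[OF assms, of m] small_level_residues[OF assms, of n]
      by (simp_all only: u_def v_def simp_thms)
    moreover have "N = 3 \<or> N = 4 \<or> N = 6" using assms by simp
    ultimately have "(if (u * v) mod int N = 1 then 1 else if (u * v) mod int N = int N - 1 then -1 else 0 :: complex) =
        (if u = 1 then 1 else if u = int N - 1 then -1 else 0) * (if v = 1 then 1 else if v = int N - 1 then -1 else 0)"
      by (elim disjE) simp_all
    then show ?thesis unfolding odd_character_def eq u_def v_def .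
  next
    case False
    have zero: "odd_character N x = 0" if "\<not> coprime x (int N)" for x
      using that small_level_residues[OF assms, of x] by (simp add: odd_character_def)
    have "\<not> coprime (m * n) (int N)" using False by (simp add: coprime_mult_left_iff)
    moreover have "\<not> coprime m (int N) \<or> \<not> coprime n (int N)" using False by blast
    ultimately show ?thesis using zero[of "m * n"] zero[of m] zero[of n] by (elim disjE) simp_all
  qed
qed

lemma weight_character:
  assumes "N \<in> {3, 4, 6} \<or> odd j"
  shows "dirichlet_character N (weight_character N j)"
  using assms odd_character principal_character by (auto simp: weight_character_def)

lemma coprime_cases:
  assumes "N \<in> {2, 3, 4, 6}" "coprime d (int N)"
  obtains s k :: int where "d = s + k * int N" "s = 1 \<or> s = -1"
    "N \<in> {3, 4, 6} \<or> odd j \<Longrightarrow> weight_character N j d = of_int s ^ Suc j"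
proof -
  have "d mod int N = 1 \<or> d mod int N = int N - 1"
  proof (cases "N = 2")
    case True
    then show ?thesis using assms(2) by (auto simp: coprime_right_2_iff_odd odd_iff_mod_2_eq_one)
  qed (use assms small_level_residues[of N d] in auto)
  then consider "d mod int N = 1" | "d mod int N = int N - 1" "d mod int N \<noteq> 1" by blast
  then show ?thesis
  proof cases
    case 1
    have d: "d = 1 + (d div int N) * int N" using mod_div_mult_eq[of d "int N"] 1 by simp
    have "weight_character N j d = of_int 1 ^ Suc j"
      using 1 assms(2) by (simp add: weight_character_def odd_character_def principal_character_def)
    then show ?thesis by (intro that[OF d]) simp_all
  next
    case 2
    have d: "d = -1 + (d div int N + 1) * int N" using mod_div_mult_eq[of d "int N"] 2 by (simp add: algebra_simps)
    have "weight_character N j d = of_int (-1) ^ Suc j"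
      using 2 assms(2) by (simp add: weight_character_def odd_character_def principal_character_def)
    then show ?thesis by (intro that[OF d]) simp_all
  qed
qed

section \<open>Modularity at torsion points\<close>

lemma torsion_point_not_in_lattice:
  assumes \<gamma>: "(a, b, c, d) \<in> SL2Z" and \<tau>: "\<tau> \<in> \<H>" and N: "N \<ge> 2"
  shows "1 / of_nat N * (of_int c * \<tau> + of_int d) \<notin> lattice \<tau>"
proof
  assume "1 / of_nat N * (of_int c * \<tau> + of_int d) \<in> lattice \<tau>"
  then obtain m n where "1 / of_nat N * (of_int c * \<tau> + of_int d) = of_int m + of_int n * \<tau>" by (auto simp: lattice_def)
  then have eq: "of_int c * \<tau> + of_int d = of_nat N * (of_int m + of_int n * \<tau>)"
    using N by (simp add: field_simps)
  from arg_cong[OF eq, of Im] have "real_of_int c * Im \<tau> = (real N * of_int n) * Im \<tau>" by simp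
  then have "real_of_int c = real N * of_int n" using \<tau> by (simp add: upper_half_plane_iff)
  then have c: "c = int N * n" by (metis of_int_eq_iff of_int_mult of_int_of_nat_eq)
  from arg_cong[OF eq, of Re] have "real_of_int d = real N * of_int m" using \<open>real_of_int c = _\<close> by (simp add: algebra_simps)
  then have d: "d = int N * m" by (metis of_int_eq_iff of_int_mult of_int_of_nat_eq)
  have "int N * (a * m - b * n) = 1" using \<gamma> unfolding SL2Z_def c d by (simp add: algebra_simps)
  then have "int N dvd 1" by (metis dvd_triv_left)
  then show False using N by simp
qed

text \<open>
  Take \<open>z = (c \<tau> + d) / N\<close> in the transformation formula. As \<open>N\<close> divides \<open>c\<close>, this is \<open>d / N\<close> plus a multiple of
  \<open>\<tau>\<close>, and for \<open>j = 0\<close> the quasi-period of that multiple cancels the correction \<open>c z\<close>. As \<open>d \<equiv> \<plusminus> 1\<close>, parity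
  turns \<open>d / N\<close> into \<open>1 / N\<close> at the cost of a sign, the value of the character.
\<close>

lemma eis_torsion_Gamma0:
  assumes \<gamma>: "(a, b, c, d) \<in> Gamma0 N" and \<tau>: "\<tau> \<in> \<H>" and N: "N \<in> {2, 3, 4, 6}" and j: "N \<in> {3, 4, 6} \<or> odd j"
  defines "\<mu> \<equiv> of_int c * \<tau> + of_int d"
  shows "eis j (1 / of_nat N) (moebius a b c d \<tau>) =
    weight_character N j d * \<mu> ^ Suc j * eis j (1 / of_nat N) \<tau> - of_bool (j = 1) * of_int c * \<mu> / tpi"
proof -
  note \<gamma>' = Gamma0_imp_SL2Z[OF \<gamma>]
  have N2: "N \<ge> 2" using N by auto
  have ne: "\<mu> \<noteq> 0" unfolding \<mu>_def using denominator_nonzero[OF \<gamma>' \<tau>] .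
  obtain c' where c': "c = int N * c'" using \<gamma> by (auto simp: Gamma0_def)
  obtain s k where s: "d = s + k * int N" "s = 1 \<or> s = -1" "weight_character N j d = of_int s ^ Suc j"
    using coprime_cases[OF N Gamma0_coprime[OF \<gamma>], of j] j by metis
  let ?z = "1 / of_nat N * \<mu>"
  have z: "?z = of_int s / of_nat N + of_int k + of_int c' * \<tau>"
    using N2 unfolding \<mu>_def c' s(1) by (simp add: field_simps)
  have "eis j (of_int s / of_nat N) \<tau> = of_int s ^ Suc j * eis j (1 / of_nat N) \<tau>"
    using s(2) eis_minus[OF \<tau>, of j "1 / of_nat N"] by auto
  then have ez: "eis j ?z \<tau> = of_int s ^ Suc j * eis j (1 / of_nat N) \<tau> + of_int c' * of_bool (j = 0)"
    unfolding z eis_translate[OF \<tau>] by simp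
  have "?z / \<mu> = 1 / of_nat N" using ne by simp
  then have "eis j (1 / of_nat N) (moebius a b c d \<tau>) =
      \<mu> ^ Suc j * eis j ?z \<tau> - of_bool (j = 0) * of_int c * ?z - of_bool (j = 1) * of_int c * \<mu> / tpi"
    using eis_moebius[OF \<gamma>' \<tau>, of ?z j] torsion_point_not_in_lattice[OF \<gamma>' \<tau> N2] unfolding \<mu>_def by metis
  moreover have "of_bool (j = 0) * of_int c * ?z = \<mu> ^ Suc j * (of_int c' * of_bool (j = 0))"
    using N2 by (cases j) (simp_all add: c')
  ultimately show ?thesis unfolding ez s(3) by (simp add: algebra_simps)
qed

lemma Bfun_quotient:
  assumes \<gamma>: "(a, b, c, d) \<in> SL2Z"
  shows "Bfun (\<lambda>\<tau>. of_int c / (of_int c * \<tau> + of_int d)) (filtercomap Im at_top)"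
proof (rule BfunI, rule eventually_mono[OF eventually_Im_ge[of 1]])
  fix \<tau> :: complex assume \<tau>: "Im \<tau> \<ge> 1"
  show "norm (of_int c / (of_int c * \<tau> + of_int d)) \<le> 1"
  proof -
    have "\<bar>real_of_int c\<bar> * 1 \<le> \<bar>real_of_int c\<bar> * Im \<tau>" using \<tau> by (intro mult_left_mono) auto
    also have "\<dots> = \<bar>Im (of_int c * \<tau> + of_int d)\<bar>" using \<tau> by (simp add: abs_mult)
    also have "\<dots> \<le> norm (of_int c * \<tau> + of_int d)" by (rule abs_Im_le_cmod)
    finally show ?thesis by (simp add: norm_divide divide_le_eq_1)
  qed
qed

text \<open>
  At an arbitrary cusp \<open>c / N\<close> need not be an integer. Subtracting its integral part by quasi-periodicity
  reduces the claim to boundedness on the lines \<open>z = x + \<beta> \<tau>\<close>.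
\<close>

lemma eis_torsion_bounded:
  assumes \<gamma>: "(a, b, c, d) \<in> SL2Z" and N: "N \<ge> 2"
  shows "Bfun (\<lambda>\<tau>. (of_int c * \<tau> + of_int d) powi (- int (Suc j)) * eis j (1 / of_nat N) (moebius a b c d \<tau>))
    (filtercomap Im at_top)"
proof -
  define \<beta> where "\<beta> = frac (real_of_int c / of_nat N)"
  define n where "n = \<lfloor>real_of_int c / of_nat N\<rfloor>"
  let ?x = "real_of_int d / of_nat N"
  let ?R = "\<lambda>\<tau>. eis j (of_real ?x + of_real \<beta> * \<tau>) \<tau> +
      ((of_int n * of_bool (j = 0) - of_bool (j = 0) * of_int c / of_nat N) +
       (- of_bool (j = 1) / tpi) * (of_int c / (of_int c * \<tau> + of_int d)))"
  have \<beta>: "0 \<le> \<beta>" "\<beta> < 1" by (auto simp: \<beta>_def frac_ge_0 frac_lt_1)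
  have "Bfun ?R (filtercomap Im at_top)"
    by (intro Bfun_add_complex Bfun_mult_complex eis_bounded_at_top \<beta> Bfun_const Bfun_quotient[OF \<gamma>])
  then show ?thesis
  proof (rule Bfun_cong_ev)
    show "\<forall>\<^sub>F \<tau> in filtercomap Im at_top. ?R \<tau> =
        (of_int c * \<tau> + of_int d) powi (- int (Suc j)) * eis j (1 / of_nat N) (moebius a b c d \<tau>)"
      using eventually_upper_half_plane
    proof eventually_elim
      fix \<tau> assume \<tau>: "\<tau> \<in> \<H>"
      let ?\<mu> = "of_int c * \<tau> + of_int d"
      let ?z = "1 / of_nat N * ?\<mu>"
      have ne: "?\<mu> \<noteq> 0" using denominator_nonzero[OF \<gamma> \<tau>] .
      have "of_real (real_of_int c / of_nat N) = (of_real \<beta> + of_int n :: complex)"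
        by (simp add: \<beta>_def n_def frac_def)
      then have cN: "of_int c / of_nat N = (of_real \<beta> + of_int n :: complex)" by simp
      have "?z = of_int c / of_nat N * \<tau> + of_int d / of_nat N" by (simp add: add_divide_distrib)
      also have "\<dots> = (of_real ?x + of_real \<beta> * \<tau>) + of_int 0 + of_int n * \<tau>"
        unfolding cN by (simp add: algebra_simps)
      finally have z: "eis j ?z \<tau> = eis j (of_real ?x + of_real \<beta> * \<tau>) \<tau> + of_int n * of_bool (j = 0)"
        by (simp only: eis_translate[OF \<tau>])
      have zm: "?z / ?\<mu> = 1 / of_nat N" using ne by simp
      have m: "eis j (1 / of_nat N) (moebius a b c d \<tau>) =
          ?\<mu> ^ Suc j * eis j ?z \<tau> - of_bool (j = 0) * of_int c * ?z - of_bool (j = 1) * of_int c * ?\<mu> / tpi"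
        using eis_moebius[OF \<gamma> \<tau> torsion_point_not_in_lattice[OF \<gamma> \<tau> N], of j] unfolding zm .
      have p: "?\<mu> powi (- int (Suc j)) = 1 / ?\<mu> ^ Suc j"
        using power_int_of_nat[of ?\<mu> "Suc j"] by (simp only: power_int_minus inverse_eq_divide)
      have "?\<mu> powi (- int (Suc j)) * eis j (1 / of_nat N) (moebius a b c d \<tau>) =
          eis j ?z \<tau> - (of_bool (j = 0) * of_int c * ?z + of_bool (j = 1) * of_int c * ?\<mu> / tpi) / ?\<mu> ^ Suc j"
        unfolding m p using ne by (simp add: diff_divide_distrib add_divide_distrib del: power_Suc)
      also have "(of_bool (j = 0) * of_int c * ?z + of_bool (j = 1) * of_int c * ?\<mu> / tpi) / ?\<mu> ^ Suc j =
          of_bool (j = 0) * of_int c / of_nat N + of_bool (j = 1) / tpi * (of_int c / ?\<mu>)"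
        using ne by (cases "j = 0"; cases "j = 1") (simp_all add: power2_eq_square)
      finally show "?R \<tau> = ?\<mu> powi (- int (Suc j)) * eis j (1 / of_nat N) (moebius a b c d \<tau>)"
        unfolding z by simp
    qed
  qed
qed

text \<open>
  The point \<open>1/2\<close> is its own negative modulo the integers, so odd functions vanish there. This matches the
  absence of an odd character modulo \<open>2\<close>.
\<close>

lemma eis_half_even_eq_0:
  assumes "\<tau> \<in> \<H>" "even j"
  shows "eis j (1 / 2) \<tau> = 0"
proof -
  have "eis j (1 / 2) \<tau> = eis j (- (1 / 2)) \<tau>" using eis_plus_1[of j "- (1 / 2)" \<tau>] by simp
  also have "\<dots> = - eis j (1 / 2) \<tau>" using eis_minus[OF assms(1), of j "1 / 2"] assms(2) by simp
  finally show ?thesis by simp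
qed

theorem eis_torsion_modular:
  assumes N: "N \<in> {2, 3, 4, 6}" and j: "j \<noteq> 1"
  shows "modular N (int (Suc j)) (\<lambda>\<tau>. eis j (1 / of_nat N) \<tau>)"
proof (cases "\<forall>\<tau>\<in>\<H>. eis j (1 / of_nat N) \<tau> = 0")
  case False
  have j': "N \<in> {3, 4, 6} \<or> odd j" using False N eis_half_even_eq_0[of _ j] by auto
  let ?f = "\<lambda>\<tau>. eis j (1 / of_nat N) \<tau>"
  have hol: "?f holomorphic_on \<H>" by (rule eis_holomorphic_in_tau) simp
  have "quasi_components N (weight_character N j) (int (Suc j)) 0 ?f (\<lambda>_. ?f)"
    unfolding quasi_components_def
  proof (intro conjI allI impI ballI)
    fix a b c d r
    show "\<exists>\<tau>\<in>\<H>. ?f \<tau> \<noteq> 0" using False by blast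
    show "?f (moebius a b c d \<tau>) = weight_character N j d * (of_int c * \<tau> + of_int d) powi int (Suc j) *
        (\<Sum>j\<le>0. ?f \<tau> * (of_int c / (of_int c * \<tau> + of_int d)) ^ j)"
      if "(a, b, c, d) \<in> Gamma0 N" "\<tau> \<in> \<H>" for \<tau>
      using eis_torsion_Gamma0[OF that N j'] j by (simp only: power_int_of_nat) simp
    show "Bfun (\<lambda>\<tau>. (of_int c * \<tau> + of_int d) powi - (int (Suc j) - 2 * int r) * ?f (moebius a b c d \<tau>)) (filtercomap Im at_top)"
      if "r \<le> 0" "(a, b, c, d) \<in> SL2Z"
      using eis_torsion_bounded[OF that(2), of N j] N that(1) by (auto simp del: of_nat_Suc)
  qed (rule hol)
  with hol have "quasimodular_form N (weight_character N j) (int (Suc j)) 0 ?f"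
    unfolding quasimodular_form_iff by (intro conjI exI[of _ "\<lambda>_. ?f"])
  then show ?thesis unfolding modular_def using weight_character[OF j'] by (intro disjI2 exI conjI)
qed (simp add: modular_def)

theorem eis_torsion_quasimodular_2:
  assumes N: "N \<in> {2, 3, 4, 6}"
  shows "quasimodular N 2 (\<lambda>\<tau>. eis 1 (1 / of_nat N) \<tau>)"
proof -
  let ?f = "\<lambda>\<tau>. eis 1 (1 / of_nat N) \<tau>"
  \<comment> \<open>the constant is the correction term of weight \<open>2\<close>\<close>
  let ?G = "\<lambda>i :: nat. if i = 0 then ?f else (\<lambda>_. - 1 / tpi)"
  have hol: "?f holomorphic_on \<H>" by (rule eis_holomorphic_in_tau) simp
  have "quasi_components N (weight_character N 1) 2 1 ?f ?G"
    unfolding quasi_components_def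
  proof (intro conjI allI impI ballI)
    fix a b c d r
    have "\<i> \<in> \<H>" by (simp add: upper_half_plane_iff)
    then show "\<exists>\<tau>\<in>\<H>. ?G 1 \<tau> \<noteq> 0" by (intro bexI[of _ \<i>]) simp_all
    show "?G i holomorphic_on \<H>" for i by (cases i) (simp_all add: hol del: One_nat_def)
    show "?f (moebius a b c d \<tau>) = weight_character N 1 d * (of_int c * \<tau> + of_int d) powi 2 *
        (\<Sum>i\<le>1. ?G i \<tau> * (of_int c / (of_int c * \<tau> + of_int d)) ^ i)"
      if \<gamma>: "(a, b, c, d) \<in> Gamma0 N" and \<tau>: "\<tau> \<in> \<H>" for \<tau>
    proof -
      have ne: "of_int c * \<tau> + of_int d \<noteq> 0" using denominator_nonzero[OF Gamma0_imp_SL2Z[OF \<gamma>] \<tau>] .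
      have "weight_character N 1 d = 1"
        using Gamma0_coprime[OF \<gamma>] by (simp add: weight_character_def principal_character_def)
      then have e: "?f (moebius a b c d \<tau>) = (of_int c * \<tau> + of_int d) ^ 2 * ?f \<tau> - of_int c * (of_int c * \<tau> + of_int d) / tpi"
        using eis_torsion_Gamma0[OF \<gamma> \<tau> N, of 1] by (simp only: numeral_2_eq_2 One_nat_def) simp
      have "\<mu> ^ 2 * x - u * \<mu> / T = \<mu> powi 2 * (x + - 1 / T * (u / \<mu>))"
        if "\<mu> \<noteq> 0" "T \<noteq> 0" for \<mu> x u T :: complex
        using that by (simp add: field_simps power2_eq_square)
      from e[unfolded this[OF ne tpi_nonzero]] show ?thesis using \<open>weight_character N 1 d = 1\<close> by simp
    qed
    show "Bfun (\<lambda>\<tau>. (of_int c * \<tau> + of_int d) powi - (2 - 2 * int r) * ?G r (moebius a b c d \<tau>)) (filtercomap Im at_top)"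
      if "r \<le> 1" "(a, b, c, d) \<in> SL2Z"
    proof (cases "r = 0")
      case True
      then show ?thesis using eis_torsion_bounded[OF that(2), of N 1] N by auto
    next
      case False
      then have "r = 1" using that by simp
      then show ?thesis by simp
    qed
  qed
  with hol have "quasimodular_form N (weight_character N 1) 2 1 ?f"
    unfolding quasimodular_form_iff by (intro conjI exI[of _ ?G])
  then show ?thesis unfolding quasimodular_def using weight_character[of N 1] by (intro disjI2 exI conjI) simp_all
qed

section \<open>The summand and its differential equation\<close>

lemma qexp_power: "qexp \<tau> ^ n = qexp (of_nat n * \<tau>)"
  unfolding qexp_def exp_of_nat_mult[symmetric] by (simp add: mult_ac)

text \<open>
  The function \<open>1 / (x + 1/x + a)\<close> of \<open>x = qexp w\<close>; the terms of the series are its values at \<open>w = n \<tau>\<close>.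
\<close>

definition kern :: "complex \<Rightarrow> complex \<Rightarrow> complex" where
  "kern a w = qexp w / (1 + a * qexp w + qexp w ^ 2)"

lemma summand_qexp: "summand a (qexp \<tau>) n = kern a (of_nat n * \<tau>)"
  unfolding summand_def kern_def qexp_power[symmetric] by (simp only: power_mult[symmetric] mult.commute)

text \<open>
  The derivative of \<^const>\<open>kern\<close> with respect to \<open>2 \<pi> \<i> w\<close>.
\<close>

definition kern' :: "complex \<Rightarrow> complex \<Rightarrow> complex" where
  "kern' a w = qexp w * (1 - qexp w ^ 2) / (1 + a * qexp w + qexp w ^ 2) ^ 2"

lemma qexp_sq_has_derivative: "((\<lambda>w. qexp w ^ 2) has_field_derivative tpi * (2 * qexp w ^ 2)) (at w)"
proof -
  have "((\<lambda>w. qexp w * qexp w) has_field_derivative tpi * qexp w * qexp w + tpi * qexp w * qexp w) (at w)"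
    by (intro DERIV_mult qexp_has_derivative)
  moreover have "tpi * qexp w * qexp w + tpi * qexp w * qexp w = tpi * (2 * qexp w ^ 2)"
    by (simp add: power2_eq_square)
  ultimately show ?thesis by (simp only: power2_eq_square)
qed

lemma denominator_has_derivative:
  "((\<lambda>w. 1 + a * qexp w + qexp w ^ 2) has_field_derivative tpi * (a * qexp w + 2 * qexp w ^ 2)) (at w)"
proof -
  have "((\<lambda>w. 1 + a * qexp w + qexp w ^ 2) has_field_derivative 0 + a * (tpi * qexp w) + tpi * (2 * qexp w ^ 2)) (at w)"
    by (intro DERIV_add DERIV_const DERIV_cmult qexp_has_derivative qexp_sq_has_derivative)
  moreover have "0 + a * (tpi * qexp w) + tpi * (2 * qexp w ^ 2) = tpi * (a * qexp w + 2 * qexp w ^ 2)"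
    by (simp add: algebra_simps)
  ultimately show ?thesis by (simp only:)
qed

lemma kern_has_derivative:
  assumes "1 + a * qexp w + qexp w ^ 2 \<noteq> 0"
  shows "(kern a has_field_derivative tpi * kern' a w) (at w)"
proof -
  let ?D = "1 + a * qexp w + qexp w ^ 2"
  have "((\<lambda>w. qexp w / (1 + a * qexp w + qexp w ^ 2)) has_field_derivative
      (tpi * qexp w * ?D - qexp w * (tpi * (a * qexp w + 2 * qexp w ^ 2))) / (?D * ?D)) (at w)"
    by (intro DERIV_divide denominator_has_derivative qexp_has_derivative assms)
  moreover have "tpi * qexp w * ?D - qexp w * (tpi * (a * qexp w + 2 * qexp w ^ 2)) = tpi * (qexp w * (1 - qexp w ^ 2))"
    by (simp add: algebra_simps power2_eq_square)
  ultimately show ?thesis unfolding kern_def[abs_def] kern'_def by (simp only: power2_eq_square times_divide_eq_right)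
qed

text \<open>
  A first order equation \<open>h'\<^sup>2 = P(h)\<close> with a quartic polynomial \<open>P\<close>, cubic for \<open>a\<^sup>2 = 4\<close>; the second derivative of \<open>h\<close> is then \<open>P'(h) / 2\<close>.
\<close>

lemma kern'_sq:
  assumes "1 + a * qexp w + qexp w ^ 2 \<noteq> 0"
  shows "kern' a w ^ 2 = kern a w ^ 2 - 2 * a * kern a w ^ 3 + (a ^ 2 - 4) * kern a w ^ 4"
proof -
  define E D where "E = qexp w" and "D = 1 + a * E + E ^ 2"
  have D: "D \<noteq> 0" using assms by (simp add: D_def E_def)
  \<comment> \<open>the derivative of \<open>x + 1/x\<close> is \<open>x - 1/x\<close>, and its square is \<open>(x + 1/x)\<^sup>2 - 4\<close>\<close>
  have "(1 - E ^ 2) ^ 2 = (D - a * E) ^ 2 - 4 * E ^ 2" unfolding D_def by (simp add: algebra_simps power2_eq_square)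
  also have "\<dots> = D ^ 2 - 2 * a * E * D + (a ^ 2 - 4) * E ^ 2" by (simp add: algebra_simps power2_eq_square)
  finally have eq: "(1 - E ^ 2) ^ 2 = D ^ 2 - 2 * a * E * D + (a ^ 2 - 4) * E ^ 2" .
  have "(E * (1 - E ^ 2) / D ^ 2) ^ 2 = E ^ 2 * (1 - E ^ 2) ^ 2 / D ^ 4"
    by (simp add: power_divide power_mult_distrib flip: power_mult)
  also have "\<dots> = (E / D) ^ 2 - 2 * a * (E / D) ^ 3 + (a ^ 2 - 4) * (E / D) ^ 4"
    unfolding eq using D by (simp add: field_simps eval_nat_numeral)
  finally show ?thesis unfolding kern_def kern'_def E_def[symmetric] D_def[symmetric] .
qed

lemma kern'_has_derivative:
  assumes "1 + a * qexp w + qexp w ^ 2 \<noteq> 0"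
  shows "(kern' a has_field_derivative tpi * (kern a w - 3 * a * kern a w ^ 2 + 2 * (a ^ 2 - 4) * kern a w ^ 3)) (at w)"
proof -
  define E D where "E = qexp w" and "D = 1 + a * E + E ^ 2"
  have D: "D \<noteq> 0" using assms by (simp add: D_def E_def)
  have dD: "((\<lambda>w. 1 + a * qexp w + qexp w ^ 2) has_field_derivative tpi * (a * E + 2 * E ^ 2)) (at w)"
    unfolding E_def by (rule denominator_has_derivative)
  have "((\<lambda>w. qexp w * (1 - qexp w ^ 2)) has_field_derivative tpi * E * (1 - qexp w ^ 2) + (0 - tpi * (2 * E ^ 2)) * qexp w) (at w)"
    unfolding E_def by (intro DERIV_mult DERIV_diff DERIV_const qexp_has_derivative qexp_sq_has_derivative)
  moreover have "tpi * E * (1 - qexp w ^ 2) + (0 - tpi * (2 * E ^ 2)) * qexp w = tpi * (E - 3 * E ^ 3)"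
    unfolding E_def by (simp add: algebra_simps eval_nat_numeral)
  ultimately have dN: "((\<lambda>w. qexp w * (1 - qexp w ^ 2)) has_field_derivative tpi * (E - 3 * E ^ 3)) (at w)" by simp
  have "((\<lambda>w. qexp w * (1 - qexp w ^ 2) / ((1 + a * qexp w + qexp w ^ 2) * (1 + a * qexp w + qexp w ^ 2))) has_field_derivative
      (tpi * (E - 3 * E ^ 3) * (D * D) - E * (1 - E ^ 2) * (tpi * (a * E + 2 * E ^ 2) * D + tpi * (a * E + 2 * E ^ 2) * D))
      / ((D * D) * (D * D))) (at w)"
    using DERIV_divide[OF dN DERIV_mult[OF dD dD]] D unfolding E_def[symmetric] D_def[symmetric] by simp
  also have "(tpi * (E - 3 * E ^ 3) * (D * D) - E * (1 - E ^ 2) * (tpi * (a * E + 2 * E ^ 2) * D + tpi * (a * E + 2 * E ^ 2) * D))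
      / ((D * D) * (D * D)) = tpi * ((E - 3 * E ^ 3) * D - 2 * E * (1 - E ^ 2) * (a * E + 2 * E ^ 2)) * D / (D ^ 3 * D)"
    by (simp add: algebra_simps eval_nat_numeral)
  also have "\<dots> = tpi * ((E - 3 * E ^ 3) * D - 2 * E * (1 - E ^ 2) * (a * E + 2 * E ^ 2)) / D ^ 3"
    using D by (rule nonzero_mult_divide_mult_cancel_right)
  also have "(E - 3 * E ^ 3) * D - 2 * E * (1 - E ^ 2) * (a * E + 2 * E ^ 2) =
      E * D ^ 2 - 3 * a * E ^ 2 * D + 2 * (a ^ 2 - 4) * E ^ 3"
    unfolding D_def by (simp add: algebra_simps eval_nat_numeral)
  also have "tpi * (E * D ^ 2 - 3 * a * E ^ 2 * D + 2 * (a ^ 2 - 4) * E ^ 3) / D ^ 3 =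
      tpi * (E / D - 3 * a * (E / D) ^ 2 + 2 * (a ^ 2 - 4) * (E / D) ^ 3)"
    using D by (simp add: field_simps eval_nat_numeral)
  finally show ?thesis unfolding kern_def kern'_def[abs_def] E_def D_def by (simp only: power2_eq_square)
qed

section \<open>Powers of the summand as combinations of cotangent derivatives\<close>

text \<open>
  These functions are even in \<open>w\<close>, as \<^const>\<open>kern\<close> is, and have no poles besides \<open>\<plusminus> r\<close> modulo the
  integers. At \<open>w = n \<tau>\<close> they are the terms of the Eisenstein series at \<open>z = r\<close>.
\<close>

definition cot_pair :: "complex \<Rightarrow> nat \<Rightarrow> complex \<Rightarrow> complex" where
  "cot_pair r j w = dcot j (w + r) + (-1) ^ Suc j * dcot j (w - r)"

lemma cot_pair_pairterm: "cot_pair r j (of_nat n * \<tau>) = pairterm j n r \<tau>"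
  using dcot_minus[of j "of_nat n * \<tau> - r"] by (simp add: cot_pair_def pairterm_def add.commute)

text \<open>
  The set \<open>J\<close> of admissible orders is kept explicit because it determines the weights: order \<open>j\<close>
  produces weight \<open>j + 1\<close>.
\<close>

definition cot_span :: "complex \<Rightarrow> nat set \<Rightarrow> (complex \<Rightarrow> complex) \<Rightarrow> bool" where
  "cot_span r J f \<longleftrightarrow> (\<exists>\<alpha>. \<forall>w\<in>\<H>. f w = (\<Sum>j\<in>J. \<alpha> j * cot_pair r j w))"

lemma cot_span_cong:
  assumes "cot_span r J f" "\<And>w. w \<in> \<H> \<Longrightarrow> f w = g w"
  shows "cot_span r J g"
proof -
  obtain \<alpha> where "\<forall>w\<in>\<H>. f w = (\<Sum>j\<in>J. \<alpha> j * cot_pair r j w)" using assms(1) unfolding cot_span_def by (elim exE)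
  then show ?thesis unfolding cot_span_def using assms(2) by (intro exI[of _ \<alpha>]) simp
qed

lemma cot_span_single:
  assumes "j \<in> J" "finite J"
  shows "cot_span r J (cot_pair r j)"
  unfolding cot_span_def
proof (intro exI ballI)
  fix w
  have "(\<Sum>i\<in>J. (if i = j then 1 else 0) * cot_pair r i w) = (\<Sum>i\<in>J. if i = j then cot_pair r i w else 0)"
    by (intro sum.cong) auto
  then show "cot_pair r j w = (\<Sum>i\<in>J. (if i = j then 1 else 0) * cot_pair r i w)" using assms by simp
qed

lemma cot_span_scale: "cot_span r J f \<Longrightarrow> cot_span r J (\<lambda>w. c * f w)"
proof -
  assume "cot_span r J f"
  then obtain \<alpha> where "\<forall>w\<in>\<H>. f w = (\<Sum>j\<in>J. \<alpha> j * cot_pair r j w)" unfolding cot_span_def by (elim exE)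
  then show ?thesis
    unfolding cot_span_def by (intro exI[of _ "\<lambda>j. c * \<alpha> j"]) (simp add: sum_distrib_left mult.assoc)
qed

lemma cot_span_add:
  assumes "cot_span r J f" "cot_span r J g"
  shows "cot_span r J (\<lambda>w. f w + g w)"
proof -
  obtain \<alpha> where "\<forall>w\<in>\<H>. f w = (\<Sum>j\<in>J. \<alpha> j * cot_pair r j w)" using assms(1) unfolding cot_span_def by (elim exE)
  moreover obtain \<beta> where "\<forall>w\<in>\<H>. g w = (\<Sum>j\<in>J. \<beta> j * cot_pair r j w)" using assms(2) unfolding cot_span_def by (elim exE)
  ultimately show ?thesis
    unfolding cot_span_def by (intro exI[of _ "\<lambda>j. \<alpha> j + \<beta> j"]) (simp add: sum.distrib distrib_right)
qed

lemma cot_span_mono: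
  assumes "cot_span r J f" "J \<subseteq> K" "finite K"
  shows "cot_span r K f"
proof -
  obtain \<alpha> where \<alpha>: "\<forall>w\<in>\<H>. f w = (\<Sum>j\<in>J. \<alpha> j * cot_pair r j w)" using assms(1) unfolding cot_span_def by (elim exE)
  have "(\<Sum>j\<in>J. \<alpha> j * cot_pair r j w) = (\<Sum>j\<in>K. (if j \<in> J then \<alpha> j else 0) * cot_pair r j w)" for w
    using assms(2,3) by (intro sum.mono_neutral_cong_left) auto
  with \<alpha> show ?thesis unfolding cot_span_def by (intro exI[of _ "\<lambda>j. if j \<in> J then \<alpha> j else 0"]) simp
qed

text \<open>
  A single derivative exchanges the sign between the two terms of \<^const>\<open>cot_pair\<close>; two derivatives
  restore it and raise the order by two.
\<close>

lemma cot_span_second_derivative: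
  assumes f: "cot_span r J f" and r: "Im r = 0"
    and f1: "\<And>w. w \<in> \<H> \<Longrightarrow> (f has_field_derivative tpi * f1 w) (at w)"
    and f2: "\<And>w. w \<in> \<H> \<Longrightarrow> (f1 has_field_derivative tpi * f2 w) (at w)"
  shows "cot_span r ((\<lambda>j. j + 2) ` J) f2"
proof -
  obtain \<alpha> where \<alpha>: "\<forall>w\<in>\<H>. f w = (\<Sum>j\<in>J. \<alpha> j * cot_pair r j w)" using f unfolding cot_span_def by (elim exE)
  let ?v1 = "\<lambda>j w. dcot (Suc j) (w + r) + (-1) ^ Suc j * dcot (Suc j) (w - r)"
  have notint: "w + r \<notin> \<int>" "w - r \<notin> \<int>" if "w \<in> \<H>" for w
    using that r by (auto simp: upper_half_plane_iff complex_is_Int_iff)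
  have shift: "((\<lambda>w. w + r) has_field_derivative 1 + 0) (at w)" "((\<lambda>w. w - r) has_field_derivative 1 - 0) (at w)" for w
    by (rule DERIV_add DERIV_diff, rule DERIV_ident, rule DERIV_const)+
  have dshift: "((\<lambda>w. dcot i (w + r)) has_field_derivative tpi * dcot (Suc i) (w + r) * (1 + 0)) (at w)"
    "((\<lambda>w. dcot i (w - r)) has_field_derivative tpi * dcot (Suc i) (w - r) * (1 - 0)) (at w)" if "w \<in> \<H>" for w i
    using DERIV_chain2[where f = "dcot i" and g = "\<lambda>w. w + r", OF dcot_has_derivative[OF notint(1)[OF that]] shift(1)]
      DERIV_chain2[where f = "dcot i" and g = "\<lambda>w. w - r", OF dcot_has_derivative[OF notint(2)[OF that]] shift(2)] by blast+
  have d1: "(cot_pair r j has_field_derivative tpi * ?v1 j w) (at w)" if "w \<in> \<H>" for j w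
  proof -
    have "((\<lambda>w. dcot j (w + r) + (-1) ^ Suc j * dcot j (w - r)) has_field_derivative
        tpi * dcot (Suc j) (w + r) * (1 + 0) + (-1) ^ Suc j * (tpi * dcot (Suc j) (w - r) * (1 - 0))) (at w)"
      by (intro DERIV_add DERIV_cmult dshift that)
    then show ?thesis unfolding cot_pair_def[abs_def] by (simp add: algebra_simps)
  qed
  have d2: "(?v1 j has_field_derivative tpi * cot_pair r (j + 2) w) (at w)" if "w \<in> \<H>" for j w
  proof -
    have "(?v1 j has_field_derivative
        tpi * dcot (Suc (Suc j)) (w + r) * (1 + 0) + (-1) ^ Suc j * (tpi * dcot (Suc (Suc j)) (w - r) * (1 - 0))) (at w)"
      by (intro DERIV_add DERIV_cmult dshift that)
    then show ?thesis unfolding cot_pair_def by (simp add: algebra_simps)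
  qed
  have e1: "f1 w = (\<Sum>j\<in>J. \<alpha> j * ?v1 j w)" if w: "w \<in> \<H>" for w
  proof -
    have "((\<lambda>w. \<Sum>j\<in>J. \<alpha> j * cot_pair r j w) has_field_derivative (\<Sum>j\<in>J. \<alpha> j * (tpi * ?v1 j w))) (at w)"
      by (intro DERIV_sum DERIV_cmult d1 w)
    then have "(f has_field_derivative (\<Sum>j\<in>J. \<alpha> j * (tpi * ?v1 j w))) (at w)"
      by (rule has_field_derivative_transform_within_open[OF _ open_upper_half_plane w]) (use \<alpha> in simp)
    from DERIV_unique[OF f1[OF w] this] have "tpi * f1 w = tpi * (\<Sum>j\<in>J. \<alpha> j * ?v1 j w)"
      by (simp only: sum_distrib_left mult.left_commute)
    then show ?thesis by (simp only: mult_cancel_left tpi_nonzero simp_thms)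
  qed
  have e2: "f2 w = (\<Sum>j\<in>J. \<alpha> j * cot_pair r (j + 2) w)" if w: "w \<in> \<H>" for w
  proof -
    have "((\<lambda>w. \<Sum>j\<in>J. \<alpha> j * ?v1 j w) has_field_derivative (\<Sum>j\<in>J. \<alpha> j * (tpi * cot_pair r (j + 2) w))) (at w)"
      by (intro DERIV_sum DERIV_cmult d2 w)
    then have "(f1 has_field_derivative (\<Sum>j\<in>J. \<alpha> j * (tpi * cot_pair r (j + 2) w))) (at w)"
      by (rule has_field_derivative_transform_within_open[OF _ open_upper_half_plane w]) (use e1 in simp)
    from DERIV_unique[OF f2[OF w] this] have "tpi * f2 w = tpi * (\<Sum>j\<in>J. \<alpha> j * cot_pair r (j + 2) w)"
      by (simp only: sum_distrib_left mult.left_commute)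
    then show ?thesis by (simp only: mult_cancel_left tpi_nonzero simp_thms)
  qed
  have "(\<Sum>j\<in>J. \<alpha> j * cot_pair r (j + 2) w) = (\<Sum>j\<in>(\<lambda>j. j + 2) ` J. \<alpha> (j - 2) * cot_pair r j w)" for w
    by (subst sum.reindex) (auto simp: inj_on_def)
  with e2 show ?thesis unfolding cot_span_def by (intro exI[of _ "\<lambda>j. \<alpha> (j - 2)"]) simp
qed

text \<open>
  With \<open>h = kern a\<close> and \<open>k = m + 1\<close>, the equation
  \<open>D\<^sup>2 (h\<^sup>k) = k\<^sup>2 h\<^sup>k - a k (2k + 1) h\<^sup>k\<^sup>+\<^sup>1 + (a\<^sup>2 - 4) k (k + 1) h\<^sup>k\<^sup>+\<^sup>2\<close>
  expresses a higher power of \<open>h\<close> through lower ones and a second derivative. It replaces the partial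
  fraction decomposition of \<open>h\<^sup>k\<close>.
\<close>

lemma kern_power_second_derivative:
  assumes span: "cot_span r J (\<lambda>w. kern a w ^ Suc m)" and r: "Im r = 0"
    and D: "\<And>w. w \<in> \<H> \<Longrightarrow> 1 + a * qexp w + qexp w ^ 2 \<noteq> 0"
  shows "cot_span r ((\<lambda>j. j + 2) ` J) (\<lambda>w. of_nat (Suc m) ^ 2 * kern a w ^ Suc m
    - a * of_nat (Suc m) * (2 * of_nat (Suc m) + 1) * kern a w ^ (m + 2)
    + (a ^ 2 - 4) * of_nat (Suc m) * of_nat (m + 2) * kern a w ^ (m + 3))"
proof (rule cot_span_second_derivative[OF span r])
  fix w assume w: "w \<in> \<H>"
  let ?f1 = "\<lambda>w. of_nat (Suc m) * (kern' a w * kern a w ^ m)"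
  let ?h = "kern a w" and ?h' = "kern' a w" and ?h'' = "kern a w - 3 * a * kern a w ^ 2 + 2 * (a ^ 2 - 4) * kern a w ^ 3"
  note dh = kern_has_derivative[OF D[OF w]] and dh' = kern'_has_derivative[OF D[OF w]]
  have dpow: "((\<lambda>w. kern a w ^ n) has_field_derivative of_nat n * (tpi * ?h' * ?h ^ (n - Suc 0))) (at w)" for n
    by (rule DERIV_power[OF dh])
  show "((\<lambda>w. kern a w ^ Suc m) has_field_derivative tpi * ?f1 w) (at w)"
    using dpow[of "Suc m"] by (simp add: mult_ac)
  have d1: "(?f1 has_field_derivative of_nat (Suc m) * (tpi * ?h'' * ?h ^ m + of_nat m * (tpi * ?h' * ?h ^ (m - Suc 0)) * ?h')) (at w)"
    by (intro DERIV_cmult DERIV_mult dpow dh')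
  have sq: "of_nat m * ?h ^ (m - Suc 0) * ?h' ^ 2 = of_nat m * (?h ^ (m + 1) - 2 * a * ?h ^ (m + 2) + (a ^ 2 - 4) * ?h ^ (m + 3))"
    unfolding kern'_sq[OF D[OF w]] by (cases m) (simp_all add: algebra_simps eval_nat_numeral)
  have "of_nat (Suc m) * (tpi * ?h'' * ?h ^ m + of_nat m * (tpi * ?h' * ?h ^ (m - Suc 0)) * ?h') =
      tpi * (of_nat (Suc m) * (?h'' * ?h ^ m + of_nat m * ?h ^ (m - Suc 0) * ?h' ^ 2))"
    by (simp add: algebra_simps power2_eq_square)
  also have "of_nat (Suc m) * (?h'' * ?h ^ m + of_nat m * ?h ^ (m - Suc 0) * ?h' ^ 2) =
      of_nat (Suc m) ^ 2 * ?h ^ Suc m - a * of_nat (Suc m) * (2 * of_nat (Suc m) + 1) * ?h ^ (m + 2)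
      + (a ^ 2 - 4) * of_nat (Suc m) * of_nat (m + 2) * ?h ^ (m + 3)"
    unfolding sq by (simp add: algebra_simps eval_nat_numeral)
  finally show "(?f1 has_field_derivative tpi * (of_nat (Suc m) ^ 2 * ?h ^ Suc m
      - a * of_nat (Suc m) * (2 * of_nat (Suc m) + 1) * ?h ^ (m + 2)
      + (a ^ 2 - 4) * of_nat (Suc m) * of_nat (m + 2) * ?h ^ (m + 3))) (at w)"
    using d1 by simp
qed

text \<open>
  The condition on \<open>a\<close> says \<open>1 + a x + x\<^sup>2 = (1 - \<zeta> x) (1 - x / \<zeta>)\<close> with \<open>\<zeta> = qexp r\<close>.
\<close>

locale torsion_point =
  fixes r a :: complex
  assumes real: "Im r = 0" and a: "a = - (qexp r + inverse (qexp r))"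
begin

lemma shifted_not_Ints: "w \<in> \<H> \<Longrightarrow> w + r \<notin> \<int>" "w \<in> \<H> \<Longrightarrow> w - r \<notin> \<int>"
  using real by (auto simp: upper_half_plane_iff complex_is_Int_iff)

lemma qexp_shifted: "qexp (w + r) = qexp w * qexp r" "qexp (w - r) = qexp w * inverse (qexp r)"
  using qexp_add[of w r] qexp_add[of w "- r"] by (simp_all add: qexp_minus)

lemma denominator_factors:
  "1 + a * qexp w + qexp w ^ 2 = (1 - qexp (w + r)) * (1 - qexp (w - r))"
  unfolding a qexp_shifted by (simp add: field_simps power2_eq_square)

lemma denominator_nonzero: "w \<in> \<H> \<Longrightarrow> 1 + a * qexp w + qexp w ^ 2 \<noteq> 0"
  using shifted_not_Ints[of w] by (simp add: denominator_factors flip: qexp_eq_1_iff)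

lemma cot_pair_0: "w \<in> \<H> \<Longrightarrow> cot_pair r 0 w = (qexp r - inverse (qexp r)) * kern a w"
proof -
  assume w: "w \<in> \<H>"
  have ne: "1 - qexp (w + r) \<noteq> 0" "1 - qexp (w - r) \<noteq> 0" using shifted_not_Ints[OF w] by (simp_all flip: qexp_eq_1_iff)
  have "cot_pair r 0 w = 1 / (1 - qexp (w + r)) - 1 / (1 - qexp (w - r))"
    using shifted_not_Ints[OF w] by (simp add: cot_pair_def dcot_0 halfcot_altdef)
  also have "\<dots> = (qexp (w + r) - qexp (w - r)) / ((1 - qexp (w + r)) * (1 - qexp (w - r)))"
    using ne by (simp add: field_simps)
  also have "\<dots> = (qexp r - inverse (qexp r)) * kern a w"
  proof -
    have "qexp (w + r) - qexp (w - r) = (qexp r - inverse (qexp r)) * qexp w"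
      unfolding qexp_shifted by (simp add: algebra_simps)
    then show ?thesis unfolding kern_def denominator_factors by simp
  qed
  finally show ?thesis .
qed

lemma cot_pair_1: "w \<in> \<H> \<Longrightarrow> cot_pair r 1 w = (a ^ 2 - 4) * kern a w ^ 2 - a * kern a w"
proof -
  assume w: "w \<in> \<H>"
  define u v E where "u = qexp (w + r)" and "v = qexp (w - r)" and "E = qexp w"
  \<comment> \<open>everything is symmetric in \<open>u\<close> and \<open>v\<close>, hence rational in \<open>a\<close> and \<open>E\<close>\<close>
  have uv: "u * v = E ^ 2" by (simp add: u_def v_def E_def qexp_shifted power2_eq_square)
  have upv: "a * E = - (u + v)" unfolding u_def v_def E_def qexp_shifted a by (simp add: algebra_simps)
  have ne: "1 - u \<noteq> 0" "1 - v \<noteq> 0" using shifted_not_Ints[OF w] by (simp_all add: u_def v_def flip: qexp_eq_1_iff)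
  define D where "D = (1 - u) * (1 - v)"
  have D: "D \<noteq> 0" using ne by (simp add: D_def)
  have h: "kern a w = E / D" unfolding kern_def denominator_factors D_def u_def v_def E_def ..
  have "cot_pair r 1 w = u / (1 - u) ^ 2 + v / (1 - v) ^ 2"
    using halfcot_sq[OF shifted_not_Ints(1)[OF w]] halfcot_sq[OF shifted_not_Ints(2)[OF w]]
    by (simp add: cot_pair_def dcot_def u_def v_def pderiv_pCons power2_eq_square algebra_simps)
  also have "\<dots> = (u * (1 - v) ^ 2 + v * (1 - u) ^ 2) / D ^ 2"
    using ne by (simp add: D_def power_mult_distrib add_frac_eq)
  also have "u * (1 - v) ^ 2 + v * (1 - u) ^ 2 = (u + v) ^ 2 - 4 * (u * v) + (u + v) * D"
    unfolding D_def by (simp add: algebra_simps power2_eq_square)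
  also have "\<dots> = (a * E) ^ 2 - 4 * E ^ 2 - a * E * D"
    unfolding upv uv[symmetric] by (simp add: algebra_simps power2_eq_square)
  also have "\<dots> / D ^ 2 = (a ^ 2 - 4) * (E / D) ^ 2 - a * (E / D)"
    using D by (simp add: field_simps power2_eq_square)
  finally show ?thesis unfolding h .
qed

lemma cot_span_kern_power_recurrence:
  assumes "cot_span r J (\<lambda>w. kern a w ^ Suc m)" "cot_span r K (\<lambda>w. a * kern a w ^ (m + 2))" "a ^ 2 \<noteq> 4"
    and "J \<subseteq> L" "K \<subseteq> L" "(\<lambda>j. j + 2) ` J \<subseteq> L" "finite L"
  shows "cot_span r L (\<lambda>w. kern a w ^ (m + 3))"
proof -
  define C where "C = (a ^ 2 - 4) * of_nat (Suc m) * of_nat (m + 2)"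
  have C: "C \<noteq> 0" using assms(3) by (simp add: C_def del: of_nat_Suc of_nat_add)
  let ?F = "\<lambda>w. of_nat (Suc m) ^ 2 * kern a w ^ Suc m
    - a * of_nat (Suc m) * (2 * of_nat (Suc m) + 1) * kern a w ^ (m + 2) + C * kern a w ^ (m + 3)"
  have F: "cot_span r L ?F"
    using cot_span_mono[OF kern_power_second_derivative[OF assms(1) real denominator_nonzero] assms(6,7)] unfolding C_def .
  have 1: "cot_span r L (\<lambda>w. kern a w ^ Suc m)" "cot_span r L (\<lambda>w. a * kern a w ^ (m + 2))"
    using assms by (auto intro: cot_span_mono)
  have "cot_span r L (\<lambda>w. 1 / C * (?F w + (- (of_nat (Suc m) ^ 2) * kern a w ^ Suc m
      + of_nat (Suc m) * (2 * of_nat (Suc m) + 1) * (a * kern a w ^ (m + 2)))))"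
    by (intro cot_span_scale cot_span_add F 1)
  then show ?thesis
  proof (rule cot_span_cong)
    fix w
    have "?F w + (- (of_nat (Suc m) ^ 2) * kern a w ^ Suc m + of_nat (Suc m) * (2 * of_nat (Suc m) + 1) * (a * kern a w ^ (m + 2)))
      = C * kern a w ^ (m + 3)" by (simp add: algebra_simps)
    then show "1 / C * (?F w + (- (of_nat (Suc m) ^ 2) * kern a w ^ Suc m
      + of_nat (Suc m) * (2 * of_nat (Suc m) + 1) * (a * kern a w ^ (m + 2)))) = kern a w ^ (m + 3)"
      using C by simp
  qed
qed

lemma cot_span_kern:
  assumes "qexp r \<noteq> inverse (qexp r)"
  shows "cot_span r {0} (kern a)"
proof -
  have "cot_span r {0} (\<lambda>w. 1 / (qexp r - inverse (qexp r)) * cot_pair r 0 w)"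
    by (intro cot_span_scale cot_span_single) auto
  then show ?thesis
    by (rule cot_span_cong) (use assms in \<open>simp add: cot_pair_0\<close>)
qed

lemma a_sq: "a ^ 2 - 4 = (qexp r - inverse (qexp r)) ^ 2"
  unfolding a by (simp add: field_simps power2_eq_square)

text \<open>
  If the two poles are distinct, \<open>h\<^sup>k\<close> has poles of order \<open>k\<close>, so the derivatives of order \<open>j < k\<close> suffice.
\<close>

theorem cot_span_kern_power:
  assumes ne: "qexp r \<noteq> inverse (qexp r)" and "k \<ge> 1"
  shows "cot_span r {..<k} (\<lambda>w. kern a w ^ k)"
proof -
  have a4: "a ^ 2 \<noteq> 4" using a_sq ne by auto
  have "cot_span r {..<Suc m} (\<lambda>w. kern a w ^ Suc m) \<and> cot_span r {..<m + 2} (\<lambda>w. kern a w ^ (m + 2))" for m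
  proof (induction m)
    case 0
    have 1: "cot_span r {..<2} (kern a)" "cot_span r {..<1} (kern a)" using cot_span_kern[OF ne] by (auto intro: cot_span_mono)
    have "cot_span r {..<2} (\<lambda>w. 1 / (a ^ 2 - 4) * (cot_pair r 1 w + a * kern a w))"
      by (intro cot_span_scale cot_span_add cot_span_single 1) auto
    then have "cot_span r {..<2} (\<lambda>w. kern a w ^ 2)"
      by (rule cot_span_cong) (use a4 in \<open>simp only: cot_pair_1\<close>, simp)
    with 1 show ?case by (simp add: numeral_2_eq_2)
  next
    case (Suc m)
    have "cot_span r {..<m + 3} (\<lambda>w. kern a w ^ (m + 3))"
      using Suc by (intro cot_span_kern_power_recurrence[of "{..<Suc m}" m "{..<m + 2}"] cot_span_scale a4) auto
    with Suc show ?case by (simp add: eval_nat_numeral)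
  qed
  from this[of "k - 1"] \<open>k \<ge> 1\<close> show ?thesis by simp
qed

text \<open>
  If \<open>a = 0\<close>, the recurrence connects only exponents of equal parity. Starting at \<open>k = 1\<close> it never meets odd
  orders, in particular not the order \<open>1\<close> that is responsible for positive depth.
\<close>

theorem cot_span_kern_power_odd:
  assumes ne: "qexp r \<noteq> inverse (qexp r)" and a0: "a = 0" and "odd k"
  shows "cot_span r {j. j < k \<and> even j} (\<lambda>w. kern a w ^ k)"
proof -
  have "cot_span r {j. j < 2 * m + 1 \<and> even j} (\<lambda>w. kern a w ^ (2 * m + 1))" for m
  proof (induction m)
    case 0
    have "{j. j < 2 * 0 + 1 \<and> even j} = {0 :: nat}" by auto
    then show ?case using cot_span_kern[OF ne] by simp
  next
    case (Suc m)
    have "cot_span r {} (\<lambda>w. a * kern a w ^ (2 * m + 2))" using a0 by (simp add: cot_span_def)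
    then have "cot_span r {j. j < 2 * Suc m + 1 \<and> even j} (\<lambda>w. kern a w ^ (2 * m + 3))"
      using Suc a0 by (intro cot_span_kern_power_recurrence[of "{j. j < 2 * m + 1 \<and> even j}" "2 * m" "{}"]) auto
    moreover have "2 * Suc m + 1 = 2 * m + 3" by simp
    ultimately show ?case by (simp only:)
  qed
  from this[of "k div 2"] \<open>odd k\<close> show ?thesis by simp
qed

text \<open>
  If \<open>\<zeta> = -1\<close>, that is \<open>a = 2\<close>, the two poles coincide and the coefficient \<open>a\<^sup>2 - 4\<close> vanishes. The recurrence then
  gives \<open>h\<^sup>k\<^sup>+\<^sup>1\<close> in terms of \<open>h\<^sup>k\<close> alone, at the price of two orders for each step: this is why the weight
  doubles.
\<close>

theorem cot_span_kern_power_double: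
  assumes dbl: "qexp r = - 1" and "k \<ge> 1"
  shows "cot_span r {..<2 * k} (\<lambda>w. kern a w ^ k)"
proof -
  have a2: "a = 2" unfolding a dbl by simp
  have "cot_span r {..<2 * Suc m} (\<lambda>w. kern a w ^ Suc m)" for m
  proof (induction m)
    case 0
    have "cot_span r {..<2} (\<lambda>w. - 1 / 2 * cot_pair r 1 w)" by (intro cot_span_scale cot_span_single) auto
    then have "cot_span r {..<2} (kern a)"
      by (rule cot_span_cong) (simp only: cot_pair_1, simp add: a2)
    then show ?case by simp
  next
    case (Suc m)
    define C :: complex where "C = 2 * of_nat (Suc m) * (2 * of_nat (Suc m) + 1)"
    have "2 * of_nat (Suc m) * (2 * of_nat (Suc m) + 1) = (of_nat (2 * Suc m * (2 * Suc m + 1)) :: complex)"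
      by (simp add: algebra_simps)
    then have C: "C \<noteq> 0" unfolding C_def by (simp only: of_nat_eq_0_iff) simp
    let ?F = "\<lambda>w. of_nat (Suc m) ^ 2 * kern a w ^ Suc m - a * of_nat (Suc m) * (2 * of_nat (Suc m) + 1) * kern a w ^ (m + 2)
      + (a ^ 2 - 4) * of_nat (Suc m) * of_nat (m + 2) * kern a w ^ (m + 3)"
    have F: "cot_span r {..<2 * Suc (Suc m)} ?F"
      by (rule cot_span_mono[OF kern_power_second_derivative[OF Suc real denominator_nonzero]]) auto
    have 1: "cot_span r {..<2 * Suc (Suc m)} (\<lambda>w. kern a w ^ Suc m)" by (rule cot_span_mono[OF Suc]) auto
    have "cot_span r {..<2 * Suc (Suc m)} (\<lambda>w. - 1 / C * (?F w + - (of_nat (Suc m) ^ 2) * kern a w ^ Suc m))"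
      by (intro cot_span_scale cot_span_add F 1)
    then show ?case
    proof (rule cot_span_cong)
      fix w
      have "?F w + - (of_nat (Suc m) ^ 2) * kern a w ^ Suc m = - C * kern a w ^ (m + 2)"
        by (simp add: a2 C_def)
      then show "- 1 / C * (?F w + - (of_nat (Suc m) ^ 2) * kern a w ^ Suc m) = kern a w ^ Suc (Suc m)"
        using C by simp
    qed
  qed
  from this[of "k - 1"] \<open>k \<ge> 1\<close> show ?thesis by simp
qed

end

section \<open>The series as mixed weight forms\<close>

lemma of_nat_mult_upper_half_plane: "\<tau> \<in> \<H> \<Longrightarrow> n \<ge> 1 \<Longrightarrow> of_nat n * \<tau> \<in> \<H>"
  by (simp add: upper_half_plane_iff)

lemma cot_span_imp_summable:
  assumes "cot_span r J (\<lambda>w. kern a w ^ k)" "\<tau> \<in> \<H>"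
  shows "summable (\<lambda>n. norm (summand a (qexp \<tau>) n ^ k))"
proof -
  obtain \<alpha> where \<alpha>: "\<forall>w\<in>\<H>. kern a w ^ k = (\<Sum>j\<in>J. \<alpha> j * cot_pair r j w)"
    using assms(1) unfolding cot_span_def by (elim exE)
  have eq: "summand a (qexp \<tau>) (Suc n) ^ k = (\<Sum>j\<in>J. \<alpha> j * pairterm j (Suc n) r \<tau>)" for n
    unfolding summand_qexp using \<alpha>[rule_format, OF of_nat_mult_upper_half_plane[OF assms(2), of "Suc n"]]
    by (simp only: cot_pair_pairterm)
  have "summable (\<lambda>n. \<Sum>j\<in>J. norm (\<alpha> j) * norm (pairterm j (Suc n) r \<tau>))"
    by (intro summable_sum summable_mult summable_pairterm assms(2))
  then have "summable (\<lambda>n. norm (summand a (qexp \<tau>) (Suc n) ^ k))"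
  proof (rule summable_comparison_test')
    fix n
    show "norm (norm (summand a (qexp \<tau>) (Suc n) ^ k)) \<le> (\<Sum>j\<in>J. norm (\<alpha> j) * norm (pairterm j (Suc n) r \<tau>))"
      unfolding eq by (simp only: real_norm_def abs_norm_cancel) (rule order_trans[OF norm_sum], simp add: norm_mult)
  qed
  then show ?thesis by (rule summable_Suc_iff[THEN iffD1])
qed

text \<open>
  Summing the expansion of \<open>h\<^sup>k\<close> over \<open>w = n \<tau>\<close> gives the Eisenstein series without their terms of index \<open>0\<close>,
  which are constants in \<open>\<tau>\<close>.
\<close>

lemma Useries1_as_eis:
  assumes "cot_span r J (\<lambda>w. kern a w ^ k)"
  obtains \<alpha> where "\<And>\<tau>. \<tau> \<in> \<H> \<Longrightarrow> Useries1 k k a (qexp \<tau>) = (\<Sum>j\<in>J. \<alpha> j * (eis j r \<tau> + - dcot j r))"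
proof -
  obtain \<alpha> where \<alpha>: "\<forall>w\<in>\<H>. kern a w ^ k = (\<Sum>j\<in>J. \<alpha> j * cot_pair r j w)"
    using assms unfolding cot_span_def by (elim exE)
  have "Useries1 k k a (qexp \<tau>) = (\<Sum>j\<in>J. \<alpha> j * (eis j r \<tau> + - dcot j r))" if \<tau>: "\<tau> \<in> \<H>" for \<tau>
  proof -
    let ?f = "\<lambda>n. summand a (qexp \<tau>) n ^ k"
    have eq: "?f (Suc n) = (\<Sum>j\<in>J. \<alpha> j * pairterm j (Suc n) r \<tau>)" for n
      unfolding summand_qexp using \<alpha>[rule_format, OF of_nat_mult_upper_half_plane[OF \<tau>, of "Suc n"]]
      by (simp only: cot_pair_pairterm)
    have "(\<lambda>n. \<Sum>j\<in>J. \<alpha> j * pairterm j (Suc n) r \<tau>) sums (\<Sum>j\<in>J. \<alpha> j * pairsum j r \<tau>)"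
      by (intro sums_sum sums_mult pairterm_sums \<tau>)
    then have "(\<lambda>n. ?f (Suc n)) sums (\<Sum>j\<in>J. \<alpha> j * pairsum j r \<tau>)" unfolding eq .
    moreover have "summable (\<lambda>n. norm (?f (Suc n)))"
      using cot_span_imp_summable[OF assms \<tau>] by (rule summable_Suc_iff[THEN iffD2])
    ultimately have "((\<lambda>n. ?f (Suc n)) has_sum (\<Sum>j\<in>J. \<alpha> j * pairsum j r \<tau>)) UNIV"
      by (intro norm_summable_imp_has_sum)
    then have "(?f has_sum (\<Sum>j\<in>J. \<alpha> j * pairsum j r \<tau>)) (range Suc)"
      by (subst has_sum_reindex) (auto simp: o_def)
    moreover have "range Suc = {1..}" by (auto simp: image_def) presburger
    ultimately have "Useries1 k k a (qexp \<tau>) = (\<Sum>j\<in>J. \<alpha> j * pairsum j r \<tau>)"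
      unfolding Useries1_eq by (simp add: infsumI)
    then show ?thesis by (simp add: eis_def)
  qed
  then show ?thesis by (rule that)
qed

text \<open>
  What the modular and the quasimodular functions of fixed level have in common for the purpose of
  forming polynomials in them.
\<close>

locale weight_graded =
  fixes Q :: "int \<Rightarrow> (complex \<Rightarrow> complex) \<Rightarrow> bool"
  assumes mult: "Q v f \<Longrightarrow> Q w g \<Longrightarrow> Q (v + w) (\<lambda>\<tau>. f \<tau> * g \<tau>)"
    and const: "Q 0 (\<lambda>_. c)"
begin

lemma mixed_const: "mixed Q (int W) (\<lambda>_. c)"
  by (rule mixed_single[of Q 0, OF const]) simp

lemma mixed_times: "mixed Q w f \<Longrightarrow> mixed Q w' g \<Longrightarrow> mixed Q (w + w') (\<lambda>\<tau>. f \<tau> * g \<tau>)"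
  by (rule mixed_mult) (rule mult)

lemma mixed_const_mult: "mixed Q w f \<Longrightarrow> mixed Q w (\<lambda>\<tau>. c * f \<tau>)"
  using mixed_times[OF mixed_const[of 0 c], of w f] by simp

lemma mixed_Useries1:
  assumes span: "cot_span r J (\<lambda>w. kern a w ^ k)"
    and eis: "\<And>j. j \<in> J \<Longrightarrow> Q (int (Suc j)) (\<lambda>\<tau>. eis j r \<tau>)"
    and J: "\<And>j. j \<in> J \<Longrightarrow> j < W"
  shows "mixed Q (int W) (\<lambda>\<tau>. Useries1 k k a (qexp \<tau>))"
proof -
  obtain \<alpha> where \<alpha>: "\<And>\<tau>. \<tau> \<in> \<H> \<Longrightarrow> Useries1 k k a (qexp \<tau>) = (\<Sum>j\<in>J. \<alpha> j * (eis j r \<tau> + - dcot j r))"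
    using Useries1_as_eis[OF span] by metis
  have "mixed Q (int W) (\<lambda>\<tau>. \<Sum>j\<in>J. \<alpha> j * (eis j r \<tau> + - dcot j r))"
  proof (rule mixed_sum, rule mixed_const_mult, rule mixed_add)
    fix j assume j: "j \<in> J"
    show "mixed Q (int W) (\<lambda>\<tau>. eis j r \<tau>)"
      using J[OF j] by (intro mixed_single[of Q "int (Suc j)"] eis[OF j]) simp
    show "mixed Q (int W) (\<lambda>_. - dcot j r)"
      by (rule mixed_const)
  qed
  then show ?thesis by (rule mixed_cong) (simp only: \<alpha>)
qed

text \<open>
  Newton's identities express the series by products of series with smaller \<open>t\<close> and power sums. The factor
  \<open>u\<close> is the weight that each unit of the exponent of the summand contributes.
\<close>

lemma mixed_Useries:
  assumes U1: "\<And>s. s \<ge> 1 \<Longrightarrow> mixed Q (int (u * s)) (\<lambda>\<tau>. Useries1 s s a (qexp \<tau>))"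
    and summable: "\<And>s \<tau>. s \<ge> 1 \<Longrightarrow> \<tau> \<in> \<H> \<Longrightarrow> summable (\<lambda>n. norm (summand a (qexp \<tau>) n ^ s))"
    and k: "k \<ge> 1"
  shows "mixed Q (int (u * (t * k))) (\<lambda>\<tau>. Useries t k k a (qexp \<tau>))"
proof (induction t rule: less_induct)
  case (less t)
  show ?case
  proof (cases t)
    case 0
    then show ?thesis using mixed_const[of 0 1] by (simp add: Useries_0)
  next
    case (Suc s)
    have "mixed Q (int (u * (t * k))) (\<lambda>\<tau>. (-1) ^ i * (Useries (s - i) k k a (qexp \<tau>) * Useries1 (Suc i * k) (Suc i * k) a (qexp \<tau>)))"
      if i: "i \<le> s" for i
    proof (rule mixed_const_mult)
      have "Suc i * k \<ge> 1" using k by simp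
      then have "mixed Q (int (u * ((s - i) * k)) + int (u * (Suc i * k)))
          (\<lambda>\<tau>. Useries (s - i) k k a (qexp \<tau>) * Useries1 (Suc i * k) (Suc i * k) a (qexp \<tau>))"
        using Suc by (intro mixed_times less.IH U1) auto
      moreover have "int (u * ((s - i) * k)) + int (u * (Suc i * k)) = int (u * (t * k))"
      proof -
        have "s - i + Suc i = t" using i Suc by simp
        then have "(s - i) * k + Suc i * k = t * k" by (simp only: add_mult_distrib[symmetric])
        then show ?thesis by (simp only: of_nat_add[symmetric] add_mult_distrib2[symmetric])
      qed
      ultimately show "mixed Q (int (u * (t * k))) (\<lambda>\<tau>. Useries (s - i) k k a (qexp \<tau>) * Useries1 (Suc i * k) (Suc i * k) a (qexp \<tau>))"
        by (simp only:)
    qed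
    then have "mixed Q (int (u * (t * k))) (\<lambda>\<tau>. \<Sum>i\<le>s. (-1) ^ i * (Useries (s - i) k k a (qexp \<tau>) * Useries1 (Suc i * k) (Suc i * k) a (qexp \<tau>)))"
      by (intro mixed_sum) simp
    then have "mixed Q (int (u * (t * k))) (\<lambda>\<tau>. 1 / of_nat t *
        (\<Sum>i\<le>s. (-1) ^ i * (Useries (s - i) k k a (qexp \<tau>) * Useries1 (Suc i * k) (Suc i * k) a (qexp \<tau>))))"
      by (rule mixed_const_mult)
    then show ?thesis
    proof (rule mixed_cong)
      fix \<tau> assume \<tau>: "\<tau> \<in> \<H>"
      have "of_nat t * Useries t k k a (qexp \<tau>) =
          (\<Sum>i\<le>s. (-1) ^ i * (Useries (s - i) k k a (qexp \<tau>) * Useries1 (Suc i * k) (Suc i * k) a (qexp \<tau>)))"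
        using Useries_newton[OF summable[OF _ \<tau>] k, of s] by (simp only: Suc mult.assoc)
      moreover have "of_nat t \<noteq> (0 :: complex)" using Suc by (simp del: of_nat_Suc)
      ultimately show "1 / of_nat t * (\<Sum>i\<le>s. (-1) ^ i * (Useries (s - i) k k a (qexp \<tau>) * Useries1 (Suc i * k) (Suc i * k) a (qexp \<tau>)))
          = Useries t k k a (qexp \<tau>)" by (simp add: field_simps)
    qed
  qed
qed

end

lemma weight_graded_modular: "weight_graded (modular N)"
  by unfold_locales (rule modular_mult modular_const; assumption)+

lemma quasimodular_const: "quasimodular N 0 (\<lambda>_. C)"
  by (intro modular_imp_quasimodular modular_const)

lemma eis_torsion_quasimodular:
  assumes "N \<in> {2, 3, 4, 6}"
  shows "quasimodular N (int (Suc j)) (\<lambda>\<tau>. eis j (1 / of_nat N) \<tau>)"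
proof (cases "j = 1")
  case True
  then show ?thesis using eis_torsion_quasimodular_2[OF assms] by simp
qed (use eis_torsion_modular[OF assms] modular_imp_quasimodular in blast)

lemma weight_graded_quasimodular: "weight_graded (quasimodular N)"
  by unfold_locales (rule quasimodular_mult quasimodular_const; assumption)+

text \<open>
  The primitive \<open>N\<close>-th root of unity \<open>\<zeta> = qexp (1/N)\<close> has \<open>\<zeta> + 1/\<zeta> = 2 cos (2 \<pi> / N)\<close>.
\<close>

lemma torsion_pointI:
  assumes "x = - 2 * cos (2 * pi / real N)"
  shows "torsion_point (1 / of_nat N) (of_real x)"
proof
  have "2 * of_real pi * \<i> * (1 / of_nat N) = \<i> * of_real (2 * pi / real N)" by simp
  then have q: "qexp (1 / of_nat N) = cis (2 * pi / real N)" unfolding qexp_def cis_conv_exp by (simp only:)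
  show "of_real x = - (qexp (1 / of_nat N) + inverse (qexp (1 / of_nat N)))"
    unfolding q by (simp add: assms complex_eq_iff)
qed simp

lemma torsion_points:
  "torsion_point (1 / of_nat 4) 0" "torsion_point (1 / of_nat 3) 1"
  "torsion_point (1 / of_nat 6) (- 1)" "torsion_point (1 / of_nat 2) 2"
  using torsion_pointI[of 0 4] torsion_pointI[of 1 3] torsion_pointI[of "-1" 6] torsion_pointI[of 2 2]
  by (simp_all add: cos_60 cos_120 cos_pi_half)

lemma qexp_half: "qexp (1 / of_nat 2) = - 1"
  by (simp add: qexp_def)

lemma torsion_point_span:
  assumes "torsion_point r a" "a ^ 2 \<noteq> 4" "k \<ge> 1"
  shows "cot_span r {..<k} (\<lambda>w. kern a w ^ k)"
  using torsion_point.cot_span_kern_power[OF assms(1) _ assms(3)] torsion_point.a_sq[OF assms(1)] assms(2) by fastforce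

lemma mixed_quasimodular_Useries:
  assumes N: "N \<in> {2, 3, 4, 6}"
    and span: "\<And>s. s \<ge> 1 \<Longrightarrow> cot_span (1 / of_nat N) {..<u * s} (\<lambda>w. kern a w ^ s)" and k: "k \<ge> 1"
  shows "mixed_quasimodular N (int (u * k)) (\<lambda>\<tau>. Useries1 k k a (qexp \<tau>))"
    and "mixed_quasimodular N (int (u * (t * k))) (\<lambda>\<tau>. Useries t k k a (qexp \<tau>))"
proof -
  have U1: "mixed (quasimodular N) (int (u * s)) (\<lambda>\<tau>. Useries1 s s a (qexp \<tau>))" if "s \<ge> 1" for s
    by (rule weight_graded.mixed_Useries1[OF weight_graded_quasimodular span[OF that]])
      (rule eis_torsion_quasimodular[OF N], simp)
  show "mixed_quasimodular N (int (u * k)) (\<lambda>\<tau>. Useries1 k k a (qexp \<tau>))"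
    unfolding mixed_quasimodular_iff by (rule U1[OF k])
  show "mixed_quasimodular N (int (u * (t * k))) (\<lambda>\<tau>. Useries t k k a (qexp \<tau>))"
    unfolding mixed_quasimodular_iff
    by (rule weight_graded.mixed_Useries[OF weight_graded_quasimodular U1 cot_span_imp_summable[OF span] k])
qed

theorem theorem1p1:
  fixes t k :: nat
  assumes "t \<ge> 1" and "k \<ge> 1"
  shows
    "(mixed_quasimodular 4 (int k) (\<lambda>\<tau>. Useries1 k k 0 (qexp \<tau>)) \<and>
      mixed_quasimodular 3 (int k) (\<lambda>\<tau>. Useries1 k k 1 (qexp \<tau>)) \<and>
      mixed_quasimodular 6 (int k) (\<lambda>\<tau>. Useries1 k k (-1) (qexp \<tau>)) \<and>
      mixed_quasimodular 2 (int (2 * k)) (\<lambda>\<tau>. Useries1 k k 2 (qexp \<tau>)) \<and>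
      (odd k \<longrightarrow> mixed_modular 4 (int k) (\<lambda>\<tau>. Useries1 k k 0 (qexp \<tau>)))) \<and>
     ((\<exists>P. isobaric t P \<and>
        (\<forall>a :: complex.
           U_formal t k k a = eval_rat_mpoly P (\<lambda>s. U1_formal (s * k) (s * k) a))) \<and>
      mixed_quasimodular 4 (int (t * k)) (\<lambda>\<tau>. Useries t k k 0 (qexp \<tau>)) \<and>
      mixed_quasimodular 3 (int (t * k)) (\<lambda>\<tau>. Useries t k k 1 (qexp \<tau>)) \<and>
      mixed_quasimodular 6 (int (t * k)) (\<lambda>\<tau>. Useries t k k (-1) (qexp \<tau>)) \<and>
      mixed_quasimodular 2 (int (2 * t * k)) (\<lambda>\<tau>. Useries t k k 2 (qexp \<tau>)))"
proof -
  have s4: "cot_span (1 / of_nat 4) {..<1 * s} (\<lambda>w. kern 0 w ^ s)" if "s \<ge> 1" for s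
    using torsion_point_span[OF torsion_points(1) _ that] by simp
  have s3: "cot_span (1 / of_nat 3) {..<1 * s} (\<lambda>w. kern 1 w ^ s)" if "s \<ge> 1" for s
    using torsion_point_span[OF torsion_points(2) _ that] by simp
  have s6: "cot_span (1 / of_nat 6) {..<1 * s} (\<lambda>w. kern (- 1) w ^ s)" if "s \<ge> 1" for s
    using torsion_point_span[OF torsion_points(3) _ that] by simp
  have s2: "cot_span (1 / of_nat 2) {..<2 * s} (\<lambda>w. kern 2 w ^ s)" if "s \<ge> 1" for s
    by (rule torsion_point.cot_span_kern_power_double[OF torsion_points(4) qexp_half that])
  note q4 = mixed_quasimodular_Useries[where N = 4, OF _ s4 \<open>k \<ge> 1\<close>]
  note q3 = mixed_quasimodular_Useries[where N = 3, OF _ s3 \<open>k \<ge> 1\<close>]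
  note q6 = mixed_quasimodular_Useries[where N = 6, OF _ s6 \<open>k \<ge> 1\<close>]
  note q2 = mixed_quasimodular_Useries[where N = 2, OF _ s2 \<open>k \<ge> 1\<close>]
  have odd: "mixed_modular 4 (int k) (\<lambda>\<tau>. Useries1 k k 0 (qexp \<tau>))" if "odd k"
    unfolding mixed_modular_iff
  proof (rule weight_graded.mixed_Useries1[OF weight_graded_modular])
    have "qexp (1 / of_nat 4) \<noteq> inverse (qexp (1 / of_nat 4))"
      using torsion_point.a_sq[OF torsion_points(1)] by auto
    then show "cot_span (1 / of_nat 4) {j. j < k \<and> even j} (\<lambda>w. kern 0 w ^ k)"
      by (rule torsion_point.cot_span_kern_power_odd[OF torsion_points(1) _ refl that])
    show "modular 4 (int (Suc j)) (eis j (1 / of_nat 4))" if "j \<in> {j. j < k \<and> even j}" for j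
      using that by (intro eis_torsion_modular) auto
  qed auto
  have isobaric: "\<exists>P. isobaric t P \<and> (\<forall>a. U_formal t k k a = eval_rat_mpoly P (\<lambda>s. U1_formal (s * k) (s * k) a))"
    by (rule ex_isobaric_newton[OF U_formal_0 U_formal_newton[OF \<open>k \<ge> 1\<close>]])
  show ?thesis
    using q4 q3 q6 q2 odd isobaric by (simp add: mult.assoc del: of_nat_mult)
qed

end
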